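(* Assume the standing assumptions of the context. Then for every $\alpha\in(\underline{\alpha},\overline{\alpha}]$ and $p\in[p_0,q)$, the set $\mathcal{G}_{p,\alpha}=\{\mu\in\mathcal{G}:\mu[L^p(\mathsf{V},w_\alpha)]=1\}$ is non-void and compact in the weak topology of $\mathcal{P}(\mathit{\Omega})$. For every $\lambda>0$ and $x\in\mathsf{V}$ there exists $C(p,\alpha;\lambda,x)>0$ such that for all $\mu\in\mathcal{G}_{p,\alpha}$, $$\int_{\mathit{\Omega}}\exp\left(\lambda|\omega(x)|^p\right)\mu(d\omega)\le C(p,\alpha;\lambda,x),$$ and for every $\lambda>0$ there exists $C(p,\alpha;\lambda)>0$ such that for all $\mu\in\mathcal{G}_{p,\alpha}$, $$\int_{\mathit{\Omega}}\exp\left(\lambda\|\omega\|^p_{p,\alpha}\right)\mu(d\omega)\le C(p,\alpha;\lambda).$$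
   Context: $\mathsf{G}=(\mathsf{V},\mathsf{E})$ is a countable, connected, locally finite undirected graph; $x\sim y$ denotes adjacency, $n(x)$ the degree, $\rho$ the path distance. A root $o\in\mathsf{V}$ is fixed; $w_\alpha(x)=\exp[-\alpha\rho(o,x)]$. For $\theta>0$, $m_\theta(x)=\sum_{y\sim x}[n(x)n(y)]^\theta$ and $\mathit{\Theta}(\alpha,\theta)=\sum_xm_\theta(x)w_\alpha(x)$. Standing assumptions: $\theta>0$ is fixed and $\mathit{\Theta}(\alpha,\theta)<\infty$ for some $\alpha>0$; $W:\mathbb{R}^2\to\mathbb{R}$ is continuous, symmetric, with $|W(u,v)|\le[I_W+J_W(|u|^r+|v|^r)]/2$ for some $I_W,J_W,r>0$; $V:\mathbb{R}\to\mathbb{R}$ is continuous with $V(u)\ge a_V|u|^q-c_V$ for some $a_V,c_V>0$ and $q>r+r/\theta$. Set $\underline{\alpha}=\inf\{\alpha:\mathit{\Theta}(\alpha,\theta)<\infty\}$, let $\overline{\alpha}>\underline{\alpha}$ be such that $\mathit{\Theta}(\alpha,\theta)<\infty$ for all $\alpha\in(\underline{\alpha},\overline{\alpha}]$, and $p_0=r+r/\theta$. $\mathit{\Omega}=\mathbb{R}^{\mathsf{V}}$ with the product topology and Borel $\sigma$-field; $\mathcal{P}(\mathit{\Omega})$ = Borel probability measures with the weak topology (bounded continuous test functions). $\|\omega\|_{p,\alpha}=[\sum_x|\omega(x)|^pw_\alpha(x)]^{1/p}$, $L^p(\mathsf{V},w_\alpha)=\{\omega:\|\omega\|_{p,\alpha}<\infty\}$.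 For finite non-void $\mathit{\Lambda}\subset\mathsf{V}$ and $\xi\in\mathit{\Omega}$: $H_{\mathit{\Lambda}}(\omega_{\mathit{\Lambda}}|\xi)=\sum_{\langle x,y\rangle\in\mathsf{E}:x,y\in\mathit{\Lambda}}W(\omega(x),\omega(y))+\sum_{\langle x,y\rangle\in\mathsf{E}:x\in\mathit{\Lambda},y\notin\mathit{\Lambda}}W(\omega(x),\xi(y))+\sum_{x\in\mathit{\Lambda}}V(\omega(x))$ and $\pi_{\mathit{\Lambda}}(A|\xi)=Z_{\mathit{\Lambda}}(\xi)^{-1}\int_{\mathbb{R}^{\mathit{\Lambda}}}\mathbb{I}_A(\omega_{\mathit{\Lambda}}\times\xi_{\mathit{\Lambda}^c})e^{-H_{\mathit{\Lambda}}(\omega_{\mathit{\Lambda}}|\xi)}d\omega_{\mathit{\Lambda}}$ with $Z_{\mathit{\Lambda}}(\xi)$ the normalizing constant. $\mathcal{G}$ is the set of $\mu\in\mathcal{P}(\mathit{\Omega})$ with $\mu(A)=\int\pi_{\mathit{\Lambda}}(A|\omega)\mu(d\omega)$ for all Borel $A$ and all finite non-void $\mathit{\Lambda}$. *)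

theory Defs
  imports "HOL-Probability.Probability"
begin

text \<open>A graph on vertex type 'v is given by a symmetric irreflexive adjacency predicate.\<close>

definition degree :: "('v \<Rightarrow> 'v \<Rightarrow> bool) \<Rightarrow> 'v \<Rightarrow> nat" where
  "degree adj x = card {y. adj x y}"

definition graph_dist :: "('v \<Rightarrow> 'v \<Rightarrow> bool) \<Rightarrow> 'v \<Rightarrow> 'v \<Rightarrow> nat" where
  "graph_dist adj x y = (LEAST n. (adj ^^ n) x y)"

definition weight :: "('v \<Rightarrow> 'v \<Rightarrow> bool) \<Rightarrow> 'v \<Rightarrow> real \<Rightarrow> 'v \<Rightarrow> real" where
  "weight adj o' \<alpha> x = exp (- \<alpha> * real (graph_dist adj o' x))"

definition m_theta :: "('v \<Rightarrow> 'v \<Rightarrow> bool) \<Rightarrow> real \<Rightarrow> 'v \<Rightarrow> real" where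
  "m_theta adj \<theta> x = (\<Sum>y\<in>{y. adj x y}. (real (degree adj x) * real (degree adj y)) powr \<theta>)"

definition Theta :: "('v \<Rightarrow> 'v \<Rightarrow> bool) \<Rightarrow> 'v \<Rightarrow> real \<Rightarrow> real \<Rightarrow> ennreal" where
  "Theta adj o' \<alpha> \<theta> = (\<Sum>\<^sub>\<infinity>x. ennreal (m_theta adj \<theta> x * weight adj o' \<alpha> x))"

definition Lp_set :: "('v \<Rightarrow> 'v \<Rightarrow> bool) \<Rightarrow> 'v \<Rightarrow> real \<Rightarrow> real \<Rightarrow> ('v \<Rightarrow> real) set" where
  "Lp_set adj o' p \<alpha> = {\<omega>. (\<lambda>x. \<bar>\<omega> x\<bar> powr p * weight adj o' \<alpha> x) summable_on UNIV}"

text \<open>The p-th power of the weighted norm (meaningful on Lp_set; junk value 0 elsewhere).\<close>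
definition norm_pow :: "('v \<Rightarrow> 'v \<Rightarrow> bool) \<Rightarrow> 'v \<Rightarrow> real \<Rightarrow> real \<Rightarrow> ('v \<Rightarrow> real) \<Rightarrow> real" where
  "norm_pow adj o' p \<alpha> \<omega> = (\<Sum>\<^sub>\<infinity>x. \<bar>\<omega> x\<bar> powr p * weight adj o' \<alpha> x)"

text \<open>Configuration space: 'v \<Rightarrow> real with its product topology (type class instance)
  and its Borel sigma-field.\<close>

definition prob_measures :: "('v \<Rightarrow> real) measure set" where
  "prob_measures = {\<mu>. prob_space \<mu> \<and> sets \<mu> = sets (borel :: ('v \<Rightarrow> real) measure)}"

definition weak_topology :: "('v \<Rightarrow> real) measure topology" where
  "weak_topology = topology_generated_by
     {{\<mu> \<in> prob_measures. (\<integral>\<omega>. f \<omega> \<partial>\<mu>) \<in> U} | f U.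
        continuous_on UNIV f \<and> bounded (range f) \<and> open (U :: real set)}"

definition merge_cfg :: "'v set \<Rightarrow> ('v \<Rightarrow> real) \<Rightarrow> ('v \<Rightarrow> real) \<Rightarrow> ('v \<Rightarrow> real)" where
  "merge_cfg \<Lambda> \<omega> \<xi> = (\<lambda>x. if x \<in> \<Lambda> then \<omega> x else \<xi> x)"

text \<open>Local Hamiltonian. The first sum runs over edges with both ends in \<Lambda>, each edge
  counted once; with W symmetric this is half the sum over ordered adjacent pairs.\<close>
definition hamiltonian ::
  "('v \<Rightarrow> 'v \<Rightarrow> bool) \<Rightarrow> (real \<Rightarrow> real \<Rightarrow> real) \<Rightarrow> (real \<Rightarrow> real) \<Rightarrow> 'v set
    \<Rightarrow> ('v \<Rightarrow> real) \<Rightarrow> ('v \<Rightarrow> real) \<Rightarrow> real" where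
  "hamiltonian adj W V \<Lambda> \<omega> \<xi> =
     (let \<eta> = merge_cfg \<Lambda> \<omega> \<xi> in
        (\<Sum>(x,y)\<in>{(x,y). x \<in> \<Lambda> \<and> y \<in> \<Lambda> \<and> adj x y}. W (\<eta> x) (\<eta> y)) / 2
      + (\<Sum>(x,y)\<in>{(x,y). x \<in> \<Lambda> \<and> y \<notin> \<Lambda> \<and> adj x y}. W (\<eta> x) (\<xi> y))
      + (\<Sum>x\<in>\<Lambda>. V (\<eta> x)))"

definition partition_fn ::
  "('v \<Rightarrow> 'v \<Rightarrow> bool) \<Rightarrow> (real \<Rightarrow> real \<Rightarrow> real) \<Rightarrow> (real \<Rightarrow> real) \<Rightarrow> 'v set
    \<Rightarrow> ('v \<Rightarrow> real) \<Rightarrow> ennreal" where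
  "partition_fn adj W V \<Lambda> \<xi> =
     (\<integral>\<^sup>+ \<omega>. ennreal (exp (- hamiltonian adj W V \<Lambda> \<omega> \<xi>)) \<partial>(PiM \<Lambda> (\<lambda>_. lborel)))"

definition local_spec ::
  "('v \<Rightarrow> 'v \<Rightarrow> bool) \<Rightarrow> (real \<Rightarrow> real \<Rightarrow> real) \<Rightarrow> (real \<Rightarrow> real) \<Rightarrow> 'v set
    \<Rightarrow> ('v \<Rightarrow> real) set \<Rightarrow> ('v \<Rightarrow> real) \<Rightarrow> ennreal" where
  "local_spec adj W V \<Lambda> A \<xi> =
     (\<integral>\<^sup>+ \<omega>. indicator A (merge_cfg \<Lambda> \<omega> \<xi>) * ennreal (exp (- hamiltonian adj W V \<Lambda> \<omega> \<xi>))
        \<partial>(PiM \<Lambda> (\<lambda>_. lborel))) / partition_fn adj W V \<Lambda> \<xi>"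

definition gibbs_measures ::
  "('v \<Rightarrow> 'v \<Rightarrow> bool) \<Rightarrow> (real \<Rightarrow> real \<Rightarrow> real) \<Rightarrow> (real \<Rightarrow> real) \<Rightarrow> ('v \<Rightarrow> real) measure set" where
  "gibbs_measures adj W V = {\<mu> \<in> prob_measures.
     \<forall>\<Lambda> A. finite \<Lambda> \<and> \<Lambda> \<noteq> {} \<and> A \<in> sets (borel :: ('v \<Rightarrow> real) measure) \<longrightarrow>
       emeasure \<mu> A = (\<integral>\<^sup>+ \<omega>. local_spec adj W V \<Lambda> A \<omega> \<partial>\<mu>)}"

definition gibbs_Lp ::
  "('v \<Rightarrow> 'v \<Rightarrow> bool) \<Rightarrow> (real \<Rightarrow> real \<Rightarrow> real) \<Rightarrow> (real \<Rightarrow> real) \<Rightarrow> 'v \<Rightarrow> real \<Rightarrow> real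
    \<Rightarrow> ('v \<Rightarrow> real) measure set" where
  "gibbs_Lp adj W V o' p \<alpha> = {\<mu> \<in> gibbs_measures adj W V. measure \<mu> (Lp_set adj o' p \<alpha>) = 1}"

end

theory Submission
  imports Defs
begin

text \<open>By Young's inequality, the logarithm of the moment of \<open>exp (l * \<bar>\<omega> x\<bar> powr p)\<close> under the
  single-site kernel at \<open>x\<close> is at most a constant times \<open>1 + m_theta x\<close> plus a small multiple \<open>\<kappa>\<close> of
  the neighbouring \<open>\<bar>\<xi> y\<bar> powr p / (deg x * deg y)\<close>; here \<open>p \<ge> r + r / \<theta>\<close> is exactly what makes the
  degrees enter through \<open>m_theta\<close>. Integrating this against a finite-volume kernel, by consistency and
  Hoelder's inequality, gives a linear system of inequalities for the logarithmic moments. Summed with the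
  weights, it closes for small \<open>\<kappa>\<close> and bounds the exponential moment of the weighted norm by a constant
  and the weighted norm of the boundary condition next to the volume, which vanishes in the infinite-volume
  limit for tempered boundary conditions. So all tempered Gibbs measures, and the finite-volume
  measures with zero boundary condition, obey the same moment bounds and form a tight family. Weak limits
  inherit the bounds, and are Gibbs because the kernels are Feller.

  Prokhorov's theorem on the countable product of lines is reduced to Helly's theorem on the line by
  coding configurations as points of the Cantor set.\<close>

section \<open>Weak convergence and compactness\<close>

text \<open>Three obstacles shape the proof. First, full mass on the tempered configurations need
  not survive weak limits. It is therefore traded for the condition \<open>moment_bounded\<close>,
  which does survive, holds with one constant per exponent, and for Gibbs measures is equivalent to
  full mass. Second, absorbing the logarithmic moments into themselves is legitimate only if they
  are finite. Hence the estimates are made in finite volume, where crude volume-dependent domination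
  gives finiteness. Degrees may be unbounded: dividing by the product of the degrees of the two ends
  makes the neighbour matrix substochastic in rows and columns. Third, the weak topology is given
  only by a subbase. Compactness is obtained by embedding the measures into a countable product of
  lines through a determining family. In the proof of Prokhorov's theorem the codes lie in the unit
  interval, so tightness of their laws is free; tightness of the spins serves to keep the decoded
  angles away from the poles of the tangent.\<close>

lemma LIMSEQ_of_subsubseq:
  fixes X :: "nat \<Rightarrow> 'a::metric_space"
  assumes "\<And>s :: nat \<Rightarrow> nat. strict_mono s \<Longrightarrow> \<exists>r. strict_mono (r :: nat \<Rightarrow> nat) \<and> (\<lambda>n. X (s (r n))) \<longlonglongrightarrow> L"
  shows "X \<longlonglongrightarrow> L"
proof (rule ccontr)
  assume "\<not> X \<longlonglongrightarrow> L"
  then obtain e where "e > 0" and "infinite {n. \<not> dist (X n) L < e}"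
    by (auto simp: tendsto_iff not_eventually INFM_iff_infinite cofinite_eq_sequentially[symmetric])
  then obtain s :: "nat \<Rightarrow> nat" where s: "\<And>n. \<not> dist (X (s n)) L < e" and "strict_mono s"
    using enumerate_in_set enumerate_mono by (fastforce simp: strict_mono_def)
  with assms[of s] obtain r where "(\<lambda>n. X (s (r n))) \<longlonglongrightarrow> L" by blast
  with s \<open>e > 0\<close> show False by (auto dest: tendstoD)
qed

lemma tendsto_fun_iff:
  fixes f :: "'a \<Rightarrow> 'b \<Rightarrow> 'c::topological_space"
  shows "(f \<longlongrightarrow> l) F \<longleftrightarrow> (\<forall>i. ((\<lambda>x. f x i) \<longlongrightarrow> l i) F)"
  using limitin_componentwise[of "\<lambda>_. euclidean :: 'c topology" UNIV f l F]
  by (simp add: euclidean_product_topology)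

definition converges_weakly :: "(nat \<Rightarrow> 'a::topological_space measure) \<Rightarrow> 'a measure \<Rightarrow> bool" where
  "converges_weakly \<mu>s \<mu> \<longleftrightarrow> (\<forall>f. continuous_on UNIV f \<longrightarrow> bounded (range f) \<longrightarrow>
     (\<lambda>n. \<integral>z. f z \<partial>\<mu>s n) \<longlonglongrightarrow> (\<integral>z. (f z :: real) \<partial>\<mu>))"

lemma converges_weaklyD:
  assumes "converges_weakly \<mu>s \<mu>" "continuous_on UNIV f" "\<And>z. \<bar>f z\<bar> \<le> B"
  shows "(\<lambda>n. \<integral>z. f z \<partial>\<mu>s n) \<longlonglongrightarrow> (\<integral>z. (f z :: real) \<partial>\<mu>)"
  using assms unfolding converges_weakly_def by (auto simp: bounded_iff)

text \<open>The case \<open>U = UNIV\<close> is separate because \<open>infdist z {} = 0\<close>.\<close>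

definition open_approx :: "'a::metric_space set \<Rightarrow> nat \<Rightarrow> 'a \<Rightarrow> real" where
  "open_approx U k z = (if U = UNIV then 1 else min 1 (real k * infdist z (- U)))"

lemma continuous_open_approx: "continuous_on UNIV (open_approx U k)"
  unfolding open_approx_def
  by (cases "U = UNIV") (auto intro!: continuous_intros)

lemma open_approx_bounds: "0 \<le> open_approx U k z" "open_approx U k z \<le> 1"
  by (auto simp: open_approx_def infdist_nonneg)

lemma abs_open_approx: "\<bar>open_approx U k z\<bar> \<le> 1"
  using open_approx_bounds[of U k z] by auto

lemma open_approx_eq_0: "z \<notin> U \<Longrightarrow> open_approx U k z = 0"
  by (auto simp: open_approx_def)

lemma open_approx_le_indicator: "open_approx U k z \<le> indicator U z"
  using open_approx_bounds[of U k z] by (auto simp: open_approx_eq_0 indicator_def)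

lemma open_approx_tendsto:
  assumes "open U"
  shows "(\<lambda>k. open_approx U k z) \<longlonglongrightarrow> indicator U z"
proof (cases "U = UNIV \<or> z \<notin> U")
  case True
  then show ?thesis by (auto simp: open_approx_eq_0) (simp add: open_approx_def)
next
  case False
  then have "infdist z (- U) \<noteq> 0"
    using in_closed_iff_infdist_zero[of "- U" z] assms by auto
  then have pos: "infdist z (- U) > 0"
    using infdist_nonneg[of z "- U"] by linarith
  obtain N where N: "real N * infdist z (- U) > 1"
    using reals_Archimedean3[OF pos] by auto
  have "open_approx U k z = indicator U z" if "k \<ge> N" for k
  proof -
    have "real k * infdist z (- U) \<ge> real N * infdist z (- U)"
      using that pos by (intro mult_right_mono) auto
    with N False show ?thesis by (simp add: open_approx_def)
  qed
  then show ?thesis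
    by (intro tendsto_eventually eventually_sequentiallyI[of N]) auto
qed

lemma integral_open_approx_tendsto:
  fixes \<mu> :: "'a::metric_space measure"
  assumes "finite_measure \<mu>" "sets \<mu> = sets borel" "open U"
  shows "(\<lambda>k. \<integral>z. open_approx U k z \<partial>\<mu>) \<longlonglongrightarrow> measure \<mu> U"
proof -
  interpret finite_measure \<mu> by fact
  note [measurable_cong] = assms(2)
  have [measurable]: "U \<in> sets borel" using assms(3) by simp
  have [measurable]: "open_approx U k \<in> borel_measurable borel" for k
    by (intro borel_measurable_continuous_onI continuous_open_approx)
  have "(\<lambda>k. \<integral>z. open_approx U k z \<partial>\<mu>) \<longlonglongrightarrow> (\<integral>z. indicator U z \<partial>\<mu>)"
    by (rule integral_dominated_convergence[where w = "\<lambda>_. 1"])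
       (auto intro!: AE_I2 open_approx_tendsto[OF assms(3)] abs_open_approx)
  then show ?thesis
    using sets_eq_imp_space_eq[OF assms(2)] by simp
qed

text \<open>The indicator of an open set is a pointwise limit of continuous functions below it: the
  bound passes first to the weak limit and then to the set.\<close>

lemma measure_open_le_of_converges_weakly:
  fixes \<mu> :: "'a::metric_space measure"
  assumes "converges_weakly \<mu>s \<mu>" "open U"
    and ps: "\<And>n. prob_space (\<mu>s n)" "\<And>n. sets (\<mu>s n) = sets borel"
    and p: "prob_space \<mu>" "sets \<mu> = sets borel"
    and le: "\<And>n. measure (\<mu>s n) U \<le> e"
  shows "measure \<mu> U \<le> e"
proof -
  interpret prob_space \<mu> by fact
  have [measurable]: "U \<in> sets borel" using assms(2) by simp
  have [measurable]: "open_approx U k \<in> borel_measurable borel" for k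
    by (intro borel_measurable_continuous_onI continuous_open_approx)
  have "(\<integral>z. open_approx U k z \<partial>\<mu>) \<le> e" for k
  proof (rule LIMSEQ_le_const2)
    show "(\<lambda>n. \<integral>z. open_approx U k z \<partial>\<mu>s n) \<longlonglongrightarrow> (\<integral>z. open_approx U k z \<partial>\<mu>)"
      using assms(1) continuous_open_approx abs_open_approx by (rule converges_weaklyD)
    have "(\<integral>z. open_approx U k z \<partial>\<mu>s n) \<le> e" for n
    proof -
      interpret n: prob_space "\<mu>s n" by fact
      note [measurable_cong] = ps(2)[of n]
      have "(\<integral>z. open_approx U k z \<partial>\<mu>s n) \<le> (\<integral>z. indicator U z \<partial>\<mu>s n)"
        by (intro integral_mono n.integrable_const_bound[where B = 1] AE_I2)
           (auto simp: abs_open_approx open_approx_le_indicator)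
      also have "\<dots> = measure (\<mu>s n) U"
        using sets_eq_imp_space_eq[OF ps(2)[of n]] by simp
      finally show ?thesis using le[of n] by linarith
    qed
    then show "\<exists>N. \<forall>n\<ge>N. (\<integral>z. open_approx U k z \<partial>\<mu>s n) \<le> e" by auto
  qed
  then show ?thesis
    using LIMSEQ_le_const2[OF integral_open_approx_tendsto[OF _ p(2) assms(2)]] finite_measure_axioms
    by blast
qed

text \<open>Integrals of \<open>open_approx\<close> recover the measure of an open set, and the
  finite intersections of a countable basis form a pi-system generating the Borel sets. Countability
  puts the values into a metrizable product of lines.\<close>

lemma countable_determining_family:
  "\<exists>d :: nat list \<times> nat \<Rightarrow> 'a::{metric_space,second_countable_topology} \<Rightarrow> real.
    (\<forall>i. continuous_on UNIV (d i)) \<and> (\<forall>i z. \<bar>d i z\<bar> \<le> 1) \<and>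
    (\<forall>\<mu> \<nu>. prob_space \<mu> \<longrightarrow> prob_space \<nu> \<longrightarrow> sets \<mu> = sets borel \<longrightarrow> sets \<nu> = sets borel \<longrightarrow>
       (\<forall>i. (\<integral>z. d i z \<partial>\<mu>) = (\<integral>z. d i z \<partial>\<nu>)) \<longrightarrow> \<mu> = \<nu>)"
proof -
  obtain B :: "'a set set" where B: "countable B" "topological_basis B"
    using ex_countable_basis by auto
  have "B \<noteq> {}"
    using topological_basisE[OF B(2) open_UNIV UNIV_I] by auto
  \<comment> \<open>Lists of indices encode finite intersections of basis sets; the empty list
    supplies the whole space.\<close>
  define U where "U l = (\<Inter>i\<in>set l. from_nat_into B i)" for l
  have openU: "open (U l)" for l
    unfolding U_def using from_nat_into[OF \<open>B \<noteq> {}\<close>] topological_basis_open[OF B(2)]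
    by (intro open_INT) auto
  have U_append: "U (l @ l') = U l \<inter> U l'" for l l' unfolding U_def by auto
  have U_Nil: "U [] = UNIV" unfolding U_def by simp
  have sub: "B \<subseteq> range U"
  proof
    fix b assume "b \<in> B"
    then have "b = U [to_nat_on B b]"
      unfolding U_def using B(1) by simp
    then show "b \<in> range U" by blast
  qed
  have "sets (sigma UNIV B) = sigma_sets UNIV B" by (rule sets_measure_of) simp
  then have borelB: "sets (borel :: 'a measure) = sigma_sets UNIV B"
    using borel_eq_countable_basis[OF B] by simp
  have sig: "sets (borel :: 'a measure) = sigma_sets UNIV (range U)"
  proof
    show "sets (borel :: 'a measure) \<subseteq> sigma_sets UNIV (range U)"
      unfolding borelB using sub by (rule sigma_sets_mono')
    show "sigma_sets UNIV (range U) \<subseteq> sets (borel :: 'a measure)"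
      using openU by (intro sets.sigma_sets_subset'[of _ borel, simplified]) auto
  qed
  show ?thesis
  proof (intro exI[of _ "\<lambda>(l, k). open_approx (U l) k"] conjI allI impI)
    show "continuous_on UNIV (case i of (l, k) \<Rightarrow> open_approx (U l) k)" for i
      by (auto simp: continuous_open_approx split: prod.split)
    show "\<bar>(case i of (l, k) \<Rightarrow> open_approx (U l) k) z\<bar> \<le> 1" for i z
      by (auto simp: abs_open_approx split: prod.split)
    fix \<mu> \<nu> :: "'a measure"
    assume \<mu>: "prob_space \<mu>" "sets \<mu> = sets borel" and \<nu>: "prob_space \<nu>" "sets \<nu> = sets borel"
      and eq: "\<forall>i. (\<integral>z. (case i of (l, k) \<Rightarrow> open_approx (U l) k) z \<partial>\<mu>)
        = (\<integral>z. (case i of (l, k) \<Rightarrow> open_approx (U l) k) z \<partial>\<nu>)"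
    interpret M: prob_space \<mu> by fact
    interpret N: prob_space \<nu> by fact
    have eqU: "emeasure \<mu> (U l) = emeasure \<nu> (U l)" for l
    proof -
      have "(\<lambda>k. \<integral>z. open_approx (U l) k z \<partial>\<mu>) = (\<lambda>k. \<integral>z. open_approx (U l) k z \<partial>\<nu>)"
        using eq by simp
      then have "measure \<mu> (U l) = measure \<nu> (U l)"
        using integral_open_approx_tendsto[OF M.finite_measure_axioms \<mu>(2) openU[of l]]
          integral_open_approx_tendsto[OF N.finite_measure_axioms \<nu>(2) openU[of l]]
        by (metis LIMSEQ_unique)
      then show ?thesis by (simp add: M.emeasure_eq_measure N.emeasure_eq_measure)
    qed
    show "\<mu> = \<nu>"
    proof (rule measure_eqI_generator_eq[where E = "range U" and \<Omega> = UNIV and A = "\<lambda>_. UNIV"])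
      show "Int_stable (range U)"
        by (auto simp: Int_stable_def U_append[symmetric])
      show "range (\<lambda>_. UNIV) \<subseteq> range U" by (auto simp: U_Nil[symmetric])
      show "emeasure \<mu> X = emeasure \<nu> X" if "X \<in> range U" for X using that eqU by auto
      show "sets \<mu> = sigma_sets UNIV (range U)" "sets \<nu> = sigma_sets UNIV (range U)"
        using \<mu> \<nu> sig by auto
    qed auto
  qed
qed

text \<open>The determining family embeds \<open>K\<close> into a countable product of lines, where
  sequential compactness is compactness. The inverse of this embedding is continuous into
  \<open>weak_topology\<close>, so \<open>K\<close> is a continuous image of a compact set, and no
  metric for the weak topology has to be constructed.\<close>

lemma compactin_weak_topologyI:
  fixes K :: "('v::countable \<Rightarrow> real) measure set"
  assumes K: "K \<subseteq> prob_measures"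
    and seq: "\<And>\<mu>s. (\<And>n. \<mu>s n \<in> K) \<Longrightarrow>
      \<exists>r \<mu>. strict_mono (r :: nat \<Rightarrow> nat) \<and> \<mu> \<in> K \<and> converges_weakly (\<mu>s \<circ> r) \<mu>"
  shows "compactin weak_topology K"
proof -
  obtain d :: "nat list \<times> nat \<Rightarrow> ('v \<Rightarrow> real) \<Rightarrow> real" where
    D: "(\<forall>i. continuous_on UNIV (d i)) \<and> (\<forall>i z. \<bar>d i z\<bar> \<le> 1) \<and>
    (\<forall>\<mu> \<nu>. prob_space \<mu> \<longrightarrow> prob_space \<nu> \<longrightarrow> sets \<mu> = sets borel \<longrightarrow> sets \<nu> = sets borel \<longrightarrow>
       (\<forall>i. (\<integral>z. d i z \<partial>\<mu>) = (\<integral>z. d i z \<partial>\<nu>)) \<longrightarrow> \<mu> = \<nu>)"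
    using countable_determining_family ..
  note d = D[THEN conjunct1, rule_format] D[THEN conjunct2, THEN conjunct1, rule_format]
    and det = D[THEN conjunct2, THEN conjunct2, rule_format]
  define \<Phi> where "\<Phi> \<mu> = (\<lambda>i. \<integral>z. d i z \<partial>\<mu>)" for \<mu>
  have inj: "inj_on \<Phi> K"
  proof (rule inj_onI)
    fix \<mu> \<nu> assume "\<mu> \<in> K" "\<nu> \<in> K" "\<Phi> \<mu> = \<Phi> \<nu>"
    moreover from this have "\<Phi> \<mu> i = \<Phi> \<nu> i" for i by simp
    then have "(\<integral>z. d i z \<partial>\<mu>) = (\<integral>z. d i z \<partial>\<nu>)" for i unfolding \<Phi>_def .
    ultimately show "\<mu> = \<nu>"
      using K by (intro det) (auto simp: prob_measures_def)
  qed
  have \<Phi>_lim: "(\<lambda>n. \<Phi> (\<mu>s n)) \<longlonglongrightarrow> \<Phi> \<mu>" if "converges_weakly \<mu>s \<mu>" for \<mu>s \<mu>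
    unfolding \<Phi>_def
    by (rule tendsto_fun_iff[THEN iffD2, rule_format]) (rule converges_weaklyD[OF that d])
  define \<Psi> where "\<Psi> = inv_into K \<Phi>"
  have \<Psi>\<Phi>: "\<Psi> (\<Phi> \<mu>) = \<mu>" if "\<mu> \<in> K" for \<mu>
    unfolding \<Psi>_def using inj that by simp
  have "seq_compact (\<Phi> ` K)"
  proof (rule seq_compactI)
    fix f :: "nat \<Rightarrow> nat list \<times> nat \<Rightarrow> real" assume "\<forall>n. f n \<in> \<Phi> ` K"
    then have "\<forall>n. \<exists>\<mu>. \<mu> \<in> K \<and> f n = \<Phi> \<mu>" unfolding image_iff Bex_def .
    from choice[OF this] obtain \<mu>s where "\<forall>n. \<mu>s n \<in> K \<and> f n = \<Phi> (\<mu>s n)" ..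
    then have \<mu>s: "\<And>n. \<mu>s n \<in> K" "\<And>n. f n = \<Phi> (\<mu>s n)" by simp_all
    obtain r \<mu> where r: "strict_mono (r :: nat \<Rightarrow> nat)" "\<mu> \<in> K" "converges_weakly (\<mu>s \<circ> r) \<mu>"
      using seq[of \<mu>s, OF \<mu>s(1)] by (elim exE conjE) (rule that)
    moreover have "(f \<circ> r) \<longlonglongrightarrow> \<Phi> \<mu>"
      using \<Phi>_lim[OF r(3)] \<mu>s(2) by (simp add: comp_def)
    ultimately show "\<exists>l\<in>\<Phi> ` K. \<exists>r. strict_mono r \<and> (f \<circ> r) \<longlonglongrightarrow> l"
      by (intro bexI[of _ "\<Phi> \<mu>"] exI[of _ r] conjI imageI)
  qed
  then have "compact (\<Phi> ` K)" by (simp add: compact_eq_seq_compact_metric)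
  then have "compactin (top_of_set (\<Phi> ` K)) (\<Phi> ` K)"
    by (simp add: compactin_subtopology)
  moreover have "continuous_map (top_of_set (\<Phi> ` K)) weak_topology \<Psi>"
    unfolding weak_topology_def
  proof (rule continuous_on_generated_topo)
    \<comment> \<open>A map into a generated topology must land in the union of the generating sets;
      the constant test function 0 with \<open>U = UNIV\<close> shows that this union contains
      \<open>prob_measures\<close>.\<close>
    have "\<Psi> ` \<Phi> ` K \<subseteq> prob_measures" using \<Psi>\<Phi> K by auto
    also have "\<dots> = {\<mu> \<in> prob_measures. (\<integral>\<omega>. 0 \<partial>\<mu>) \<in> (UNIV :: real set)}" by simp
    also have "\<dots> \<subseteq> \<Union> {{\<mu> \<in> prob_measures. (\<integral>\<omega>. f \<omega> \<partial>\<mu>) \<in> U} | (f :: ('v \<Rightarrow> real) \<Rightarrow> real) U.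
        continuous_on UNIV f \<and> bounded (range f) \<and> open (U :: real set)}"
    proof (rule Union_upper, rule CollectI, intro exI conjI)
      show "bounded (range (\<lambda>_ :: 'v \<Rightarrow> real. 0 :: real))" by (auto intro: boundedI)
    qed (rule refl, auto)
    finally show "\<Psi> ` topspace (top_of_set (\<Phi> ` K)) \<subseteq> \<dots>" by simp
    fix S :: "('v \<Rightarrow> real) measure set"
    assume "S \<in> {{\<mu> \<in> prob_measures. (\<integral>\<omega>. f \<omega> \<partial>\<mu>) \<in> U} | f U.
        continuous_on UNIV f \<and> bounded (range f) \<and> open (U :: real set)}"
    then obtain f :: "('v \<Rightarrow> real) \<Rightarrow> real" and U where
      S: "S = {\<mu> \<in> prob_measures. (\<integral>\<omega>. f \<omega> \<partial>\<mu>) \<in> U}" and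
      f: "continuous_on UNIV f" "bounded (range f)" and U: "open U" by blast
    have "continuous_on (\<Phi> ` K) (\<lambda>z. \<integral>\<omega>. f \<omega> \<partial>\<Psi> z)"
    proof (rule continuous_on_sequentiallyI)
      fix u a assume u: "\<forall>n. u n \<in> \<Phi> ` K" and a: "a \<in> \<Phi> ` K" and lim: "u \<longlonglongrightarrow> a"
      from a obtain \<mu> where \<mu>: "\<mu> \<in> K" "a = \<Phi> \<mu>" by auto
      show "(\<lambda>n. \<integral>\<omega>. f \<omega> \<partial>\<Psi> (u n)) \<longlonglongrightarrow> (\<integral>\<omega>. f \<omega> \<partial>\<Psi> a)"
      \<comment> \<open>Every subsequence of preimages has a further one with a weak limit \<nu> in
        \<open>K\<close>. The coordinates of \<nu> are \<open>a\<close>, so injectivity of \<Phi>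
        identifies it, whatever the subsequence.\<close>
      proof (rule LIMSEQ_of_subsubseq)
        fix s :: "nat \<Rightarrow> nat" assume s: "strict_mono s"
        have inv: "\<Psi> (u n) \<in> K \<and> \<Phi> (\<Psi> (u n)) = u n" for n
          using u[rule_format, of n] by (auto simp: \<Psi>\<Phi>)
        obtain r \<nu> where r: "strict_mono (r :: nat \<Rightarrow> nat)" "\<nu> \<in> K"
          "converges_weakly ((\<lambda>n. \<Psi> (u (s n))) \<circ> r) \<nu>"
          using seq[of "\<lambda>n. \<Psi> (u (s n))", OF inv[THEN conjunct1]] by (elim exE conjE) (rule that)
        have "(\<lambda>n. u (s (r n))) \<longlonglongrightarrow> \<Phi> \<nu>"
          using \<Phi>_lim[OF r(3)] inv by (simp add: comp_def)
        moreover have "(\<lambda>n. u (s (r n))) \<longlonglongrightarrow> a"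
          using LIMSEQ_subseq_LIMSEQ[OF lim strict_mono_o[OF s r(1)]] by (simp add: comp_def)
        ultimately have "\<Phi> \<nu> = a" by (rule LIMSEQ_unique)
        then have "\<nu> = \<Psi> a" using \<Psi>\<Phi>[OF r(2)] by simp
        then have "(\<lambda>n. \<integral>\<omega>. f \<omega> \<partial>\<Psi> (u (s (r n)))) \<longlonglongrightarrow> (\<integral>\<omega>. f \<omega> \<partial>\<Psi> a)"
          using r(3) f by (auto simp: converges_weakly_def comp_def)
        then show "\<exists>r. strict_mono r \<and> (\<lambda>n. \<integral>\<omega>. f \<omega> \<partial>\<Psi> (u (s (r n)))) \<longlonglongrightarrow> (\<integral>\<omega>. f \<omega> \<partial>\<Psi> a)"
          using r(1) by blast
      qed
    qed
    then have "openin (top_of_set (\<Phi> ` K)) (\<Phi> ` K \<inter> (\<lambda>z. \<integral>\<omega>. f \<omega> \<partial>\<Psi> z) -` U)"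
      using U by (rule continuous_openin_preimage_gen)
    moreover have "\<Phi> ` K \<inter> (\<lambda>z. \<integral>\<omega>. f \<omega> \<partial>\<Psi> z) -` U = \<Psi> -` S \<inter> \<Phi> ` K"
    proof -
      have "z \<in> \<Phi> ` K \<Longrightarrow> \<Psi> z \<in> prob_measures" for z
        using \<Psi>\<Phi> K by auto
      then show ?thesis unfolding S by blast
    qed
    ultimately show "openin (top_of_set (\<Phi> ` K)) (\<Psi> -` S \<inter> topspace (top_of_set (\<Phi> ` K)))"
      by simp
  qed
  ultimately have "compactin weak_topology (\<Psi> ` \<Phi> ` K)"
    by (rule image_compactin)
  also have "\<Psi> ` \<Phi> ` K = K" using \<Psi>\<Phi> by (simp add: image_image)
  finally show ?thesis .
qed

section \<open>Prokhorov's theorem for countable products of the line\<close>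

lemma binary_expansion:
  assumes "0 \<le> z" "z < (1::real)"
  shows "(\<lambda>j. real_of_int (\<lfloor>2 ^ Suc j * z\<rfloor> mod 2) / 2 ^ Suc j) sums z"
proof -
  have step: "real_of_int \<lfloor>2 * y\<rfloor> = 2 * real_of_int \<lfloor>y\<rfloor> + real_of_int (\<lfloor>2 * y\<rfloor> mod 2)" for y :: real
  proof -
    have "\<lfloor>2 * y\<rfloor> div 2 = \<lfloor>y\<rfloor>"
      using floor_divide_real_eq_div[of 2 "2 * y"] by simp
    then have "\<lfloor>2 * y\<rfloor> = 2 * \<lfloor>y\<rfloor> + \<lfloor>2 * y\<rfloor> mod 2" by presburger
    then show ?thesis by linarith
  qed
  \<comment> \<open>The first \<open>n\<close> digits add up to \<open>z\<close> rounded down to a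
    multiple of 2^-n, because \<open>step\<close> splits off one digit per doubling.\<close>
  have partial: "(\<Sum>j<n. real_of_int (\<lfloor>2 ^ Suc j * z\<rfloor> mod 2) / 2 ^ Suc j) = real_of_int \<lfloor>2 ^ n * z\<rfloor> / 2 ^ n" for n
  proof (induction n)
    case 0
    have "\<lfloor>z\<rfloor> = 0" using assms by (simp add: floor_eq_iff)
    then show ?case by simp
  next
    case (Suc n)
    then show ?case using step[of "2 ^ n * z"] by (simp add: field_simps)
  qed
  have "(\<lambda>n. real_of_int \<lfloor>2 ^ n * z\<rfloor> / 2 ^ n) \<longlonglongrightarrow> z"
  proof (rule tendsto_sandwich[of "\<lambda>n. z - (1/2) ^ n" _ _ "\<lambda>_. z"])
    show "\<forall>\<^sub>F n in sequentially. z - (1/2) ^ n \<le> real_of_int \<lfloor>2 ^ n * z\<rfloor> / 2 ^ n"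
    proof (rule always_eventually, rule allI)
      fix n :: nat
      have "2 ^ n * z - 1 \<le> real_of_int \<lfloor>2 ^ n * z\<rfloor>" by linarith
      then have "(2 ^ n * z - 1) / 2 ^ n \<le> real_of_int \<lfloor>2 ^ n * z\<rfloor> / 2 ^ n"
        by (rule divide_right_mono) simp
      then show "z - (1/2) ^ n \<le> real_of_int \<lfloor>2 ^ n * z\<rfloor> / 2 ^ n"
        by (simp add: field_simps power_divide)
    qed
    show "\<forall>\<^sub>F n in sequentially. real_of_int \<lfloor>2 ^ n * z\<rfloor> / 2 ^ n \<le> z"
    proof (rule always_eventually, rule allI)
      fix n :: nat
      have "real_of_int \<lfloor>2 ^ n * z\<rfloor> / 2 ^ n \<le> (2 ^ n * z) / 2 ^ n"
        by (rule divide_right_mono) auto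
      then show "real_of_int \<lfloor>2 ^ n * z\<rfloor> / 2 ^ n \<le> z" by simp
    qed
    have "(\<lambda>n. z - (1/2) ^ n) \<longlonglongrightarrow> z - 0"
      by (intro tendsto_intros LIMSEQ_power_zero) simp
    then show "(\<lambda>n. z - (1/2) ^ n) \<longlonglongrightarrow> z" by simp
  qed simp
  then show ?thesis unfolding sums_def partial .
qed

text \<open>Ternary expansion with digits 0 and 2, the usual parametrisation of the Cantor set. The
  middle-third gaps separate the digits, so they can be read back continuously, which fails for
  binary expansions.\<close>

definition cantor_sum :: "(nat \<Rightarrow> real) \<Rightarrow> real" where
  "cantor_sum b = (\<Sum>i. 2 * b i / 3 ^ Suc i)"

text \<open>A continuous function of period 2 that reads off the leading ternary digit of a point of the
  Cantor set (as 0 or 1).\<close>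

definition cantor_digit :: "real \<Rightarrow> real" where
  "cantor_digit s = max 0 (min 1 (1 / 2 - cos (pi * s)))"

lemma cantor_digit_bounds: "0 \<le> cantor_digit s" "cantor_digit s \<le> 1"
  by (auto simp: cantor_digit_def)

lemma continuous_cantor_digit:
  fixes f :: "real \<Rightarrow> real"
  shows "continuous_on A f \<Longrightarrow> continuous_on A (\<lambda>x. cantor_digit (f x))"
  unfolding cantor_digit_def
  by (intro continuous_intros) auto

lemma cantor_digit_periodic: "cantor_digit (2 * real n + s) = cantor_digit s"
proof -
  have "cos (pi * (2 * real n + s)) = cos (2 * pi * real_of_int (int n) + pi * s)"
    by (simp add: algebra_simps)
  also have "\<dots> = cos (pi * s)"
    unfolding cos_add cos_int_2pin sin_int_2pin by simp
  finally show ?thesis by (simp add: cantor_digit_def)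
qed

lemma cantor_digit_0:
  assumes "0 \<le> s" "s \<le> 1 / 3"
  shows "cantor_digit s = 0"
proof -
  have "cos (pi / 3) \<le> cos (pi * s)"
    using assms pi_gt_zero by (intro cos_monotone_0_pi_le) (auto simp: field_simps)
  then show ?thesis by (simp add: cantor_digit_def cos_60)
qed

lemma cantor_digit_1:
  assumes "2 / 3 \<le> s" "s \<le> 1"
  shows "cantor_digit s = 1"
proof -
  have "cos (pi * s) \<le> cos (2 * pi / 3)"
    using assms pi_gt_zero by (intro cos_monotone_0_pi_le) (auto simp: field_simps)
  then show ?thesis by (simp add: cantor_digit_def cos_120)
qed

lemma
  assumes b: "\<And>i. b i \<in> {0, 1::real}"
  shows cantor_sum_nonneg: "0 \<le> cantor_sum b"
    and cantor_sum_le: "cantor_sum b \<le> 1"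
    and cantor_sum_shift: "3 * cantor_sum b = 2 * b 0 + cantor_sum (\<lambda>i. b (Suc i))"
proof -
  have b01: "0 \<le> b i" "b i \<le> 1" for i using b[of i] by auto
  have geo: "(\<lambda>i. 2 / 3 * (1 / 3) ^ i) sums (2 / 3 * (1 / (1 - 1 / 3 :: real)))"
    by (intro sums_mult geometric_sums) simp
  have le: "2 * b i / 3 ^ Suc i \<le> 2 / 3 * (1 / 3) ^ i" for i
    using b01[of i] by (simp add: power_divide field_simps)
  have nonneg: "0 \<le> 2 * b i / 3 ^ Suc i" for i using b01[of i] by simp
  have s: "summable (\<lambda>i. 2 * b i / 3 ^ Suc i)"
  proof (rule summable_comparison_test'[OF sums_summable[OF geo]])
    show "norm (2 * b i / 3 ^ Suc i) \<le> 2 / 3 * (1 / 3) ^ i" for i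
      using le[of i] nonneg[of i] unfolding real_norm_def abs_of_nonneg[OF nonneg[of i]] by simp
  qed
  show "0 \<le> cantor_sum b" unfolding cantor_sum_def by (rule suminf_nonneg[OF s nonneg])
  have "cantor_sum b \<le> 2 / 3 * (1 / (1 - 1 / 3))"
    unfolding cantor_sum_def sums_unique[OF geo] by (rule suminf_le[OF le s sums_summable[OF geo]])
  then show "cantor_sum b \<le> 1" by simp
  have "cantor_sum b = 2 * b 0 / 3 + (\<Sum>i. 2 * b (Suc i) / 3 ^ Suc (Suc i))"
    unfolding cantor_sum_def using suminf_split_head[OF s] by simp
  also have "(\<Sum>i. 2 * b (Suc i) / 3 ^ Suc (Suc i)) = (\<Sum>i. (2 * b (Suc i) / 3 ^ Suc i) / 3)"
    by (simp add: field_simps)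
  also have "\<dots> = (\<Sum>i. 2 * b (Suc i) / 3 ^ Suc i) / 3"
  proof (rule suminf_divide)
    have "summable (\<lambda>i. 3 * (2 * b (Suc i) / 3 ^ Suc (Suc i)))"
      using s by (intro summable_mult) (simp add: summable_Suc_iff[of "\<lambda>i. 2 * b i / 3 ^ Suc i"] del: power_Suc)
    then show "summable (\<lambda>i. 2 * b (Suc i) / 3 ^ Suc i)" by simp
  qed
  finally show "3 * cantor_sum b = 2 * b 0 + cantor_sum (\<lambda>i. b (Suc i))"
    by (simp add: cantor_sum_def)
qed

text \<open>Multiplication by 3 turns the leading digit into an even integer, which stays even under
  further multiplications and is erased by the period 2 of \<open>cantor_digit\<close>. After
  \<open>k\<close> shifts the remaining point lies in the left or the right third.\<close>

lemma cantor_digit_cantor_sum: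
  assumes b: "\<And>i. b i \<in> {0, 1::real}"
  shows "cantor_digit (3 ^ k * cantor_sum b) = b k"
  using b
proof (induction k arbitrary: b)
  case 0
  define b' where "b' = (\<lambda>i. b (Suc i))"
  have b': "\<And>i. b' i \<in> {0, 1}" using 0 by (simp add: b'_def)
  note * = cantor_sum_shift[of b, OF 0] cantor_sum_nonneg[of b', OF b'] cantor_sum_le[of b', OF b']
  consider "b 0 = 0" | "b 0 = 1" using 0[of 0] by auto
  then show ?case
  proof cases
    case 1
    then show ?thesis using * by (simp add: cantor_digit_0 b'_def)
  next
    case 2
    then show ?thesis using * by (simp add: cantor_digit_1 b'_def)
  qed
next
  case (Suc k)
  have b0: "b 0 = 0 \<or> b 0 = 1" using Suc.prems[of 0] by auto
  have "3 ^ Suc k * cantor_sum b = 3 ^ k * (3 * cantor_sum b)" by simp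
  also have "\<dots> = 2 * real (if b 0 = 1 then 3 ^ k else 0) + 3 ^ k * cantor_sum (\<lambda>i. b (Suc i))"
    unfolding cantor_sum_shift[of b, OF Suc.prems] using b0 by (auto simp: algebra_simps)
  finally show ?case
    using Suc.IH[of "\<lambda>i. b (Suc i)"] Suc.prems by (simp add: cantor_digit_periodic)
qed

text \<open>The binary digits of all the (rescaled) arctangents of the coordinates are packed into one point of the Cantor set. The packing is
  only measurable, but the unpacking is continuous, and this is all the continuous mapping theorem needs.\<close>

lemma cantor_coding:
  obtains code :: "('v::countable \<Rightarrow> real) \<Rightarrow> real" and \<theta> :: "'v \<Rightarrow> real \<Rightarrow> real"
  where "code \<in> borel_measurable borel" "\<And>\<omega>. 0 \<le> code \<omega>" "\<And>\<omega>. code \<omega> \<le> 1"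
    "\<And>x. continuous_on UNIV (\<theta> x)" "\<And>x \<omega>. \<theta> x (code \<omega>) = arctan (\<omega> x)"
proof -
  \<comment> \<open>Rescales the arctangent into the unit interval without its endpoint 1, as
    \<open>binary_expansion\<close> requires.\<close>
  define u where "u \<omega> x = 1 / 2 + arctan (\<omega> x) / pi" for \<omega> :: "'v \<Rightarrow> real" and x
  \<comment> \<open>Digit \<open>j\<close> of the coordinate \<open>x\<close> is stored at position
    \<open>prod_encode (to_nat x, j)\<close>, so that countably many digit sequences share
    one.\<close>
  define b where "b \<omega> k = real_of_int (\<lfloor>2 ^ Suc (snd (prod_decode k)) * u \<omega> (from_nat (fst (prod_decode k)))\<rfloor> mod 2)"
    for \<omega> :: "'v \<Rightarrow> real" and k
  define code where "code \<omega> = cantor_sum (b \<omega>)" for \<omega>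
  define \<psi> where "\<psi> x t = (\<Sum>j. cantor_digit (3 ^ prod_encode (to_nat x, j) * t) / 2 ^ Suc j)"
    for x :: 'v and t
  have u01: "0 \<le> u \<omega> x" "u \<omega> x < 1" for \<omega> x
    unfolding u_def using arctan[of "\<omega> x"] by (auto simp: field_simps)
  have b01: "b \<omega> k \<in> {0, 1}" for \<omega> k
    using pos_mod_sign[of 2] pos_mod_bound[of 2] unfolding b_def by (simp, presburger)
  show thesis
  proof (rule that[of code "\<lambda>x t. pi * (\<psi> x t - 1 / 2)"])
    have [measurable]: "(\<lambda>\<omega>. u \<omega> x) \<in> borel_measurable borel" for x
      unfolding u_def by measurable
    have "(\<lambda>\<omega>. b \<omega> k) \<in> borel_measurable borel" for k
      unfolding b_def by measurable
    then show "code \<in> borel_measurable borel"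
      unfolding code_def cantor_sum_def by measurable
    show "0 \<le> code \<omega>" "code \<omega> \<le> 1" for \<omega>
      unfolding code_def by (intro cantor_sum_nonneg cantor_sum_le b01)+
    show "continuous_on UNIV (\<lambda>t. pi * (\<psi> x t - 1 / 2))" for x
    proof -
      have "uniform_limit UNIV (\<lambda>n t. \<Sum>j<n. cantor_digit (3 ^ prod_encode (to_nat x, j) * t) / 2 ^ Suc j)
        (\<psi> x) sequentially"
        unfolding \<psi>_def
      proof (rule Weierstrass_m_test)
        show "summable (\<lambda>j. 1 / 2 * (1 / 2 :: real) ^ j)"
          by (intro summable_mult summable_geometric) simp
        show "norm (cantor_digit (3 ^ prod_encode (to_nat x, j) * t) / 2 ^ Suc j) \<le> 1 / 2 * (1 / 2) ^ j" for j t
          using cantor_digit_bounds[of "3 ^ prod_encode (to_nat x, j) * t"]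
          by (simp add: power_divide field_simps)
      qed
      then have "continuous_on UNIV (\<psi> x)"
        by (rule uniform_limit_theorem[rotated])
           (auto intro!: always_eventually continuous_intros continuous_cantor_digit)
      then show ?thesis by (intro continuous_intros)
    qed
    show "pi * (\<psi> x (code \<omega>) - 1 / 2) = arctan (\<omega> x)" for x \<omega>
    proof -
      have "\<psi> x (code \<omega>) = (\<Sum>j. real_of_int (\<lfloor>2 ^ Suc j * u \<omega> x\<rfloor> mod 2) / 2 ^ Suc j)"
        unfolding \<psi>_def code_def cantor_digit_cantor_sum[OF b01] by (simp add: b_def)
      also have "\<dots> = u \<omega> x"
        using binary_expansion[OF u01] by (simp only: sums_iff)
      finally show ?thesis by (simp add: u_def)
    qed
  qed
qed

text \<open>Helly's theorem gives a limit of the laws of the codes, which is pushed forward by the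
  decoder \<open>dec\<close>. The decoder need not be continuous where an angle reaches a pole of
  the tangent; tightness shows that, up to small mass, it agrees with a continuous decoder of
  clipped angles.\<close>

lemma prokhorov_fun:
  fixes \<mu>s :: "nat \<Rightarrow> ('v::countable \<Rightarrow> real) measure"
  assumes ps: "\<And>n. prob_space (\<mu>s n)" and sets: "\<And>n. sets (\<mu>s n) = sets borel"
    and tight: "\<And>x e. e > 0 \<Longrightarrow> \<exists>R. \<forall>n. measure (\<mu>s n) {\<omega>. \<bar>\<omega> x\<bar> > R} \<le> e"
  shows "\<exists>r \<mu>. strict_mono (r :: nat \<Rightarrow> nat) \<and> prob_space \<mu> \<and> sets \<mu> = sets borel \<and>
    converges_weakly (\<mu>s \<circ> r) \<mu>"
proof -
  obtain code :: "('v \<Rightarrow> real) \<Rightarrow> real" and \<theta> :: "'v \<Rightarrow> real \<Rightarrow> real"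
    where code[measurable]: "code \<in> borel_measurable borel" and code01: "\<And>\<omega>. 0 \<le> code \<omega>" "\<And>\<omega>. code \<omega> \<le> 1"
      and \<theta>: "\<And>x. continuous_on UNIV (\<theta> x)" and \<theta>_code: "\<And>x \<omega>. \<theta> x (code \<omega>) = arctan (\<omega> x)"
    using cantor_coding[where 'v = 'v] by blast
  note [measurable_cong] = sets
  have [simp]: "space (\<mu>s n) = UNIV" for n using sets_eq_imp_space_eq[OF sets[of n]] by simp
  have [measurable]: "\<theta> x \<in> borel_measurable borel" for x
    by (intro borel_measurable_continuous_onI \<theta>)
  define \<nu>s where "\<nu>s n = distr (\<mu>s n) borel code" for n
  have \<nu>s: "real_distribution (\<nu>s n)" for n
    unfolding \<nu>s_def by (intro prob_space.real_distribution_distr ps) simp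
  \<comment> \<open>Automatic, as all codes lie in the unit interval. The hypothesis on the spins
    enters only through the set \<open>bad\<close> below.\<close>
  have "tight \<nu>s"
    unfolding tight_def
  proof (intro conjI allI impI)
    fix \<epsilon> :: real assume "0 < \<epsilon>"
    have "measure (\<nu>s n) {-1<..1} = 1" for n
    proof -
      have "-1 < code \<omega>" for \<omega> using code01(1)[of \<omega>] by linarith
      then have "code -` {-1<..1} = UNIV" using code01(2) by auto
      then show ?thesis
        unfolding \<nu>s_def using prob_space.prob_space[OF ps[of n]] by (subst measure_distr) simp_all
    qed
    with \<open>0 < \<epsilon>\<close> show "\<exists>a b. a < b \<and> (\<forall>n. 1 - \<epsilon> < measure (\<nu>s n) {a<..b})"
      by (intro exI[of _ "-1"] exI[of _ 1]) simp
  qed (rule \<nu>s)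
  then obtain r \<nu> where r: "strict_mono (r :: nat \<Rightarrow> nat)" and \<nu>: "real_distribution \<nu>"
    and "weak_conv_m (\<nu>s \<circ> id \<circ> r) \<nu>"
    using tight_imp_convergent_subsubsequence[of \<nu>s id] by (auto simp: strict_mono_id)
  then have wc: "weak_conv_m (\<nu>s \<circ> r) \<nu>" by simp
  interpret \<nu>: real_distribution \<nu> by fact
  have \<nu>_lim: "converges_weakly (\<nu>s \<circ> r) \<nu>"
    unfolding converges_weakly_def
  proof (intro allI impI)
    fix f :: "real \<Rightarrow> real" assume f: "continuous_on UNIV f" "bounded (range f)"
    then obtain B where "\<And>z. norm (f z) \<le> B" by (auto simp: bounded_iff)
    then show "(\<lambda>n. \<integral>z. f z \<partial>(\<nu>s \<circ> r) n) \<longlonglongrightarrow> (\<integral>z. f z \<partial>\<nu>)"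
      using f(1) by (intro weak_conv_imp_integral_bdd_continuous_conv[OF _ \<nu> wc])
        (auto simp: \<nu>s continuous_on_eq_continuous_at)
  qed
  define dec where "dec t = (\<lambda>x. tan (\<theta> x t))" for t
  have tan_m[measurable]: "tan \<in> borel_measurable (borel :: real measure)"
    unfolding tan_def[abs_def] by measurable
  have [measurable]: "dec \<in> borel_measurable borel"
    unfolding dec_def by (intro measurable_coordinatewise_then_product) measurable
  define \<mu> where "\<mu> = distr \<nu> borel dec"
  have \<mu>: "prob_space \<mu>" unfolding \<mu>_def by (intro \<nu>.prob_space_distr) simp
  have "converges_weakly (\<mu>s \<circ> r) \<mu>"
    unfolding converges_weakly_def
  proof (intro allI impI)
    fix f :: "('v \<Rightarrow> real) \<Rightarrow> real" assume f: "continuous_on UNIV f" and "bounded (range f)"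
    then obtain B where "B > 0" and B: "\<And>z. \<bar>f z\<bar> \<le> B" by (auto simp: bounded_pos)
    have [measurable]: "f \<in> borel_measurable borel" using f by (rule borel_measurable_continuous_onI)
    show "(\<lambda>n. \<integral>z. f z \<partial>(\<mu>s \<circ> r) n) \<longlonglongrightarrow> (\<integral>z. f z \<partial>\<mu>)"
    proof (rule LIMSEQ_I)
      fix e :: real assume "e > 0"
      \<comment> \<open>Replacing \<open>f (dec t)\<close> by \<open>g t\<close> costs at most
        \<open>2 * B * \<epsilon> = e / 4\<close> under the approximating law and again under the
        limit law; \<open>e / 2\<close> is left for the convergence of the integrals of
        \<open>g\<close>.\<close>
      define \<epsilon> where "\<epsilon> = e / (8 * B)"
      have "\<epsilon> > 0" using \<open>e > 0\<close> \<open>B > 0\<close> by (simp add: \<epsilon>_def)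
      \<comment> \<open>The powers of 1/2 sum to at most 1 over all coordinates, so the union of the
        exceptional events has mass at most \<epsilon>.\<close>
      have "\<exists>R>0. \<forall>n. measure (\<mu>s n) {\<omega>. \<bar>\<omega> x\<bar> > R} \<le> \<epsilon> * (1 / 2) ^ Suc (to_nat x)" for x
      proof -
        obtain R where R: "\<And>n. measure (\<mu>s n) {\<omega>. \<bar>\<omega> x\<bar> > R} \<le> \<epsilon> * (1 / 2) ^ Suc (to_nat x)"
          using tight[of "\<epsilon> * (1 / 2) ^ Suc (to_nat x)" x] \<open>\<epsilon> > 0\<close> by auto
        have "measure (\<mu>s n) {\<omega>. \<bar>\<omega> x\<bar> > max R 1} \<le> measure (\<mu>s n) {\<omega>. \<bar>\<omega> x\<bar> > R}" for n
        proof -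
          interpret prob_space "\<mu>s n" by (rule ps)
          show ?thesis by (rule finite_measure_mono) auto
        qed
        then show ?thesis using R by (intro exI[of _ "max R 1"] conjI allI order_trans[OF _ R]) simp_all
      qed
      then obtain R where R0: "\<And>x. R x > 0"
        and R: "\<And>x n. measure (\<mu>s n) {\<omega>. \<bar>\<omega> x\<bar> > R x} \<le> \<epsilon> * (1 / 2) ^ Suc (to_nat x)"
        by metis
      \<comment> \<open>Clipping confines every angle to a compact part of (-pi/2, pi/2), where the
        tangent is continuous; hence \<open>g\<close> is an admissible test function on the
        line.\<close>
      define clip where "clip x z = max (- arctan (R x)) (min (arctan (R x)) z)" for x z
      define g where "g t = f (\<lambda>x. tan (clip x (\<theta> x t)))" for t
      have g_cont: "continuous_on UNIV g"
      proof -
        have "continuous_on UNIV (\<lambda>t. tan (clip x (\<theta> x t)))" for x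
        proof -
          have c: "continuous_on UNIV (\<lambda>t. clip x (\<theta> x t))"
            unfolding clip_def by (intro continuous_intros \<theta>)
          have "- (pi / 2) < clip x z \<and> clip x z < pi / 2" for z
            unfolding clip_def using arctan[of "R x"] R0[of x] by auto
          then have "cos (clip x (\<theta> x t)) \<noteq> 0" for t
            using cos_gt_zero_pi by (metis less_irrefl)
          then show ?thesis
            unfolding tan_def using c by (intro continuous_on_divide continuous_on_sin continuous_on_cos) auto
        qed
        then have "continuous_on UNIV (\<lambda>t x. tan (clip x (\<theta> x t)))"
          by (rule continuous_on_coordinatewise_then_product)
        then show ?thesis
          unfolding g_def by (rule continuous_on_compose2[OF f]) simp
      qed
      have gB: "\<bar>g t\<bar> \<le> B" for t unfolding g_def by (rule B)
      \<comment> \<open>Defined with closed intervals so that \<open>bad\<close> is open: this is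
        what lets the bound on its mass pass to the weak limit.\<close>
      define bad where "bad = - (\<Inter>x. \<theta> x -` {- arctan (R x)..arctan (R x)})"
      have "closed (\<Inter>x. \<theta> x -` {- arctan (R x)..arctan (R x)})"
        using \<theta> by (intro closed_INT ballI closed_vimage) (auto simp: continuous_on_eq_continuous_at)
      then have "open bad" unfolding bad_def by (rule open_Compl)
      then have bad_m[measurable]: "bad \<in> sets borel" by simp
      have eq: "f (dec t) = g t" if "t \<notin> bad" for t
      proof -
        have "clip x (\<theta> x t) = \<theta> x t" for x
          using that unfolding bad_def clip_def by (auto simp: max_def min_def dest!: spec[of _ x])
        then show ?thesis unfolding dec_def g_def by simp
      qed
      have diff: "\<bar>f (dec t) - g t\<bar> \<le> 2 * B * indicator bad t" for t
        using eq[of t] B[of "dec t"] gB[of t] by (cases "t \<in> bad") auto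
      have [measurable]: "g \<in> borel_measurable borel"
        using g_cont by (rule borel_measurable_continuous_onI)
      have close: "\<bar>(\<integral>t. f (dec t) \<partial>M) - (\<integral>t. g t \<partial>M)\<bar> \<le> 2 * B * \<epsilon>"
        if M: "real_distribution M" "measure M bad \<le> \<epsilon>" for M
      proof -
        interpret M: real_distribution M by fact
        have i1: "integrable M (\<lambda>t. f (dec t))"
          by (rule M.integrable_const_bound[of _ B]) (auto simp: B)
        have i2: "integrable M g"
          by (rule M.integrable_const_bound[of _ B]) (auto simp: gB)
        have i3: "integrable M (\<lambda>t. 2 * B * indicator bad t :: real)"
          by (rule M.integrable_const_bound[of _ "2 * B"]) (auto simp: indicator_def \<open>B > 0\<close> less_imp_le)
        have "\<bar>(\<integral>t. f (dec t) \<partial>M) - (\<integral>t. g t \<partial>M)\<bar> = \<bar>\<integral>t. f (dec t) - g t \<partial>M\<bar>"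
          using i1 i2 by simp
        also have "\<dots> \<le> (\<integral>t. 2 * B * indicator bad t \<partial>M)"
          using diff i1 i2 i3
          by (intro order_trans[OF integral_abs_bound] integral_mono integrable_abs
               Bochner_Integration.integrable_diff) auto
        also have "\<dots> = 2 * B * measure M bad" by simp
        also have "\<dots> \<le> 2 * B * \<epsilon>" using M(2) \<open>B > 0\<close> by simp
        finally show ?thesis .
      qed
      have bad_s: "measure (\<nu>s n) bad \<le> \<epsilon>" for n
      proof -
        interpret n: prob_space "\<mu>s n" by (rule ps)
        \<comment> \<open>Indexed by naturals for countable subadditivity; a number that is not the
          code of a vertex contributes the empty set.\<close>
        define A where "A i = {\<omega> :: 'v \<Rightarrow> real. \<bar>\<omega> (from_nat i)\<bar> > R (from_nat i)} \<inter> (if to_nat (from_nat i :: 'v) = i then UNIV else {})" for i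
        have A_m: "A i \<in> sets (\<mu>s n)" for i unfolding A_def by measurable
        have A_le: "measure (\<mu>s n) (A i) \<le> \<epsilon> * (1 / 2) ^ Suc i" for i
          unfolding A_def using R[of n "from_nat i"] \<open>\<epsilon> > 0\<close> by auto
        have geo: "(\<lambda>i. \<epsilon> * (1 / 2) ^ Suc i) sums (\<epsilon> * 1)"
          by (intro sums_mult power_half_series)
        have sumA: "summable (\<lambda>i. measure (\<mu>s n) (A i))"
          using A_le by (intro summable_comparison_test'[OF sums_summable[OF geo]]) auto
        have "code -` bad \<subseteq> (\<Union>i. A i)"
        proof
          fix \<omega> assume "\<omega> \<in> code -` bad"
          then obtain x where "\<not> (- arctan (R x) \<le> arctan (\<omega> x) \<and> arctan (\<omega> x) \<le> arctan (R x))"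
            unfolding bad_def by (auto simp: \<theta>_code)
          then have "\<bar>\<omega> x\<bar> > R x"
            unfolding arctan_minus[symmetric] arctan_le_iff by linarith
          then have "\<omega> \<in> A (to_nat x)" unfolding A_def by simp
          then show "\<omega> \<in> (\<Union>i. A i)" by blast
        qed
        then have "measure (\<nu>s n) bad \<le> measure (\<mu>s n) (\<Union>i. A i)"
          unfolding \<nu>s_def using A_m by (subst measure_distr) (auto intro!: n.finite_measure_mono)
        also have "\<dots> \<le> (\<Sum>i. measure (\<mu>s n) (A i))"
          using A_m by (intro n.finite_measure_subadditive_countably sumA) auto
        also have "\<dots> \<le> (\<Sum>i. \<epsilon> * (1 / 2) ^ Suc i)"
          by (rule suminf_le[OF A_le sumA sums_summable[OF geo]])
        also have "\<dots> = \<epsilon>" using sums_unique[OF geo] by simp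
        finally show ?thesis .
      qed
      have bad_lim: "measure \<nu> bad \<le> \<epsilon>"
        using \<nu>s by (intro measure_open_le_of_converges_weakly[OF \<nu>_lim \<open>open bad\<close>] bad_s)
          (auto simp: real_distribution_def real_distribution_axioms_def \<nu>.prob_space_axioms bad_s)
      have f_s: "(\<integral>z. f z \<partial>\<mu>s n) = (\<integral>t. f (dec t) \<partial>\<nu>s n)" for n
      proof -
        have "dec (code \<omega>) = \<omega>" for \<omega> unfolding dec_def by (simp add: \<theta>_code tan_arctan)
        then show ?thesis unfolding \<nu>s_def by (subst integral_distr) simp_all
      qed
      have f_lim: "(\<integral>z. f z \<partial>\<mu>) = (\<integral>t. f (dec t) \<partial>\<nu>)"
        unfolding \<mu>_def by (subst integral_distr) simp_all
      have "(\<lambda>n. \<integral>t. g t \<partial>(\<nu>s \<circ> r) n) \<longlonglongrightarrow> (\<integral>t. g t \<partial>\<nu>)"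
        by (rule converges_weaklyD[OF \<nu>_lim g_cont gB])
      from LIMSEQ_D[OF this, of "e / 2"] obtain N where N: "\<And>n. n \<ge> N \<Longrightarrow> \<bar>(\<integral>t. g t \<partial>\<nu>s (r n)) - (\<integral>t. g t \<partial>\<nu>)\<bar> < e / 2"
        using \<open>e > 0\<close> unfolding real_norm_def comp_def by (meson half_gt_zero)
      have eB: "2 * B * \<epsilon> = e / 4" unfolding \<epsilon>_def using \<open>B > 0\<close> by simp
      have "\<bar>(\<integral>z. f z \<partial>\<mu>s (r n)) - (\<integral>z. f z \<partial>\<mu>)\<bar> < e" if "n \<ge> N" for n
        using N[OF that] close[OF \<nu>s bad_s, of "r n"] close[OF \<nu> bad_lim] unfolding f_s f_lim eB
        by linarith
      then show "\<exists>N. \<forall>n\<ge>N. norm ((\<integral>z. f z \<partial>(\<mu>s \<circ> r) n) - (\<integral>z. f z \<partial>\<mu>)) < e"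
        by auto
    qed
  qed
  with r \<mu> show ?thesis
    by (intro exI[of _ r] exI[of _ \<mu>]) (simp add: \<mu>_def)
qed

section \<open>Finite-volume Gibbs kernels\<close>

lemma powr_le_powr_plus:
  assumes "0 < s" "s < q" "0 < e"
  shows "\<exists>C. \<forall>t\<ge>0. (t::real) powr s \<le> e * t powr q + C"
proof -
  \<comment> \<open>The threshold at which \<open>e * t powr q\<close> overtakes
    \<open>t powr s\<close>, that is, the solution of \<open>e * T powr (q - s) = 1\<close>.\<close>
  define T where "T = (1 / e) powr (1 / (q - s))"
  have T0: "0 < T" unfolding T_def using assms by simp
  have "t powr s \<le> e * t powr q + T powr s" if "t \<ge> 0" for t
  proof (cases "t \<le> T")
    case True
    then have "t powr s \<le> T powr s" using that assms by (intro powr_mono2) auto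
    moreover have "0 \<le> e * t powr q" using assms by simp
    ultimately show ?thesis by linarith
  next
    case False
    then have "T powr (q - s) \<le> t powr (q - s)" using T0 assms by (intro powr_mono2) auto
    then have "1 / e \<le> t powr (q - s)" unfolding T_def using assms by (simp add: powr_powr)
    then have "1 \<le> e * t powr (q - s)" using assms by (simp add: field_simps)
    then have "t powr s * 1 \<le> t powr s * (e * t powr (q - s))" by (intro mult_left_mono) auto
    also have "\<dots> = e * t powr q" by (simp add: powr_add[symmetric])
    finally show ?thesis using powr_ge_zero[of T s] by linarith
  qed
  then show ?thesis by blast
qed

lemma continuous_on_abs_powr:
  fixes f :: "'a::topological_space \<Rightarrow> real"
  assumes "continuous_on A f" "0 < s"
  shows "continuous_on A (\<lambda>x. \<bar>f x\<bar> powr s)"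
  using assms by (intro continuous_on_powr' continuous_on_rabs continuous_on_const) auto

text \<open>A third of the leading term \<open>a * |u|^q\<close> is spent on each of the two lower
  powers and on ln (1 + u^2); what remains is a constant multiple of the integrable 1 / (1 +
  u^2).\<close>

lemma integrable_stretched_exp:
  fixes A B C a r p q :: real
  assumes "0 < r" "r < q" "0 < p" "p < q" "0 < a"
  shows "integrable lborel (\<lambda>u. exp (A + B * \<bar>u\<bar> powr r + C * \<bar>u\<bar> powr p - a * \<bar>u\<bar> powr q))"
proof -
  \<comment> \<open>Any exponent strictly between 0 and \<open>q\<close> serves to dominate the
    logarithm.\<close>
  define s where "s = q / 2"
  have s: "0 < s" "s < q" using assms by (auto simp: s_def)
  define K where "K = 2 powr s * 2 / s"
  have K0: "0 < K" using s by (simp add: K_def)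
  have ln_le: "ln (1 + u\<^sup>2) \<le> K + K * \<bar>u\<bar> powr s" for u :: real
  proof -
    have "1 + u\<^sup>2 \<le> (1 + \<bar>u\<bar>)\<^sup>2" by (simp add: power2_sum)
    then have "ln (1 + u\<^sup>2) \<le> ln ((1 + \<bar>u\<bar>)\<^sup>2)"
      by (intro ln_mono) (auto simp: add_pos_nonneg)
    also have "\<dots> = 2 * ln (1 + \<bar>u\<bar>)" by (subst ln_realpow) auto
    also have "\<dots> \<le> 2 * ((1 + \<bar>u\<bar>) powr s / s)"
      using s by (intro mult_left_mono ln_powr_bound) auto
    also have "(1 + \<bar>u\<bar>) powr s \<le> 2 powr s * (1 + \<bar>u\<bar> powr s)"
    proof (cases "\<bar>u\<bar> \<le> 1")
      case True
      then have "(1 + \<bar>u\<bar>) powr s \<le> 2 powr s" using s by (intro powr_mono2) auto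
      also have "\<dots> \<le> 2 powr s * (1 + \<bar>u\<bar> powr s)" by (simp add: algebra_simps)
      finally show ?thesis .
    next
      case False
      then have "(1 + \<bar>u\<bar>) powr s \<le> (2 * \<bar>u\<bar>) powr s" using s by (intro powr_mono2) auto
      also have "\<dots> = 2 powr s * \<bar>u\<bar> powr s" by (simp add: powr_mult)
      also have "\<dots> \<le> 2 powr s * (1 + \<bar>u\<bar> powr s)" by (simp add: algebra_simps)
      finally show ?thesis .
    qed
    finally show ?thesis using s by (simp add: K_def field_simps)
  qed
  have pos: "\<bar>D\<bar> + 1 > 0" for D :: real by linarith
  have young: "\<exists>E. \<forall>u::real. D * \<bar>u\<bar> powr t \<le> a / 3 * \<bar>u\<bar> powr q + E" if tq: "0 < t" "t < q" for D t
  proof -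
    obtain E where E: "\<And>v. v \<ge> 0 \<Longrightarrow> (v::real) powr t \<le> a / (3 * (\<bar>D\<bar> + 1)) * v powr q + E"
      using powr_le_powr_plus[OF tq, of "a / (3 * (\<bar>D\<bar> + 1))"] assms pos[of D] by auto
    have "D * \<bar>u\<bar> powr t \<le> a / 3 * \<bar>u\<bar> powr q + (\<bar>D\<bar> + 1) * E" for u :: real
    proof -
      have "D * \<bar>u\<bar> powr t \<le> (\<bar>D\<bar> + 1) * \<bar>u\<bar> powr t" by (intro mult_right_mono) auto
      also have "\<dots> \<le> (\<bar>D\<bar> + 1) * (a / (3 * (\<bar>D\<bar> + 1)) * \<bar>u\<bar> powr q + E)"
        using pos[of D] by (intro mult_left_mono E) auto
      also have "\<dots> = a / 3 * \<bar>u\<bar> powr q + (\<bar>D\<bar> + 1) * E"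
        using pos[of D] by (simp add: field_simps)
      finally show ?thesis .
    qed
    then show ?thesis by blast
  qed
  obtain E1 where E1: "\<And>u::real. B * \<bar>u\<bar> powr r \<le> a / 3 * \<bar>u\<bar> powr q + E1"
    using young[of r B] assms by auto
  obtain E2 where E2: "\<And>u::real. C * \<bar>u\<bar> powr p \<le> a / 3 * \<bar>u\<bar> powr q + E2"
    using young[of p C] assms by auto
  obtain E3 where E3: "\<And>u::real. K * \<bar>u\<bar> powr s \<le> a / 3 * \<bar>u\<bar> powr q + E3"
    using young[of s K] s by auto
  have bound: "exp (A + B * \<bar>u\<bar> powr r + C * \<bar>u\<bar> powr p - a * \<bar>u\<bar> powr q)
    \<le> exp (A + E1 + E2 + E3 + K) * inverse (1 + u\<^sup>2)" for u
  proof -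
    have "A + B * \<bar>u\<bar> powr r + C * \<bar>u\<bar> powr p - a * \<bar>u\<bar> powr q \<le> (A + E1 + E2 + E3 + K) - ln (1 + u\<^sup>2)"
      using E1[of u] E2[of u] E3[of u] ln_le[of u] by linarith
    then have "exp (A + B * \<bar>u\<bar> powr r + C * \<bar>u\<bar> powr p - a * \<bar>u\<bar> powr q)
      \<le> exp ((A + E1 + E2 + E3 + K) - ln (1 + u\<^sup>2))" by simp
    also have "\<dots> = exp (A + E1 + E2 + E3 + K) * inverse (1 + u\<^sup>2)"
      unfolding exp_diff by (subst exp_ln) (auto simp: add_pos_nonneg field_simps)
    finally show ?thesis .
  qed
  show ?thesis
  proof (rule Bochner_Integration.integrable_bound)
    have "integrable lborel (\<lambda>x::real. inverse (1 + x\<^sup>2))"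
      using integrable_inverse_1_plus_square by (simp add: set_integrable_def)
    then show "integrable lborel (\<lambda>u::real. exp (A + E1 + E2 + E3 + K) * inverse (1 + u\<^sup>2))"
      by (rule integrable_mult_right)
    show "(\<lambda>u. exp (A + B * \<bar>u\<bar> powr r + C * \<bar>u\<bar> powr p - a * \<bar>u\<bar> powr q)) \<in> borel_measurable lborel"
      by measurable
    show "AE u in lborel. norm (exp (A + B * \<bar>u\<bar> powr r + C * \<bar>u\<bar> powr p - a * \<bar>u\<bar> powr q))
       \<le> norm (exp (A + E1 + E2 + E3 + K) * inverse (1 + u\<^sup>2))"
      using bound by (intro AE_I2) (simp add: abs_of_nonneg)
  qed
qed

interpretation lborel_product: product_sigma_finite "\<lambda>_ :: 'i. lborel :: real measure"
  by standard

locale spin_system =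
  fixes adj :: "'v::countable \<Rightarrow> 'v \<Rightarrow> bool"
    and W :: "real \<Rightarrow> real \<Rightarrow> real" and V :: "real \<Rightarrow> real"
    and I J r a c q :: real
  assumes sym: "\<And>x y. adj x y \<Longrightarrow> adj y x"
    and loc_fin: "\<And>x. finite {y. adj x y}"
    and W_cont: "continuous_on UNIV (\<lambda>(u,v). W u v)"
    and W_sym: "\<And>u v. W u v = W v u"
    and params: "I > 0" "J > 0" "r > 0" "a > 0"
    and W_bound: "\<And>u v. \<bar>W u v\<bar> \<le> (I + J * (\<bar>u\<bar> powr r + \<bar>v\<bar> powr r)) / 2"
    and V_cont: "continuous_on UNIV V"
    and V_bound: "\<And>u. V u \<ge> a * \<bar>u\<bar> powr q - c"
    and r_q: "r < q"
begin

section \<open>Energies and their splitting over volumes\<close>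

definition pairs :: "'v set \<Rightarrow> 'v set \<Rightarrow> ('v \<times> 'v) set" where
  "pairs A B = {(x, y). x \<in> A \<and> y \<in> B \<and> adj x y}"

definition interaction :: "'v set \<Rightarrow> 'v set \<Rightarrow> ('v \<Rightarrow> real) \<Rightarrow> real" where
  "interaction A B \<eta> = (\<Sum>(x, y)\<in>pairs A B. W (\<eta> x) (\<eta> y))"

text \<open>Takes one full configuration, so that different volumes can be compared at the same
  argument. \<open>interaction\<close> runs over ordered pairs, hence the half for interior
  edges.\<close>

definition energy :: "'v set \<Rightarrow> ('v \<Rightarrow> real) \<Rightarrow> real" where
  "energy \<Lambda> \<eta> = interaction \<Lambda> \<Lambda> \<eta> / 2 + interaction \<Lambda> (- \<Lambda>) \<eta> + (\<Sum>x\<in>\<Lambda>. V (\<eta> x))"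

abbreviation reference :: "'v set \<Rightarrow> ('v \<Rightarrow> real) measure" where
  "reference \<Lambda> \<equiv> PiM \<Lambda> (\<lambda>_. lborel)"

abbreviation Z :: "'v set \<Rightarrow> ('v \<Rightarrow> real) \<Rightarrow> ennreal" where
  "Z \<equiv> partition_fn adj W V"

lemma finite_pairs: "finite A \<Longrightarrow> finite (pairs A B)"
proof -
  assume "finite A"
  then have "finite (SIGMA x:A. {y. adj x y})" by (intro finite_SigmaI loc_fin)
  then show ?thesis by (rule rev_finite_subset) (auto simp: pairs_def)
qed

lemma interaction_Un1:
  assumes "finite A" "finite B" "A \<inter> B = {}"
  shows "interaction (A \<union> B) C \<eta> = interaction A C \<eta> + interaction B C \<eta>"
proof -
  have "pairs (A \<union> B) C = pairs A C \<union> pairs B C" "pairs A C \<inter> pairs B C = {}"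
    using assms(3) by (auto simp: pairs_def)
  then show ?thesis unfolding interaction_def using assms
    by (simp add: sum.union_disjoint finite_pairs)
qed

lemma interaction_Un2:
  assumes "finite C" "A \<inter> B = {}"
  shows "interaction C (A \<union> B) \<eta> = interaction C A \<eta> + interaction C B \<eta>"
proof -
  have "pairs C (A \<union> B) = pairs C A \<union> pairs C B" "pairs C A \<inter> pairs C B = {}"
    using assms(2) by (auto simp: pairs_def)
  then show ?thesis unfolding interaction_def using assms
    by (simp add: sum.union_disjoint finite_pairs)
qed

lemma interaction_commute: "interaction A B \<eta> = interaction B A \<eta>"
  unfolding interaction_def
  by (rule sum.reindex_bij_witness[of _ "\<lambda>(x, y). (y, x)" "\<lambda>(x, y). (y, x)"])
     (auto simp: pairs_def sym W_sym)

lemma interaction_cong: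
  assumes "\<And>x. x \<in> A \<union> B \<Longrightarrow> \<eta> x = \<eta>' x"
  shows "interaction A B \<eta> = interaction A B \<eta>'"
  unfolding interaction_def using assms by (intro sum.cong) (auto simp: pairs_def)

lemma hamiltonian_eq_energy: "hamiltonian adj W V \<Lambda> \<omega> \<xi> = energy \<Lambda> (merge_cfg \<Lambda> \<omega> \<xi>)"
proof -
  have "(\<Sum>(x,y)\<in>{(x,y). x \<in> \<Lambda> \<and> y \<notin> \<Lambda> \<and> adj x y}. W (merge_cfg \<Lambda> \<omega> \<xi> x) (\<xi> y))
    = interaction \<Lambda> (- \<Lambda>) (merge_cfg \<Lambda> \<omega> \<xi>)"
    unfolding interaction_def by (intro sum.cong) (auto simp: pairs_def merge_cfg_def)
  then show ?thesis
    unfolding hamiltonian_def energy_def Let_def interaction_def pairs_def by simp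
qed

text \<open>Edges between \<Delta> and the rest of \<Lambda> occur twice, halved, in the interior
  part of \<Lambda> and once in the boundary part of \<Delta>, so they cancel. The remainder
  \<open>g\<close> stays constant while the spins of \<Delta> are integrated.\<close>

lemma energy_split:
  assumes "finite \<Lambda>" "\<Delta> \<subseteq> \<Lambda>"
  obtains g where "\<And>\<eta>. energy \<Lambda> \<eta> = energy \<Delta> \<eta> + g \<eta>"
    "\<And>\<eta> \<eta>'. (\<And>x. x \<notin> \<Delta> \<Longrightarrow> \<eta> x = \<eta>' x) \<Longrightarrow> g \<eta> = g \<eta>'"
proof
  define \<Gamma> where "\<Gamma> = \<Lambda> - \<Delta>"
  have L: "\<Lambda> = \<Delta> \<union> \<Gamma>" "\<Delta> \<inter> \<Gamma> = {}" and fin: "finite \<Delta>" "finite \<Gamma>"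
    using assms by (auto simp: \<Gamma>_def intro: finite_subset)
  have D: "- \<Delta> = \<Gamma> \<union> - \<Lambda>" "\<Gamma> \<inter> - \<Lambda> = {}" using assms(2) by (auto simp: \<Gamma>_def)
  let ?g = "\<lambda>\<eta>. interaction \<Gamma> \<Gamma> \<eta> / 2 + interaction \<Gamma> (- \<Lambda>) \<eta> + (\<Sum>x\<in>\<Gamma>. V (\<eta> x))"
  show "energy \<Lambda> \<eta> = energy \<Delta> \<eta> + ?g \<eta>" for \<eta>
  proof -
    have "interaction \<Lambda> \<Lambda> \<eta> = interaction \<Delta> \<Delta> \<eta> + 2 * interaction \<Delta> \<Gamma> \<eta> + interaction \<Gamma> \<Gamma> \<eta>"
      unfolding L(1) using fin L(2) interaction_commute[of \<Gamma> \<Delta> \<eta>]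
      by (simp add: interaction_Un1 interaction_Un2)
    moreover have "interaction \<Lambda> (- \<Lambda>) \<eta> = interaction \<Delta> (- \<Lambda>) \<eta> + interaction \<Gamma> (- \<Lambda>) \<eta>"
      using interaction_Un1[OF fin L(2), of "- \<Lambda>"] L(1) by simp
    moreover have "interaction \<Delta> (- \<Delta>) \<eta> = interaction \<Delta> \<Gamma> \<eta> + interaction \<Delta> (- \<Lambda>) \<eta>"
      unfolding D(1) using interaction_Un2[OF fin(1) D(2)] .
    moreover have "(\<Sum>x\<in>\<Lambda>. V (\<eta> x)) = (\<Sum>x\<in>\<Delta>. V (\<eta> x)) + (\<Sum>x\<in>\<Gamma>. V (\<eta> x))"
      unfolding L(1) using fin L(2) by (rule sum.union_disjoint)
    ultimately show ?thesis unfolding energy_def by (simp add: field_simps)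
  qed
  show "?g \<eta> = ?g \<eta>'" if "\<And>x. x \<notin> \<Delta> \<Longrightarrow> \<eta> x = \<eta>' x" for \<eta> \<eta>'
  proof -
    have "\<eta> x = \<eta>' x" if "x \<in> \<Gamma> \<union> - \<Lambda>" for x
      using that \<open>\<And>x. x \<notin> \<Delta> \<Longrightarrow> \<eta> x = \<eta>' x\<close> assms(2) by (auto simp: \<Gamma>_def)
    then show ?thesis
      by (intro arg_cong2[of _ _ _ _ "(+)"] arg_cong2[of _ _ _ _ "(/)"] interaction_cong sum.cong
          arg_cong[of _ _ V] refl) auto
  qed
qed

lemma continuous_on_interaction: "continuous_on UNIV (interaction A B)"
proof -
  have "continuous_on UNIV (\<lambda>\<eta> :: 'v \<Rightarrow> real. W (\<eta> x) (\<eta> y))" for x y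
    using continuous_on_compose2[OF W_cont, of UNIV "\<lambda>\<eta> :: 'v \<Rightarrow> real. (\<eta> x, \<eta> y)"]
    by (simp add: continuous_on_Pair continuous_on_product_coordinates)
  then show ?thesis
    unfolding interaction_def[abs_def] by (intro continuous_on_sum) (simp add: case_prod_unfold)
qed

lemma continuous_on_energy: "continuous_on UNIV (energy \<Lambda>)"
proof -
  have "continuous_on UNIV (\<lambda>\<eta> :: 'v \<Rightarrow> real. V (\<eta> x))" for x
    using continuous_on_compose2[OF V_cont continuous_on_product_coordinates] by simp
  then show ?thesis
    unfolding energy_def[abs_def]
    by (intro continuous_on_add continuous_on_divide continuous_on_sum continuous_on_interaction
        continuous_on_const) auto
qed

lemma energy_measurable[measurable]: "energy \<Lambda> \<in> borel_measurable borel"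
  by (intro borel_measurable_continuous_onI continuous_on_energy)

lemma coordinate_measurable[measurable]: "(\<lambda>\<eta> :: 'v \<Rightarrow> real. \<eta> x) \<in> borel_measurable borel"
  by (intro borel_measurable_continuous_onI continuous_on_product_coordinates)

lemma merge_cfg_measurable_pair:
  "(\<lambda>p. merge_cfg \<Lambda> (snd p) (fst p)) \<in> (borel \<Otimes>\<^sub>M reference \<Lambda>) \<rightarrow>\<^sub>M borel"
proof (rule measurable_coordinatewise_then_product)
  fix x
  show "(\<lambda>p. merge_cfg \<Lambda> (snd p) (fst p) x) \<in> borel_measurable (borel \<Otimes>\<^sub>M reference \<Lambda>)"
  proof (cases "x \<in> \<Lambda>")
    case True
    have "(\<lambda>\<omega>. \<omega> x) \<in> reference \<Lambda> \<rightarrow>\<^sub>M lborel" using True by measurable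
    then have "(\<lambda>p. (snd p) x) \<in> (borel \<Otimes>\<^sub>M reference \<Lambda>) \<rightarrow>\<^sub>M lborel"
      by (rule measurable_compose[OF measurable_snd])
    then show ?thesis using True by (simp add: merge_cfg_def)
  next
    case False
    have "(\<lambda>p. (fst p) x) \<in> borel_measurable ((borel :: ('v \<Rightarrow> real) measure) \<Otimes>\<^sub>M reference \<Lambda>)"
      by (rule measurable_compose[OF measurable_fst coordinate_measurable])
    then show ?thesis using False by (simp add: merge_cfg_def)
  qed
qed

lemma merge_cfg_measurable[measurable]: "(\<lambda>\<omega>. merge_cfg \<Lambda> \<omega> \<xi>) \<in> reference \<Lambda> \<rightarrow>\<^sub>M borel"
  using measurable_compose[OF measurable_Pair1' merge_cfg_measurable_pair, of \<xi> \<Lambda>] by simp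

lemma reference_nn_integral_measurable:
  assumes "finite \<Lambda>" and [measurable]: "f \<in> borel_measurable borel"
  shows "(\<lambda>\<xi>. \<integral>\<^sup>+\<omega>. (f (merge_cfg \<Lambda> \<omega> \<xi>) :: ennreal) \<partial>reference \<Lambda>) \<in> borel_measurable borel"
proof -
  interpret sigma_finite_measure "reference \<Lambda>"
    using assms(1) by (rule lborel_product.sigma_finite)
  have "(\<lambda>p. f (merge_cfg \<Lambda> (snd p) (fst p))) \<in> borel_measurable (borel \<Otimes>\<^sub>M reference \<Lambda>)"
    by (rule measurable_compose[OF merge_cfg_measurable_pair]) fact
  then show ?thesis
    using borel_measurable_nn_integral[of "\<lambda>\<xi> \<omega>. f (merge_cfg \<Lambda> \<omega> \<xi>)" borel]
    by (simp add: case_prod_unfold)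
qed

lemma Z_eq: "Z \<Lambda> \<xi> = (\<integral>\<^sup>+\<omega>. ennreal (exp (- energy \<Lambda> (merge_cfg \<Lambda> \<omega> \<xi>))) \<partial>reference \<Lambda>)"
  by (simp add: partition_fn_def hamiltonian_eq_energy)

lemma Z_measurable[measurable]:
  assumes "finite \<Lambda>"
  shows "Z \<Lambda> \<in> borel_measurable borel"
  unfolding Z_eq[abs_def]
  by (rule reference_nn_integral_measurable[OF assms, of "\<lambda>\<eta>. ennreal (exp (- energy \<Lambda> \<eta>))"]) measurable

lemma Z_cong:
  assumes "\<And>x. x \<notin> \<Lambda> \<Longrightarrow> \<xi> x = \<xi>' x"
  shows "Z \<Lambda> \<xi> = Z \<Lambda> \<xi>'"
proof -
  have "merge_cfg \<Lambda> \<omega> \<xi> = merge_cfg \<Lambda> \<omega> \<xi>'" for \<omega> using assms by (auto simp: merge_cfg_def)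
  then show ?thesis by (simp add: Z_eq)
qed

lemma Z_pos: assumes "finite \<Lambda>" shows "Z \<Lambda> \<xi> > 0"
proof -
  have "Z \<Lambda> \<xi> \<noteq> 0"
  proof
    assume "Z \<Lambda> \<xi> = 0"
    then have "AE \<omega> in reference \<Lambda>. False"
      unfolding Z_eq by (subst (asm) nn_integral_0_iff_AE) (auto simp: not_le)
    then have "emeasure (reference \<Lambda>) (space (reference \<Lambda>)) = 0"
      by (simp add: AE_iff_null null_setsD1)
    \<comment> \<open>Each factor is the infinite length of the line and an empty product is 1, so
      the reference measure is not null.\<close>
    moreover have "emeasure (reference \<Lambda>) (space (reference \<Lambda>)) = (\<Prod>i\<in>\<Lambda>. \<infinity>)"
      using lborel_product.emeasure_PiM[OF assms, of "\<lambda>_. UNIV"] by (simp add: space_PiM)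
    ultimately show False by (simp add: assms)
  qed
  then show ?thesis by (simp add: zero_less_iff_neq_zero)
qed

section \<open>Integrability of the Boltzmann factor\<close>

definition boundary :: "'v set \<Rightarrow> 'v set" where
  "boundary \<Lambda> = {y. y \<notin> \<Lambda> \<and> (\<exists>x\<in>\<Lambda>. adj x y)}"

lemma finite_boundary: "finite \<Lambda> \<Longrightarrow> finite (boundary \<Lambda>)"
proof -
  assume "finite \<Lambda>"
  then have "finite (\<Union>x\<in>\<Lambda>. {y. adj x y})" using loc_fin by auto
  then show ?thesis by (rule rev_finite_subset) (auto simp: boundary_def)
qed

definition n_pairs :: "'v set \<Rightarrow> real" where
  "n_pairs \<Lambda> = real (card (pairs \<Lambda> UNIV))"

text \<open>Crude on purpose: each pair is bounded by the total over the volume and its boundary, so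
  the constants depend on the volume. The bound only has to separate the sites, for qualitative
  finiteness.\<close>

lemma energy_lower_bound:
  assumes "finite \<Lambda>"
  shows "- energy \<Lambda> \<eta> \<le> n_pairs \<Lambda> * (\<Sum>y\<in>boundary \<Lambda>. I + J * \<bar>\<eta> y\<bar> powr r)
    + (\<Sum>x\<in>\<Lambda>. n_pairs \<Lambda> * (I + J * \<bar>\<eta> x\<bar> powr r) - a * \<bar>\<eta> x\<bar> powr q + c)"
proof -
  define t where "t z = I + J * \<bar>\<eta> z\<bar> powr r" for z
  define S where "S = sum t (\<Lambda> \<union> boundary \<Lambda>)"
  have t0: "0 \<le> t z" for z unfolding t_def using params by (simp add: add_nonneg_nonneg less_imp_le)
  have t_le: "t z \<le> S" if "z \<in> \<Lambda> \<union> boundary \<Lambda>" for z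
    unfolding S_def using that t0 assms finite_boundary[OF assms] by (intro member_le_sum) auto
  have W_le: "\<bar>W (\<eta> x) (\<eta> y)\<bar> \<le> S" if "(x, y) \<in> pairs \<Lambda> UNIV" for x y
  proof -
    have "\<bar>W (\<eta> x) (\<eta> y)\<bar> \<le> (t x + t y) / 2"
      using W_bound[of "\<eta> x" "\<eta> y"] params unfolding t_def by (simp add: algebra_simps)
    also have "\<dots> \<le> (S + S) / 2"
      using that by (intro divide_right_mono add_mono t_le) (auto simp: pairs_def boundary_def)
    finally show ?thesis by simp
  qed
  have int_le: "\<bar>interaction \<Lambda> B \<eta>\<bar> \<le> real (card (pairs \<Lambda> B)) * S" for B
  proof -
    have "\<bar>interaction \<Lambda> B \<eta>\<bar> \<le> (\<Sum>(x, y)\<in>pairs \<Lambda> B. \<bar>W (\<eta> x) (\<eta> y)\<bar>)"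
      unfolding interaction_def by (rule order_trans[OF sum_abs]) (simp add: case_prod_unfold)
    also have "\<dots> \<le> real (card (pairs \<Lambda> B)) * S"
      by (rule sum_bounded_above) (use W_le in \<open>auto simp: pairs_def\<close>)
    finally show ?thesis .
  qed
  have "pairs \<Lambda> UNIV = pairs \<Lambda> \<Lambda> \<union> pairs \<Lambda> (- \<Lambda>)" "pairs \<Lambda> \<Lambda> \<inter> pairs \<Lambda> (- \<Lambda>) = {}"
    by (auto simp: pairs_def)
  then have N: "n_pairs \<Lambda> = real (card (pairs \<Lambda> \<Lambda>)) + real (card (pairs \<Lambda> (- \<Lambda>)))"
    unfolding n_pairs_def using assms by (simp add: card_Un_disjoint finite_pairs)
  have "\<bar>interaction \<Lambda> \<Lambda> \<eta>\<bar> + \<bar>interaction \<Lambda> (- \<Lambda>) \<eta>\<bar> \<le> n_pairs \<Lambda> * S"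
    using int_le[of \<Lambda>] int_le[of "- \<Lambda>"] unfolding N by (simp add: algebra_simps)
  moreover have "(\<Sum>x\<in>\<Lambda>. a * \<bar>\<eta> x\<bar> powr q - c) \<le> (\<Sum>x\<in>\<Lambda>. V (\<eta> x))"
    by (intro sum_mono V_bound)
  ultimately have "- energy \<Lambda> \<eta> \<le> n_pairs \<Lambda> * S - (\<Sum>x\<in>\<Lambda>. a * \<bar>\<eta> x\<bar> powr q - c)"
    unfolding energy_def by linarith
  also have "S = sum t \<Lambda> + sum t (boundary \<Lambda>)"
    unfolding S_def using assms finite_boundary[OF assms]
    by (intro sum.union_disjoint) (auto simp: boundary_def)
  finally show ?thesis
    by (simp add: t_def sum_distrib_left sum.distrib sum_subtractf algebra_simps)
qed

text \<open>A product of one-site functions, integrable by Fubini. The parameter \<open>l\<close>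
  lets one majorant serve partition functions (\<open>l = 0\<close>) as well as exponential
  moments.\<close>

definition dominant :: "'v set \<Rightarrow> real \<Rightarrow> real \<Rightarrow> ('v \<Rightarrow> real) \<Rightarrow> real" where
  "dominant \<Lambda> p l \<omega> = (\<Prod>x\<in>\<Lambda>. exp ((n_pairs \<Lambda> * I + c) + n_pairs \<Lambda> * J * \<bar>\<omega> x\<bar> powr r
     + l * \<bar>\<omega> x\<bar> powr p - a * \<bar>\<omega> x\<bar> powr q))"

definition boundary_factor :: "'v set \<Rightarrow> ('v \<Rightarrow> real) \<Rightarrow> real" where
  "boundary_factor \<Lambda> \<xi> = exp (n_pairs \<Lambda> * (\<Sum>y\<in>boundary \<Lambda>. I + J * \<bar>\<xi> y\<bar> powr r))"

lemma exp_energy_le_dominant: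
  assumes "finite \<Lambda>"
  shows "exp (l * (\<Sum>x\<in>\<Lambda>. \<bar>merge_cfg \<Lambda> \<omega> \<xi> x\<bar> powr p) - energy \<Lambda> (merge_cfg \<Lambda> \<omega> \<xi>))
    \<le> boundary_factor \<Lambda> \<xi> * dominant \<Lambda> p l \<omega>"
proof -
  let ?\<eta> = "merge_cfg \<Lambda> \<omega> \<xi>"
  have 1: "(\<Sum>y\<in>boundary \<Lambda>. I + J * \<bar>?\<eta> y\<bar> powr r) = (\<Sum>y\<in>boundary \<Lambda>. I + J * \<bar>\<xi> y\<bar> powr r)"
    by (intro sum.cong) (auto simp: boundary_def merge_cfg_def)
  have 2: "(\<Sum>x\<in>\<Lambda>. n_pairs \<Lambda> * (I + J * \<bar>?\<eta> x\<bar> powr r) - a * \<bar>?\<eta> x\<bar> powr q + c)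
    + l * (\<Sum>x\<in>\<Lambda>. \<bar>?\<eta> x\<bar> powr p) = (\<Sum>x\<in>\<Lambda>. (n_pairs \<Lambda> * I + c) + n_pairs \<Lambda> * J * \<bar>\<omega> x\<bar> powr r
     + l * \<bar>\<omega> x\<bar> powr p - a * \<bar>\<omega> x\<bar> powr q)"
    unfolding sum_distrib_left sum.distrib[symmetric]
    by (intro sum.cong) (auto simp: merge_cfg_def algebra_simps)
  have "l * (\<Sum>x\<in>\<Lambda>. \<bar>?\<eta> x\<bar> powr p) - energy \<Lambda> ?\<eta> \<le> n_pairs \<Lambda> * (\<Sum>y\<in>boundary \<Lambda>. I + J * \<bar>\<xi> y\<bar> powr r)
    + (\<Sum>x\<in>\<Lambda>. (n_pairs \<Lambda> * I + c) + n_pairs \<Lambda> * J * \<bar>\<omega> x\<bar> powr r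
     + l * \<bar>\<omega> x\<bar> powr p - a * \<bar>\<omega> x\<bar> powr q)"
    using energy_lower_bound[OF assms, of ?\<eta>] unfolding 1 2[symmetric] by linarith
  then have "exp (l * (\<Sum>x\<in>\<Lambda>. \<bar>?\<eta> x\<bar> powr p) - energy \<Lambda> ?\<eta>) \<le> exp (\<dots>)" by simp
  then show ?thesis
    unfolding boundary_factor_def dominant_def exp_add exp_sum[OF assms] .
qed

lemma integrable_dominant:
  assumes "finite \<Lambda>" "0 < p" "p < q"
  shows "integrable (reference \<Lambda>) (dominant \<Lambda> p l)"
  unfolding dominant_def[abs_def] using assms params r_q
  by (intro lborel_product.product_integrable_prod integrable_stretched_exp)

text \<open>Here \<open>r\<close> is a placeholder for the exponent of the vanishing moment term
  that meets the constraints of \<open>integrable_dominant\<close>.\<close>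

lemma exp_energy_le_dominant_0:
  assumes "finite \<Lambda>"
  shows "exp (- energy \<Lambda> (merge_cfg \<Lambda> \<omega> \<xi>)) \<le> boundary_factor \<Lambda> \<xi> * dominant \<Lambda> r 0 \<omega>"
  using exp_energy_le_dominant[OF assms, of 0 \<omega> \<xi> r] by simp

lemma integrable_exp_energy:
  assumes "finite \<Lambda>"
  shows "integrable (reference \<Lambda>) (\<lambda>\<omega>. exp (- energy \<Lambda> (merge_cfg \<Lambda> \<omega> \<xi>)))"
proof (rule Bochner_Integration.integrable_bound)
  show "integrable (reference \<Lambda>) (\<lambda>\<omega>. boundary_factor \<Lambda> \<xi> * dominant \<Lambda> r 0 \<omega>)"
    using assms params r_q by (intro integrable_mult_right integrable_dominant)
  show "AE \<omega> in reference \<Lambda>. norm (exp (- energy \<Lambda> (merge_cfg \<Lambda> \<omega> \<xi>)))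
     \<le> norm (boundary_factor \<Lambda> \<xi> * dominant \<Lambda> r 0 \<omega>)"
    using exp_energy_le_dominant_0[OF assms] by (intro AE_I2) (auto intro: order_trans[OF _ abs_ge_self])
qed measurable

section \<open>Normalised kernels and the DLR equations\<close>

definition z :: "'v set \<Rightarrow> ('v \<Rightarrow> real) \<Rightarrow> real" where
  "z \<Lambda> \<xi> = (\<integral>\<omega>. exp (- energy \<Lambda> (merge_cfg \<Lambda> \<omega> \<xi>)) \<partial>reference \<Lambda>)"

lemma Z_eq_z:
  assumes "finite \<Lambda>"
  shows "Z \<Lambda> \<xi> = ennreal (z \<Lambda> \<xi>)"
  unfolding Z_eq z_def by (intro nn_integral_eq_integral integrable_exp_energy assms) auto

lemma z_pos:
  assumes "finite \<Lambda>"
  shows "z \<Lambda> \<xi> > 0"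
  using Z_pos[OF assms, of \<xi>] unfolding Z_eq_z[OF assms] by simp

text \<open>The measure behind \<open>local_spec\<close>: the push-forward along
  \<open>merge_cfg\<close> freezes the spins outside \<Lambda> at \<xi>. In this form kernels can be
  composed in the Giry monad.\<close>

definition kernel :: "'v set \<Rightarrow> ('v \<Rightarrow> real) \<Rightarrow> ('v \<Rightarrow> real) measure" where
  "kernel \<Lambda> \<xi> = density (distr (reference \<Lambda>) borel (\<lambda>\<omega>. merge_cfg \<Lambda> \<omega> \<xi>))
     (\<lambda>\<eta>. ennreal (exp (- energy \<Lambda> \<eta>)) / Z \<Lambda> \<xi>)"

lemma sets_kernel[simp, measurable_cong]: "sets (kernel \<Lambda> \<xi>) = sets borel"
  by (simp add: kernel_def)

lemma space_kernel[simp]: "space (kernel \<Lambda> \<xi>) = UNIV"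
  by (simp add: kernel_def)

lemma nn_integral_kernel:
  assumes [measurable]: "f \<in> borel_measurable borel"
  shows "(\<integral>\<^sup>+\<eta>. f \<eta> \<partial>kernel \<Lambda> \<xi>) =
    (\<integral>\<^sup>+\<omega>. f (merge_cfg \<Lambda> \<omega> \<xi>) * ennreal (exp (- energy \<Lambda> (merge_cfg \<Lambda> \<omega> \<xi>))) \<partial>reference \<Lambda>) / Z \<Lambda> \<xi>"
proof -
  have "(\<integral>\<^sup>+\<eta>. f \<eta> \<partial>kernel \<Lambda> \<xi>) = (\<integral>\<^sup>+\<omega>. ennreal (exp (- energy \<Lambda> (merge_cfg \<Lambda> \<omega> \<xi>))) / Z \<Lambda> \<xi>
      * f (merge_cfg \<Lambda> \<omega> \<xi>) \<partial>reference \<Lambda>)"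
    unfolding kernel_def by (subst nn_integral_density) (auto simp: nn_integral_distr)
  also have "\<dots> = (\<integral>\<^sup>+\<omega>. (f (merge_cfg \<Lambda> \<omega> \<xi>) * ennreal (exp (- energy \<Lambda> (merge_cfg \<Lambda> \<omega> \<xi>)))) / Z \<Lambda> \<xi> \<partial>reference \<Lambda>)"
    by (intro nn_integral_cong) (simp add: divide_ennreal_def mult_ac)
  also have "\<dots> = (\<integral>\<^sup>+\<omega>. f (merge_cfg \<Lambda> \<omega> \<xi>) * ennreal (exp (- energy \<Lambda> (merge_cfg \<Lambda> \<omega> \<xi>))) \<partial>reference \<Lambda>) / Z \<Lambda> \<xi>"
    by (rule nn_integral_divide) measurable
  finally show ?thesis .
qed

lemma emeasure_kernel:
  assumes "A \<in> sets borel"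
  shows "emeasure (kernel \<Lambda> \<xi>) A = local_spec adj W V \<Lambda> A \<xi>"
proof -
  have "emeasure (kernel \<Lambda> \<xi>) A = (\<integral>\<^sup>+\<eta>. indicator A \<eta> \<partial>kernel \<Lambda> \<xi>)"
    using assms by simp
  also have "\<dots> = local_spec adj W V \<Lambda> A \<xi>"
    unfolding local_spec_def hamiltonian_eq_energy using assms by (subst nn_integral_kernel) auto
  finally show ?thesis .
qed

lemma prob_space_kernel:
  assumes "finite \<Lambda>"
  shows "prob_space (kernel \<Lambda> \<xi>)"
proof (rule prob_spaceI)
  have "emeasure (kernel \<Lambda> \<xi>) (space (kernel \<Lambda> \<xi>)) = (\<integral>\<^sup>+\<eta>. 1 \<partial>kernel \<Lambda> \<xi>)" by simp
  also have "\<dots> = Z \<Lambda> \<xi> / Z \<Lambda> \<xi>"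
    by (subst nn_integral_kernel) (auto simp: Z_eq)
  also have "\<dots> = 1"
    using z_pos[OF assms, of \<xi>] by (simp add: Z_eq_z[OF assms] divide_ennreal)
  finally show "emeasure (kernel \<Lambda> \<xi>) (space (kernel \<Lambda> \<xi>)) = 1" .
qed

lemma kernel_measurable:
  assumes "finite \<Lambda>"
  shows "kernel \<Lambda> \<in> borel \<rightarrow>\<^sub>M prob_algebra borel"
proof (rule measurable_prob_algebraI)
  show "prob_space (kernel \<Lambda> \<xi>)" for \<xi> using assms by (rule prob_space_kernel)
  show "kernel \<Lambda> \<in> borel \<rightarrow>\<^sub>M subprob_algebra borel"
  proof (rule measurable_subprob_algebra)
    show "subprob_space (kernel \<Lambda> \<xi>)" for \<xi>
      using prob_space_kernel[OF assms] by (rule prob_space_imp_subprob_space)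
    fix A :: "('v \<Rightarrow> real) set" assume [measurable]: "A \<in> sets borel"
    have "(\<lambda>\<xi>. (\<integral>\<^sup>+\<omega>. indicator A (merge_cfg \<Lambda> \<omega> \<xi>) * ennreal (exp (- energy \<Lambda> (merge_cfg \<Lambda> \<omega> \<xi>))) \<partial>reference \<Lambda>))
      \<in> borel_measurable borel"
      by (rule reference_nn_integral_measurable[OF assms, of "\<lambda>\<eta>. indicator A \<eta> * ennreal (exp (- energy \<Lambda> \<eta>))"]) measurable
    then show "(\<lambda>\<xi>. emeasure (kernel \<Lambda> \<xi>) A) \<in> borel_measurable borel"
      unfolding emeasure_kernel[OF \<open>A \<in> sets borel\<close>] local_spec_def hamiltonian_eq_energy
      using Z_measurable[OF assms] by (intro borel_measurable_divide_ennreal)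
  qed simp
qed

lemma kernel_measurable_subprob: "finite \<Lambda> \<Longrightarrow> kernel \<Lambda> \<in> borel \<rightarrow>\<^sub>M subprob_algebra borel"
  by (intro measurable_prob_algebraD kernel_measurable)

lemma AE_kernel_outside: "AE \<eta> in kernel \<Lambda> \<xi>. \<forall>y. y \<notin> \<Lambda> \<longrightarrow> \<eta> y = \<xi> y"
proof -
  have [measurable]: "{\<eta>. \<forall>y. y \<notin> \<Lambda> \<longrightarrow> \<eta> y = \<xi> y} \<in> sets borel"
  proof -
    have "Measurable.pred borel (\<lambda>\<eta> :: 'v \<Rightarrow> real. \<forall>y. y \<notin> \<Lambda> \<longrightarrow> \<eta> y = \<xi> y)" by measurable
    then show ?thesis by (simp add: pred_def)
  qed
  have "AE \<eta> in distr (reference \<Lambda>) borel (\<lambda>\<omega>. merge_cfg \<Lambda> \<omega> \<xi>). \<forall>y. y \<notin> \<Lambda> \<longrightarrow> \<eta> y = \<xi> y"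
  proof (subst AE_distr_iff[OF merge_cfg_measurable])
    show "AE \<omega> in reference \<Lambda>. \<forall>y. y \<notin> \<Lambda> \<longrightarrow> merge_cfg \<Lambda> \<omega> \<xi> y = \<xi> y"
      by (simp add: merge_cfg_def)
  qed simp
  then show ?thesis unfolding kernel_def by (subst AE_density) auto
qed

text \<open>The DLR equations express invariance under resampling of any finite volume; consistency
  and weak limits are handled in this form.\<close>

lemma gibbs_iff:
  "\<mu> \<in> gibbs_measures adj W V \<longleftrightarrow> prob_space \<mu> \<and> sets \<mu> = sets borel \<and>
     (\<forall>\<Lambda>. finite \<Lambda> \<and> \<Lambda> \<noteq> {} \<longrightarrow> \<mu> \<bind> kernel \<Lambda> = \<mu>)"
proof -
  have "(\<forall>A\<in>sets borel. emeasure \<mu> A = (\<integral>\<^sup>+ \<omega>. local_spec adj W V \<Lambda> A \<omega> \<partial>\<mu>)) \<longleftrightarrow> \<mu> \<bind> kernel \<Lambda> = \<mu>"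
    if "prob_space \<mu>" and s: "sets \<mu> = sets borel" and "finite \<Lambda>" for \<Lambda>
  proof -
    interpret prob_space \<mu> by fact
    have k: "kernel \<Lambda> \<in> \<mu> \<rightarrow>\<^sub>M subprob_algebra borel"
      using kernel_measurable_subprob[OF \<open>finite \<Lambda>\<close>] s by (simp cong: measurable_cong_sets)
    have "emeasure (\<mu> \<bind> kernel \<Lambda>) A = (\<integral>\<^sup>+ \<omega>. local_spec adj W V \<Lambda> A \<omega> \<partial>\<mu>)" if "A \<in> sets borel" for A
      using emeasure_bind[OF not_empty k that] emeasure_kernel[OF that] by simp
    moreover have "sets (\<mu> \<bind> kernel \<Lambda>) = sets borel"
      by (rule sets_bind) (auto simp: not_empty)
    ultimately show ?thesis using s by (auto intro!: measure_eqI)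
  qed
  then show ?thesis unfolding gibbs_measures_def prob_measures_def by blast
qed

lemma nn_integral_gibbs:
  assumes "\<mu> \<in> gibbs_measures adj W V" "finite \<Lambda>" "\<Lambda> \<noteq> {}" "f \<in> borel_measurable borel"
  shows "(\<integral>\<^sup>+\<xi>. (\<integral>\<^sup>+\<eta>. f \<eta> \<partial>kernel \<Lambda> \<xi>) \<partial>\<mu>) = (\<integral>\<^sup>+\<eta>. f \<eta> \<partial>\<mu>)"
proof -
  have s: "sets \<mu> = sets borel" and eq: "\<mu> \<bind> kernel \<Lambda> = \<mu>" using assms gibbs_iff by auto
  have k: "kernel \<Lambda> \<in> \<mu> \<rightarrow>\<^sub>M subprob_algebra borel"
    using kernel_measurable_subprob[OF \<open>finite \<Lambda>\<close>] s by (simp cong: measurable_cong_sets)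
  show ?thesis using nn_integral_bind[OF assms(4) k] eq by simp
qed

section \<open>Feller property and consistency\<close>

lemma integral_kernel:
  assumes "finite \<Lambda>" and [measurable]: "f \<in> borel_measurable borel"
  shows "(\<integral>\<eta>. (f \<eta> :: real) \<partial>kernel \<Lambda> \<xi>) =
    (\<integral>\<omega>. exp (- energy \<Lambda> (merge_cfg \<Lambda> \<omega> \<xi>)) * f (merge_cfg \<Lambda> \<omega> \<xi>) \<partial>reference \<Lambda>) / z \<Lambda> \<xi>"
proof -
  have "kernel \<Lambda> \<xi> = density (distr (reference \<Lambda>) borel (\<lambda>\<omega>. merge_cfg \<Lambda> \<omega> \<xi>))
     (\<lambda>\<eta>. ennreal (exp (- energy \<Lambda> \<eta>) / z \<Lambda> \<xi>))"
    unfolding kernel_def Z_eq_z[OF assms(1)] using z_pos[OF assms(1), of \<xi>] by (simp add: divide_ennreal)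
  then have "(\<integral>\<eta>. f \<eta> \<partial>kernel \<Lambda> \<xi>) = (\<integral>\<omega>. exp (- energy \<Lambda> (merge_cfg \<Lambda> \<omega> \<xi>)) / z \<Lambda> \<xi> * f (merge_cfg \<Lambda> \<omega> \<xi>) \<partial>reference \<Lambda>)"
    using z_pos[OF assms(1), of \<xi>] by (simp add: integral_real_density integral_distr less_imp_le)
  then show ?thesis by simp
qed

text \<open>Dominated convergence: the majorant factors into \<open>dominant\<close>, free of the
  boundary condition, and \<open>boundary_factor\<close>, which depends continuously on finitely
  many spins and hence is bounded along a convergent sequence.\<close>

lemma tendsto_exp_energy_integral:
  fixes f :: "('v \<Rightarrow> real) \<Rightarrow> real"
  assumes "finite \<Lambda>" and f: "continuous_on UNIV f" "\<And>\<eta>. \<bar>f \<eta>\<bar> \<le> B" and lim: "\<xi>s \<longlonglongrightarrow> \<xi>"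
  shows "(\<lambda>n. \<integral>\<omega>. exp (- energy \<Lambda> (merge_cfg \<Lambda> \<omega> (\<xi>s n))) * f (merge_cfg \<Lambda> \<omega> (\<xi>s n)) \<partial>reference \<Lambda>)
    \<longlonglongrightarrow> (\<integral>\<omega>. exp (- energy \<Lambda> (merge_cfg \<Lambda> \<omega> \<xi>)) * f (merge_cfg \<Lambda> \<omega> \<xi>) \<partial>reference \<Lambda>)"
proof -
  have [measurable]: "f \<in> borel_measurable borel" using f(1) by (rule borel_measurable_continuous_onI)
  have B0: "0 \<le> B" using f(2)[of undefined] by linarith
  have lim_y: "(\<lambda>n. \<xi>s n y) \<longlonglongrightarrow> \<xi> y" for y using lim by (simp add: tendsto_fun_iff)
  have m_lim: "(\<lambda>n. merge_cfg \<Lambda> \<omega> (\<xi>s n)) \<longlonglongrightarrow> merge_cfg \<Lambda> \<omega> \<xi>" for \<omega>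
    unfolding tendsto_fun_iff merge_cfg_def using lim_y by auto
  have cont_lim: "(\<lambda>n. g (merge_cfg \<Lambda> \<omega> (\<xi>s n))) \<longlonglongrightarrow> g (merge_cfg \<Lambda> \<omega> \<xi>)"
    if "continuous_on UNIV g" for g :: "('v \<Rightarrow> real) \<Rightarrow> real" and \<omega>
    using continuous_on_tendsto_compose[OF that m_lim] by simp
  have "(\<lambda>n. boundary_factor \<Lambda> (\<xi>s n)) \<longlonglongrightarrow> boundary_factor \<Lambda> \<xi>"
    unfolding boundary_factor_def using params
    by (intro tendsto_intros tendsto_powr' tendsto_rabs lim_y) auto
  then have "Bseq (\<lambda>n. boundary_factor \<Lambda> (\<xi>s n))" by (rule convergent_imp_Bseq[OF convergentI])
  then obtain K where K: "\<And>n. \<bar>boundary_factor \<Lambda> (\<xi>s n)\<bar> \<le> K" by (auto simp: Bseq_def)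
  have dom0: "0 \<le> dominant \<Lambda> r 0 \<omega>" for \<omega> unfolding dominant_def by (intro prod_nonneg) auto
  show ?thesis
  proof (rule integral_dominated_convergence[where w = "\<lambda>\<omega>. (K * B) * dominant \<Lambda> r 0 \<omega>"])
    show "integrable (reference \<Lambda>) (\<lambda>\<omega>. (K * B) * dominant \<Lambda> r 0 \<omega>)"
      using assms params r_q by (intro integrable_mult_right integrable_dominant)
    show "AE \<omega> in reference \<Lambda>. (\<lambda>n. exp (- energy \<Lambda> (merge_cfg \<Lambda> \<omega> (\<xi>s n))) * f (merge_cfg \<Lambda> \<omega> (\<xi>s n)))
      \<longlonglongrightarrow> exp (- energy \<Lambda> (merge_cfg \<Lambda> \<omega> \<xi>)) * f (merge_cfg \<Lambda> \<omega> \<xi>)"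
      by (intro AE_I2 tendsto_mult tendsto_exp tendsto_minus cont_lim continuous_on_energy f(1))
    show "AE \<omega> in reference \<Lambda>. norm (exp (- energy \<Lambda> (merge_cfg \<Lambda> \<omega> (\<xi>s n))) * f (merge_cfg \<Lambda> \<omega> (\<xi>s n)))
      \<le> (K * B) * dominant \<Lambda> r 0 \<omega>" for n
    proof (intro AE_I2)
      fix \<omega>
      have "exp (- energy \<Lambda> (merge_cfg \<Lambda> \<omega> (\<xi>s n))) \<le> K * dominant \<Lambda> r 0 \<omega>"
        using K[of n] dom0[of \<omega>]
        by (intro order_trans[OF exp_energy_le_dominant_0[OF assms(1)]] mult_right_mono) auto
      then have "exp (- energy \<Lambda> (merge_cfg \<Lambda> \<omega> (\<xi>s n))) * \<bar>f (merge_cfg \<Lambda> \<omega> (\<xi>s n))\<bar> \<le> (K * dominant \<Lambda> r 0 \<omega>) * B"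
        by (intro mult_mono f(2)) (auto intro: order_trans[OF exp_ge_zero])
      then show "norm (exp (- energy \<Lambda> (merge_cfg \<Lambda> \<omega> (\<xi>s n))) * f (merge_cfg \<Lambda> \<omega> (\<xi>s n)))
        \<le> (K * B) * dominant \<Lambda> r 0 \<omega>"
        by (simp add: abs_mult mult_ac)
    qed
  qed measurable
qed

text \<open>A ratio of convergent integrals with positive limiting denominator; sequences suffice
  because a countable product of lines is metrizable.\<close>

lemma kernel_feller:
  fixes f :: "('v \<Rightarrow> real) \<Rightarrow> real"
  assumes "finite \<Lambda>" and f: "continuous_on UNIV f" "\<And>\<eta>. \<bar>f \<eta>\<bar> \<le> B"
  shows "continuous_on UNIV (\<lambda>\<xi>. \<integral>\<eta>. f \<eta> \<partial>kernel \<Lambda> \<xi>)"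
proof (rule continuous_on_sequentiallyI)
  fix \<xi>s \<xi> assume lim: "(\<xi>s :: nat \<Rightarrow> 'v \<Rightarrow> real) \<longlonglongrightarrow> \<xi>"
  have [measurable]: "f \<in> borel_measurable borel" using f(1) by (rule borel_measurable_continuous_onI)
  have "(\<lambda>n. z \<Lambda> (\<xi>s n)) \<longlonglongrightarrow> z \<Lambda> \<xi>"
    unfolding z_def using tendsto_exp_energy_integral[OF assms(1) _ _ lim, of "\<lambda>_. 1" 1] by simp
  then show "(\<lambda>n. \<integral>\<eta>. f \<eta> \<partial>kernel \<Lambda> (\<xi>s n)) \<longlonglongrightarrow> (\<integral>\<eta>. f \<eta> \<partial>kernel \<Lambda> \<xi>)"
    unfolding integral_kernel[OF assms(1) \<open>f \<in> borel_measurable borel\<close>]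
    using z_pos[OF assms(1), of \<xi>] by (intro tendsto_divide tendsto_exp_energy_integral[OF assms lim]) auto
qed

text \<open>By Fubini the spins of \<Delta> form the inner integral. With the others fixed, the
  Boltzmann factor of \<Lambda> is that of \<Delta> times a constant, so averaging \<open>f\<close>
  by the kernel of \<Delta> leaves the inner integral unchanged.\<close>

lemma kernel_consistent:
  assumes "finite \<Lambda>" "\<Delta> \<subseteq> \<Lambda>" and [measurable]: "f \<in> borel_measurable borel"
  shows "(\<integral>\<^sup>+\<eta>. (\<integral>\<^sup>+\<zeta>. f \<zeta> \<partial>kernel \<Delta> \<eta>) \<partial>kernel \<Lambda> \<xi>) = (\<integral>\<^sup>+\<eta>. f \<eta> \<partial>kernel \<Lambda> \<xi>)"
proof -
  define \<Gamma> where "\<Gamma> = \<Lambda> - \<Delta>"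
  have fin: "finite \<Delta>" "finite \<Gamma>" using assms by (auto simp: \<Gamma>_def intro: finite_subset)
  have L: "\<Lambda> = \<Gamma> \<union> \<Delta>" "\<Gamma> \<inter> \<Delta> = {}" using assms(2) by (auto simp: \<Gamma>_def)
  obtain g where g: "\<And>\<eta>. energy \<Lambda> \<eta> = energy \<Delta> \<eta> + g \<eta>"
    "\<And>\<eta> \<eta>'. (\<And>x. x \<notin> \<Delta> \<Longrightarrow> \<eta> x = \<eta>' x) \<Longrightarrow> g \<eta> = g \<eta>'"
    using energy_split[OF assms(1,2)] by metis
  define F where "F \<eta> = (\<integral>\<^sup>+\<zeta>. f \<zeta> \<partial>kernel \<Delta> \<eta>)" for \<eta>
  define b where "b \<Lambda> \<eta> = ennreal (exp (- energy \<Lambda> \<eta>))" for \<Lambda> \<eta>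
  have [measurable]: "b \<Lambda> \<in> borel_measurable borel" for \<Lambda> unfolding b_def[abs_def] by measurable
  have F[measurable]: "F \<in> borel_measurable borel"
    unfolding F_def[abs_def] using kernel_measurable_subprob[OF fin(1)] by (rule nn_integral_measurable_subprob_algebra2[rotated]) simp
  have fold: "(\<integral>\<^sup>+\<omega>. h (merge_cfg \<Lambda> \<omega> \<xi>) \<partial>reference \<Lambda>) =
      (\<integral>\<^sup>+\<omega>. (\<integral>\<^sup>+\<omega>'. h (merge_cfg \<Delta> \<omega>' (merge_cfg \<Gamma> \<omega> \<xi>)) \<partial>reference \<Delta>) \<partial>reference \<Gamma>)"
    if [measurable]: "h \<in> borel_measurable borel" for h :: "('v \<Rightarrow> real) \<Rightarrow> ennreal"
  proof -
    have "merge_cfg \<Lambda> (merge \<Gamma> \<Delta> (\<omega>, \<omega>')) \<xi> = merge_cfg \<Delta> \<omega>' (merge_cfg \<Gamma> \<omega> \<xi>)" for \<omega> \<omega>'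
      using L by (auto simp: merge_cfg_def merge_def fun_eq_iff)
    then show ?thesis
      unfolding L(1) using lborel_product.product_nn_integral_fold[OF L(2) fin(2,1), of "\<lambda>\<omega>. h (merge_cfg (\<Gamma> \<union> \<Delta>) \<omega> \<xi>)"]
      by simp
  qed
  have inner: "(\<integral>\<^sup>+\<omega>'. F (merge_cfg \<Delta> \<omega>' \<eta>) * b \<Lambda> (merge_cfg \<Delta> \<omega>' \<eta>) \<partial>reference \<Delta>) =
    (\<integral>\<^sup>+\<omega>'. f (merge_cfg \<Delta> \<omega>' \<eta>) * b \<Lambda> (merge_cfg \<Delta> \<omega>' \<eta>) \<partial>reference \<Delta>)" for \<eta>
  proof -
    have bL: "b \<Lambda> (merge_cfg \<Delta> \<omega>' \<eta>) = b \<Delta> (merge_cfg \<Delta> \<omega>' \<eta>) * ennreal (exp (- g \<eta>))" for \<omega>'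
    proof -
      have "g (merge_cfg \<Delta> \<omega>' \<eta>) = g \<eta>" by (rule g(2)) (simp add: merge_cfg_def)
      then show ?thesis unfolding b_def g(1) by (simp add: exp_add[symmetric] ennreal_mult[symmetric])
    qed
    \<comment> \<open>The average forgets the spins of \<Delta> in its argument, since
      \<open>merge_cfg\<close> overwrites them.\<close>
    have FC: "F (merge_cfg \<Delta> \<omega>' \<eta>) = F \<eta>" for \<omega>'
    proof -
      have "merge_cfg \<Delta> \<omega> (merge_cfg \<Delta> \<omega>' \<eta>) = merge_cfg \<Delta> \<omega> \<eta>" for \<omega>
        by (auto simp: merge_cfg_def)
      moreover have "Z \<Delta> (merge_cfg \<Delta> \<omega>' \<eta>) = Z \<Delta> \<eta>" by (rule Z_cong) (simp add: merge_cfg_def)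
      ultimately show ?thesis unfolding F_def nn_integral_kernel[OF assms(3)] by simp
    qed
    have "(\<integral>\<^sup>+\<omega>'. F (merge_cfg \<Delta> \<omega>' \<eta>) * b \<Lambda> (merge_cfg \<Delta> \<omega>' \<eta>) \<partial>reference \<Delta>) =
      (\<integral>\<^sup>+\<omega>'. (F \<eta> * ennreal (exp (- g \<eta>))) * b \<Delta> (merge_cfg \<Delta> \<omega>' \<eta>) \<partial>reference \<Delta>)"
      unfolding bL FC by (simp add: mult_ac)
    also have "\<dots> = (F \<eta> * ennreal (exp (- g \<eta>))) * Z \<Delta> \<eta>"
      unfolding Z_eq b_def by (rule nn_integral_cmult) measurable
    also have "\<dots> = ennreal (exp (- g \<eta>)) * (F \<eta> * Z \<Delta> \<eta>)" by (simp add: mult_ac)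
    also have "F \<eta> * Z \<Delta> \<eta> = (\<integral>\<^sup>+\<omega>'. f (merge_cfg \<Delta> \<omega>' \<eta>) * b \<Delta> (merge_cfg \<Delta> \<omega>' \<eta>) \<partial>reference \<Delta>)"
      unfolding F_def nn_integral_kernel[OF assms(3)] b_def[symmetric]
      using z_pos[OF fin(1), of \<eta>] by (simp add: ennreal_divide_times Z_eq_z[OF fin(1)] divide_ennreal)
    also have "ennreal (exp (- g \<eta>)) * \<dots> =
      (\<integral>\<^sup>+\<omega>'. ennreal (exp (- g \<eta>)) * (f (merge_cfg \<Delta> \<omega>' \<eta>) * b \<Delta> (merge_cfg \<Delta> \<omega>' \<eta>)) \<partial>reference \<Delta>)"
      by (rule nn_integral_cmult[symmetric]) measurable
    also have "\<dots> = (\<integral>\<^sup>+\<omega>'. f (merge_cfg \<Delta> \<omega>' \<eta>) * b \<Lambda> (merge_cfg \<Delta> \<omega>' \<eta>) \<partial>reference \<Delta>)"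
      unfolding bL by (simp add: mult_ac)
    finally show ?thesis .
  qed
  have "(\<integral>\<^sup>+\<eta>. F \<eta> \<partial>kernel \<Lambda> \<xi>) = (\<integral>\<^sup>+\<omega>. F (merge_cfg \<Lambda> \<omega> \<xi>) * b \<Lambda> (merge_cfg \<Lambda> \<omega> \<xi>) \<partial>reference \<Lambda>) / Z \<Lambda> \<xi>"
    unfolding b_def by (rule nn_integral_kernel[OF F])
  also have "(\<integral>\<^sup>+\<omega>. F (merge_cfg \<Lambda> \<omega> \<xi>) * b \<Lambda> (merge_cfg \<Lambda> \<omega> \<xi>) \<partial>reference \<Lambda>) =
      (\<integral>\<^sup>+\<omega>. f (merge_cfg \<Lambda> \<omega> \<xi>) * b \<Lambda> (merge_cfg \<Lambda> \<omega> \<xi>) \<partial>reference \<Lambda>)"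
    using fold[of "\<lambda>\<eta>. F \<eta> * b \<Lambda> \<eta>"] fold[of "\<lambda>\<eta>. f \<eta> * b \<Lambda> \<eta>"] by (simp add: inner)
  also have "\<dots> / Z \<Lambda> \<xi> = (\<integral>\<^sup>+\<eta>. f \<eta> \<partial>kernel \<Lambda> \<xi>)"
    unfolding b_def by (rule nn_integral_kernel[OF assms(3), symmetric])
  finally show ?thesis unfolding F_def .
qed

end

section \<open>Exponential moments in finite volume\<close>

text \<open>Jensen's inequality with the missing mass \<open>1 - sum t F\<close> placed at the value
  0; the proof averages the tangent line of exp at the mean.\<close>

lemma exp_weighted_mean_le:
  fixes t X :: "'i \<Rightarrow> real"
  assumes "finite F" "\<And>y. y \<in> F \<Longrightarrow> 0 \<le> t y" "sum t F \<le> 1"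
  shows "exp (\<Sum>y\<in>F. t y * X y) \<le> (\<Sum>y\<in>F. t y * exp (X y)) + (1 - sum t F)"
proof -
  define s where "s = (\<Sum>y\<in>F. t y * X y)"
  have tangent: "exp s * (1 + v - s) \<le> exp v" for v
  proof -
    have "exp s * (1 + (v - s)) \<le> exp s * exp (v - s)"
      by (intro mult_left_mono exp_ge_add_one_self) auto
    then show ?thesis by (simp add: exp_add[symmetric] algebra_simps)
  qed
  have "(\<Sum>y\<in>F. t y * (exp s * (1 + X y - s))) \<le> (\<Sum>y\<in>F. t y * exp (X y))"
    using assms(2) by (intro sum_mono mult_left_mono tangent)
  moreover have "(\<Sum>y\<in>F. t y * (exp s * (1 + X y - s))) = exp s * (sum t F + s - s * sum t F)"
  proof -
    have "(\<Sum>y\<in>F. t y * (exp s * (1 + X y - s))) = (\<Sum>y\<in>F. exp s * (t y + t y * X y - s * t y))"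
      by (intro sum.cong refl) (simp add: algebra_simps)
    also have "\<dots> = exp s * ((\<Sum>y\<in>F. t y) + (\<Sum>y\<in>F. t y * X y) - s * (\<Sum>y\<in>F. t y))"
      by (simp only: sum_distrib_left[symmetric] sum.distrib sum_subtractf)
    finally show ?thesis unfolding s_def .
  qed
  moreover have "(1 - sum t F) * (exp s * (1 + 0 - s)) \<le> (1 - sum t F) * exp 0"
    using assms(3) by (intro mult_left_mono tangent) auto
  ultimately have "exp s * (sum t F + s - s * sum t F) + (1 - sum t F) * (exp s * (1 + 0 - s))
    \<le> (\<Sum>y\<in>F. t y * exp (X y)) + (1 - sum t F)" by simp
  then show ?thesis unfolding s_def[symmetric] by (simp add: algebra_simps)
qed

text \<open>Hoelder's inequality in logarithmic form; after normalising the factors it is convexity of exp.\<close>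

lemma (in prob_space) nn_integral_exp_weighted_sum_le:
  fixes t n :: "'i \<Rightarrow> real"
  assumes "finite F" "\<And>y. y \<in> F \<Longrightarrow> 0 \<le> t y" "sum t F \<le> 1"
    and [measurable]: "\<And>y. y \<in> F \<Longrightarrow> X y \<in> borel_measurable M"
    and X: "\<And>y. y \<in> F \<Longrightarrow> (\<integral>\<^sup>+\<omega>. ennreal (exp (X y \<omega>)) \<partial>M) \<le> ennreal (exp (n y))"
  shows "(\<integral>\<^sup>+\<omega>. ennreal (exp (\<Sum>y\<in>F. t y * X y \<omega>)) \<partial>M) \<le> ennreal (exp (\<Sum>y\<in>F. t y * n y))"
proof -
  have pt: "ennreal (exp (\<Sum>y\<in>F. t y * X y \<omega>)) \<le> ennreal (exp (\<Sum>y\<in>F. t y * n y)) *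
      ((\<Sum>y\<in>F. ennreal (t y * exp (- n y)) * ennreal (exp (X y \<omega>))) + ennreal (1 - sum t F))" for \<omega>
  proof -
    \<comment> \<open>Subtracting \<open>n y\<close> makes each factor have integral at most 1, so
      the convexity bound integrates to at most \<open>sum t F + (1 - sum t F) = 1\<close>.\<close>
    have "exp (\<Sum>y\<in>F. t y * X y \<omega>) = exp (\<Sum>y\<in>F. t y * n y) * exp (\<Sum>y\<in>F. t y * (X y \<omega> - n y))"
      by (simp add: exp_add[symmetric] sum.distrib[symmetric] algebra_simps)
    also have "\<dots> \<le> exp (\<Sum>y\<in>F. t y * n y) * ((\<Sum>y\<in>F. t y * exp (X y \<omega> - n y)) + (1 - sum t F))"
      using assms by (intro mult_left_mono exp_weighted_mean_le) auto
    also have "(\<Sum>y\<in>F. t y * exp (X y \<omega> - n y)) = (\<Sum>y\<in>F. (t y * exp (- n y)) * exp (X y \<omega>))"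
      by (intro sum.cong refl) (simp add: exp_add[symmetric])
    finally have "ennreal (exp (\<Sum>y\<in>F. t y * X y \<omega>)) \<le> ennreal (exp (\<Sum>y\<in>F. t y * n y) *
      ((\<Sum>y\<in>F. (t y * exp (- n y)) * exp (X y \<omega>)) + (1 - sum t F)))"
      by (rule ennreal_leI)
    also have "\<dots> = ennreal (exp (\<Sum>y\<in>F. t y * n y)) *
      ((\<Sum>y\<in>F. ennreal (t y * exp (- n y)) * ennreal (exp (X y \<omega>))) + ennreal (1 - sum t F))"
    proof -
      have "(\<Sum>y\<in>F. ennreal (t y * exp (- n y)) * ennreal (exp (X y \<omega>))) = ennreal (\<Sum>y\<in>F. (t y * exp (- n y)) * exp (X y \<omega>))"
        using assms(2) by (subst sum_ennreal[symmetric]) (auto intro!: sum.cong simp: ennreal_mult)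
      then show ?thesis
        using assms by (simp add: ennreal_mult ennreal_plus[symmetric] sum_nonneg del: ennreal_plus)
    qed
    finally show ?thesis .
  qed
  have "(\<integral>\<^sup>+\<omega>. ennreal (exp (\<Sum>y\<in>F. t y * X y \<omega>)) \<partial>M) \<le>
     (\<integral>\<^sup>+\<omega>. ennreal (exp (\<Sum>y\<in>F. t y * n y)) *
      ((\<Sum>y\<in>F. ennreal (t y * exp (- n y)) * ennreal (exp (X y \<omega>))) + ennreal (1 - sum t F)) \<partial>M)"
    by (intro nn_integral_mono pt)
  also have "\<dots> = ennreal (exp (\<Sum>y\<in>F. t y * n y)) *
      ((\<Sum>y\<in>F. ennreal (t y * exp (- n y)) * (\<integral>\<^sup>+\<omega>. ennreal (exp (X y \<omega>)) \<partial>M)) + ennreal (1 - sum t F))"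
    by (simp add: nn_integral_cmult nn_integral_add nn_integral_sum emeasure_space_1)
  also have "\<dots> \<le> ennreal (exp (\<Sum>y\<in>F. t y * n y)) *
      ((\<Sum>y\<in>F. ennreal (t y * exp (- n y)) * ennreal (exp (n y))) + ennreal (1 - sum t F))"
    by (intro mult_left_mono add_mono sum_mono X order_refl) auto
  also have "(\<Sum>y\<in>F. ennreal (t y * exp (- n y)) * ennreal (exp (n y))) = ennreal (sum t F)"
    using assms(2) by (subst sum_ennreal[symmetric]) (auto intro!: sum.cong simp: ennreal_mult[symmetric] mult.assoc exp_add[symmetric])
  also have "ennreal (sum t F) + ennreal (1 - sum t F) = 1"
    using assms by (simp add: ennreal_plus[symmetric] sum_nonneg del: ennreal_plus)
  finally show ?thesis by simp
qed

text \<open>Either \<open>t powr r\<close> is below \<open>A powr \<theta>\<close>, or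
  \<open>A\<close> is below \<open>t powr (r / \<theta>)\<close> and can be traded for it. This
  trade is the origin of the exponent \<open>r + r / \<theta>\<close>; for \<open>A\<close>
  proportional to a product of degrees the last term becomes a summand of
  \<open>m_theta\<close>.\<close>

lemma powr_le_powr_div_plus:
  fixes t A r \<theta> :: real
  assumes "0 \<le> t" "0 < A" "0 < r" "0 < \<theta>"
  shows "t powr r \<le> t powr (r + r / \<theta>) / A + A powr \<theta>"
proof (cases "t powr r \<le> A powr \<theta>")
  case True
  then show ?thesis using assms by (simp add: add_increasing)
next
  case False
  then have "(A powr \<theta>) powr (1 / \<theta>) \<le> (t powr r) powr (1 / \<theta>)" using assms by (intro powr_mono2) auto
  then have "A \<le> t powr (r / \<theta>)" using assms by (simp add: powr_powr)
  then have "t powr r * A \<le> t powr r * t powr (r / \<theta>)" by (intro mult_left_mono) auto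
  then have "t powr r * A \<le> t powr (r + r / \<theta>)" by (simp only: powr_add)
  then have "t powr r \<le> t powr (r + r / \<theta>) / A" using assms by (simp add: pos_le_divide_eq)
  then show ?thesis by (simp add: add_increasing2)
qed

text \<open>Passes from the critical exponent to any larger \<open>p\<close>; the 1 goes into the
  constants.\<close>

lemma powr_le_1_plus_powr:
  fixes t s p :: real
  assumes "0 \<le> t" "0 \<le> s" "s \<le> p"
  shows "t powr s \<le> 1 + t powr p"
proof (cases "t \<le> 1")
  case True
  then have "t powr s \<le> 1" using assms by (intro powr_le1) auto
  then show ?thesis using powr_ge_zero[of t p] by linarith
next
  case False
  then have "t powr s \<le> t powr p" using assms by (intro powr_mono) auto
  then show ?thesis by linarith
qed

text \<open>The weights are abstract: \<open>E\<close> bounds their ratio across an edge,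
  \<open>M\<close> the total mass. The summand 1 in \<open>mass\<close> pays for constants per site
  and bounds the total weight.\<close>

locale tempered_spin_system = spin_system adj W V I J r a c q
  for adj :: "'v::countable \<Rightarrow> 'v \<Rightarrow> bool" and W V I J r a c q +
  fixes w :: "'v \<Rightarrow> real" and \<theta> p E M :: real
  assumes irrefl: "\<And>x. \<not> adj x x"
    and w_pos: "\<And>x. 0 < w x"
    and w_adj: "\<And>x y. adj x y \<Longrightarrow> w x \<le> E * w y"
    and E_ge_1: "1 \<le> E"
    and \<theta>_pos: "0 < \<theta>"
    and p_ge: "r + r / \<theta> \<le> p"
    and p_less: "p < q"
    and mass: "\<And>F. finite F \<Longrightarrow> (\<Sum>x\<in>F. (1 + m_theta adj \<theta> x) * w x) \<le> M"
begin

section \<open>Degree estimates and the single-site kernel\<close>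

abbreviation nbrs :: "'v \<Rightarrow> 'v set" where
  "nbrs x \<equiv> {y. adj x y}"

abbreviation deg :: "'v \<Rightarrow> real" where
  "deg x \<equiv> real (degree adj x)"

lemma p_pos: "0 < p"
proof -
  have "0 < r + r / \<theta>" using params \<theta>_pos by (simp add: add_pos_pos)
  then show ?thesis using p_ge by linarith
qed

lemma deg_ge_1: "adj x y \<Longrightarrow> 1 \<le> deg x"
  using loc_fin[of x] by (auto simp: degree_def card_gt_0_iff Suc_le_eq)

lemma m_theta_nonneg: "0 \<le> m_theta adj \<theta> x"
  unfolding m_theta_def by (intro sum_nonneg) auto

lemma M_pos: "0 < M"
proof -
  have "0 < (\<Sum>x\<in>{undefined}. (1 + m_theta adj \<theta> x) * w x)"
    using m_theta_nonneg w_pos by (simp add: add_pos_nonneg)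
  then show ?thesis using mass[of "{undefined}"] by simp
qed

lemma sum_w_le: "finite F \<Longrightarrow> sum w F \<le> M"
  using m_theta_nonneg w_pos
  by (intro order_trans[OF sum_mono mass]) (auto simp: algebra_simps less_imp_le)

text \<open>Each neighbour has degree at least 1 and so contributes at least
  \<open>deg x powr \<theta>\<close>.\<close>

lemma deg_powr_le_m_theta: "deg x powr (1 + \<theta>) \<le> m_theta adj \<theta> x"
proof -
  have "deg x powr (1 + \<theta>) = deg x * deg x powr \<theta>"
    by (cases "deg x = 0") (auto simp: powr_add)
  also have "\<dots> = (\<Sum>y\<in>nbrs x. deg x powr \<theta>)" by (simp add: degree_def)
  also have "\<dots> \<le> m_theta adj \<theta> x"
    unfolding m_theta_def
  proof (rule sum_mono)
    fix y assume "y \<in> nbrs x"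
    then have "deg x * 1 \<le> deg x * deg y" using deg_ge_1[OF sym] by (intro mult_left_mono) auto
    then show "deg x powr \<theta> \<le> (deg x * deg y) powr \<theta>" using \<theta>_pos by (intro powr_mono2) auto
  qed
  finally show ?thesis .
qed

lemma deg_le_m_theta: "deg x \<le> m_theta adj \<theta> x"
proof (cases "deg x = 0")
  case False
  then have "1 \<le> deg x" by simp
  then have "deg x powr 1 \<le> deg x powr (1 + \<theta>)" using \<theta>_pos by (intro powr_mono) auto
  then show ?thesis using deg_powr_le_m_theta[of x] \<open>1 \<le> deg x\<close> by simp
qed (simp add: m_theta_nonneg)

text \<open>The entries are symmetric in \<open>x\<close> and \<open>y\<close>, so this bounds both
  row and column sums of the neighbour matrix, whatever the degrees.\<close>

lemma sum_inverse_deg_le_1: "(\<Sum>y\<in>nbrs x \<inter> B. 1 / (deg x * deg y)) \<le> 1"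
proof -
  have "(\<Sum>y\<in>nbrs x \<inter> B. 1 / (deg x * deg y)) \<le> (\<Sum>y\<in>nbrs x. 1 / (deg x * deg y))"
    using loc_fin by (intro sum_mono2) auto
  also have "\<dots> \<le> (\<Sum>y\<in>nbrs x. 1 / deg x)"
  proof (rule sum_mono)
    fix y assume y: "y \<in> nbrs x"
    then have "1 \<le> deg x" "1 \<le> deg y" using deg_ge_1[of x y] deg_ge_1[OF sym] by auto
    then show "1 / (deg x * deg y) \<le> 1 / deg x" by (simp add: field_simps)
  qed
  also have "\<dots> \<le> 1" by (simp add: degree_def)
  finally show ?thesis .
qed

text \<open>The trade with \<open>A = J / \<kappa> * deg x * deg y\<close>: dividing
  \<open>J\<close> by \<open>A\<close> leaves the coefficient
  \<open>\<kappa> / (deg x * deg y)\<close>, and the terms \<open>A powr \<theta>\<close> sum to a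
  multiple of \<open>m_theta\<close>.\<close>

lemma sum_boundary_term_le:
  assumes "0 < \<kappa>"
  shows "J * (\<Sum>y\<in>nbrs x. \<bar>\<xi> y\<bar> powr r) \<le> \<kappa> * (\<Sum>y\<in>nbrs x. \<bar>\<xi> y\<bar> powr p / (deg x * deg y)) + \<kappa>
    + J * (J / \<kappa>) powr \<theta> * m_theta adj \<theta> x"
proof -
  have "J * (\<Sum>y\<in>nbrs x. \<bar>\<xi> y\<bar> powr r) \<le> (\<Sum>y\<in>nbrs x. \<kappa> * (\<bar>\<xi> y\<bar> powr p / (deg x * deg y))
      + \<kappa> * (1 / (deg x * deg y)) + J * (J / \<kappa>) powr \<theta> * (deg x * deg y) powr \<theta>)"
    unfolding sum_distrib_left
  proof (rule sum_mono)
    fix y assume y: "y \<in> nbrs x"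
    define N where "N = deg x * deg y"
    have "1 \<le> deg x" "1 \<le> deg y" using y deg_ge_1[of x y] deg_ge_1[OF sym] by auto
    then have N: "0 < N" unfolding N_def by (intro mult_pos_pos) auto
    have "\<bar>\<xi> y\<bar> powr r \<le> \<bar>\<xi> y\<bar> powr (r + r / \<theta>) / (J / \<kappa> * N) + (J / \<kappa> * N) powr \<theta>"
      using N assms params \<theta>_pos by (intro powr_le_powr_div_plus) auto
    also have "\<dots> \<le> (1 + \<bar>\<xi> y\<bar> powr p) / (J / \<kappa> * N) + (J / \<kappa> * N) powr \<theta>"
      using N assms params \<theta>_pos p_ge
      by (intro add_right_mono divide_right_mono powr_le_1_plus_powr) (auto simp: less_imp_le add_nonneg_nonneg)
    finally have "J * \<bar>\<xi> y\<bar> powr r \<le> J * ((1 + \<bar>\<xi> y\<bar> powr p) / (J / \<kappa> * N) + (J / \<kappa> * N) powr \<theta>)"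
      using params by (intro mult_left_mono) auto
    also have "\<dots> = \<kappa> * (\<bar>\<xi> y\<bar> powr p / N) + \<kappa> * (1 / N) + J * (J / \<kappa>) powr \<theta> * N powr \<theta>"
      using N assms params by (simp add: powr_mult powr_divide field_simps)
    finally show "J * \<bar>\<xi> y\<bar> powr r \<le> \<kappa> * (\<bar>\<xi> y\<bar> powr p / (deg x * deg y))
      + \<kappa> * (1 / (deg x * deg y)) + J * (J / \<kappa>) powr \<theta> * (deg x * deg y) powr \<theta>"
      unfolding N_def .
  qed
  also have "\<dots> = \<kappa> * (\<Sum>y\<in>nbrs x. \<bar>\<xi> y\<bar> powr p / (deg x * deg y)) + \<kappa> * (\<Sum>y\<in>nbrs x. 1 / (deg x * deg y))
    + J * (J / \<kappa>) powr \<theta> * m_theta adj \<theta> x"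
    unfolding m_theta_def by (simp only: sum.distrib sum_distrib_left)
  also have "\<dots> \<le> \<kappa> * (\<Sum>y\<in>nbrs x. \<bar>\<xi> y\<bar> powr p / (deg x * deg y)) + \<kappa> * 1
    + J * (J / \<kappa>) powr \<theta> * m_theta adj \<theta> x"
    using sum_inverse_deg_le_1[of x UNIV] assms by (intro add_mono mult_left_mono order_refl) auto
  finally show ?thesis by simp
qed

lemma energy_singleton:
  "\<bar>energy {x} (merge_cfg {x} \<omega> \<xi>) - V (\<omega> x)\<bar>
     \<le> deg x * I / 2 + deg x * J / 2 * \<bar>\<omega> x\<bar> powr r + J / 2 * (\<Sum>y\<in>nbrs x. \<bar>\<xi> y\<bar> powr r)"
proof -
  let ?\<eta> = "merge_cfg {x} \<omega> \<xi>"
  have "pairs {x} {x} = {}" using irrefl by (auto simp: pairs_def)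
  then have 1: "interaction {x} {x} ?\<eta> = 0" by (simp add: interaction_def)
  have "pairs {x} (- {x}) = Pair x ` nbrs x" using irrefl by (auto simp: pairs_def)
  then have "interaction {x} (- {x}) ?\<eta> = (\<Sum>y\<in>nbrs x. W (?\<eta> x) (?\<eta> y))"
    unfolding interaction_def by (simp add: sum.reindex inj_on_def)
  also have "\<dots> = (\<Sum>y\<in>nbrs x. W (\<omega> x) (\<xi> y))"
    using irrefl by (intro sum.cong) (auto simp: merge_cfg_def)
  finally have "energy {x} ?\<eta> - V (\<omega> x) = (\<Sum>y\<in>nbrs x. W (\<omega> x) (\<xi> y))"
    by (simp add: energy_def 1) (simp add: merge_cfg_def)
  then have "\<bar>energy {x} ?\<eta> - V (\<omega> x)\<bar> \<le> (\<Sum>y\<in>nbrs x. \<bar>W (\<omega> x) (\<xi> y)\<bar>)" by (simp add: sum_abs)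
  also have "\<dots> \<le> (\<Sum>y\<in>nbrs x. I / 2 + J / 2 * \<bar>\<omega> x\<bar> powr r + J / 2 * \<bar>\<xi> y\<bar> powr r)"
    using W_bound by (intro sum_mono) (simp add: field_simps)
  also have "\<dots> = deg x * I / 2 + deg x * J / 2 * \<bar>\<omega> x\<bar> powr r + J / 2 * (\<Sum>y\<in>nbrs x. \<bar>\<xi> y\<bar> powr r)"
    by (simp add: sum.distrib sum_distrib_left degree_def algebra_simps)
  finally show ?thesis .
qed

text \<open>The numerator is at most \<open>exp A * K\<close>; the partition function is bounded
  below by restricting the spin to [0, 1], where the energy is at most \<open>- B\<close>. The
  boundary spins enter both with \<open>J / 2 * S\<close>, and \<open>sum_boundary_term_le\<close>
  converts the total \<open>J * S\<close>. Powers of the degree go into \<open>m_theta\<close>,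
  which keeps \<open>C\<close> independent of \<open>x\<close> and \<xi>.\<close>

lemma kernel_singleton_moment:
  assumes "0 < l" "0 < \<kappa>"
  shows "\<exists>C>0. \<forall>x \<xi>. (\<integral>\<^sup>+\<eta>. ennreal (exp (l * \<bar>\<eta> x\<bar> powr p)) \<partial>kernel {x} \<xi>)
    \<le> ennreal (exp (C * (1 + m_theta adj \<theta> x) + \<kappa> * (\<Sum>y\<in>nbrs x. \<bar>\<xi> y\<bar> powr p / (deg x * deg y))))"
proof -
  \<comment> \<open>The zero terms fit \<open>integrable_stretched_exp\<close>; the extra
    \<open>J / 2\<close> is the price for trading \<open>deg x * |u|^r\<close> for
    \<open>|u|^p\<close>.\<close>
  define K where "K = (\<integral>u. exp (0 + 0 * \<bar>u\<bar> powr r + (J / 2 + l) * \<bar>u\<bar> powr p - a * \<bar>u\<bar> powr q) \<partial>lborel)"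
  have K_int: "integrable lborel (\<lambda>u. exp (0 + 0 * \<bar>u\<bar> powr r + (J / 2 + l) * \<bar>u\<bar> powr p - a * \<bar>u\<bar> powr q))"
    using params r_q p_pos p_less by (intro integrable_stretched_exp)
  have K0: "0 \<le> K" unfolding K_def by (intro integral_nonneg_AE) auto
  have "compact (V ` {0..1})"
    by (intro compact_continuous_image continuous_on_subset[OF V_cont]) auto
  then obtain v where v: "\<And>u. 0 \<le> u \<Longrightarrow> u \<le> 1 \<Longrightarrow> \<bar>V u\<bar> \<le> v"
    using compact_imp_bounded[of "V ` {0..1}"] by (auto simp: bounded_iff) (metis atLeastAtMost_iff)
  have v0: "0 \<le> v" using v[of 0] by simp
  \<comment> \<open>Collects the constants and the coefficients of \<open>m_theta\<close> from the
    estimate of \<open>A + K - B\<close> at the end.\<close>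
  define C where "C = K + \<bar>c\<bar> + v + J / 2 + \<kappa> + I + J + J * (J / \<kappa>) powr \<theta>"
  have "0 \<le> J * (J / \<kappa>) powr \<theta>" using params by (intro mult_nonneg_nonneg) auto
  then have C0: "0 < C" unfolding C_def using K0 v0 params assms by linarith
  have "(\<integral>\<^sup>+\<eta>. ennreal (exp (l * \<bar>\<eta> x\<bar> powr p)) \<partial>kernel {x} \<xi>)
    \<le> ennreal (exp (C * (1 + m_theta adj \<theta> x) + \<kappa> * (\<Sum>y\<in>nbrs x. \<bar>\<xi> y\<bar> powr p / (deg x * deg y))))" for x \<xi>
  proof -
    define S where "S = (\<Sum>y\<in>nbrs x. \<bar>\<xi> y\<bar> powr r)"
    define m where "m = m_theta adj \<theta> x"
    define A where "A = deg x * I / 2 + J / 2 * (deg x powr (1 + \<theta>) + 1) + J / 2 * S + c"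
    define B where "B = - (deg x * I / 2 + deg x * J / 2 + J / 2 * S + v)"
    have up: "l * \<bar>\<omega> x\<bar> powr p - energy {x} (merge_cfg {x} \<omega> \<xi>)
      \<le> A + (0 + 0 * \<bar>\<omega> x\<bar> powr r + (J / 2 + l) * \<bar>\<omega> x\<bar> powr p - a * \<bar>\<omega> x\<bar> powr q)" for \<omega>
    proof -
      \<comment> \<open>The same trade with \<open>A = deg x\<close>; the leftover
        \<open>deg x powr (1 + \<theta>)\<close> is at most \<open>m_theta\<close>.\<close>
      have "deg x * \<bar>\<omega> x\<bar> powr r \<le> \<bar>\<omega> x\<bar> powr p + 1 + deg x powr (1 + \<theta>)"
      proof (cases "deg x = 0")
        case True
        then show ?thesis by (simp add: add_nonneg_nonneg)
      next
        case False
        then have d: "0 < deg x" by simp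
        have "deg x * \<bar>\<omega> x\<bar> powr r \<le> deg x * (\<bar>\<omega> x\<bar> powr (r + r / \<theta>) / deg x + deg x powr \<theta>)"
          using d params \<theta>_pos by (intro mult_left_mono powr_le_powr_div_plus) auto
        also have "\<dots> = \<bar>\<omega> x\<bar> powr (r + r / \<theta>) + deg x powr (1 + \<theta>)"
          using d by (simp add: powr_add field_simps)
        also have "\<bar>\<omega> x\<bar> powr (r + r / \<theta>) \<le> 1 + \<bar>\<omega> x\<bar> powr p"
          using params \<theta>_pos p_ge by (intro powr_le_1_plus_powr) (auto simp: add_nonneg_nonneg less_imp_le)
        finally show ?thesis by simp
      qed
      then have "J / 2 * (deg x * \<bar>\<omega> x\<bar> powr r) \<le> J / 2 * (\<bar>\<omega> x\<bar> powr p + 1 + deg x powr (1 + \<theta>))"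
        using params by (intro mult_left_mono) auto
      then show ?thesis
        using energy_singleton[of x \<omega> \<xi>] V_bound[of "\<omega> x"] unfolding A_def S_def
        by (simp add: algebra_simps)
    qed
    have low: "B \<le> - energy {x} (merge_cfg {x} \<omega> \<xi>)" if "0 \<le> \<omega> x" "\<omega> x \<le> 1" for \<omega>
    proof -
      have "\<bar>\<omega> x\<bar> powr r \<le> 1" using that params by (intro powr_le1) auto
      then have "deg x * J / 2 * \<bar>\<omega> x\<bar> powr r \<le> deg x * J / 2 * 1"
        using params by (intro mult_left_mono) auto
      then show ?thesis
        using energy_singleton[of x \<omega> \<xi>] v[OF that] unfolding B_def S_def by linarith
    qed
    have "(\<integral>\<^sup>+\<omega>. ennreal (exp (l * \<bar>merge_cfg {x} \<omega> \<xi> x\<bar> powr p)) * ennreal (exp (- energy {x} (merge_cfg {x} \<omega> \<xi>))) \<partial>reference {x})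
      \<le> (\<integral>\<^sup>+\<omega>. ennreal (exp A) * ennreal (exp (0 + 0 * \<bar>\<omega> x\<bar> powr r + (J / 2 + l) * \<bar>\<omega> x\<bar> powr p - a * \<bar>\<omega> x\<bar> powr q)) \<partial>reference {x})"
      using up by (intro nn_integral_mono)
        (simp add: ennreal_mult[symmetric] exp_add[symmetric] merge_cfg_def)
    also have "\<dots> = (\<integral>\<^sup>+u. ennreal (exp A) * ennreal (exp (0 + 0 * \<bar>u\<bar> powr r + (J / 2 + l) * \<bar>u\<bar> powr p - a * \<bar>u\<bar> powr q)) \<partial>lborel)"
      using borel_measurable_integrable[OF K_int]
      by (intro lborel_product.product_nn_integral_singleton borel_measurable_times_ennreal) auto
    also have "\<dots> = ennreal (exp A) * ennreal K"
    proof -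
      have "(\<integral>\<^sup>+u. ennreal (exp (0 + 0 * \<bar>u\<bar> powr r + (J / 2 + l) * \<bar>u\<bar> powr p - a * \<bar>u\<bar> powr q)) \<partial>lborel) = ennreal K"
        unfolding K_def by (intro nn_integral_eq_integral K_int) auto
      moreover have "(\<lambda>u. ennreal (exp (0 + 0 * \<bar>u\<bar> powr r + (J / 2 + l) * \<bar>u\<bar> powr p - a * \<bar>u\<bar> powr q))) \<in> borel_measurable lborel"
        using borel_measurable_integrable[OF K_int] by simp
      ultimately show ?thesis by (simp only: nn_integral_cmult)
    qed
    finally have num: "(\<integral>\<^sup>+\<omega>. ennreal (exp (l * \<bar>merge_cfg {x} \<omega> \<xi> x\<bar> powr p)) * ennreal (exp (- energy {x} (merge_cfg {x} \<omega> \<xi>))) \<partial>reference {x})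
      \<le> ennreal (exp A * K)" using K0 by (simp add: ennreal_mult)
    have "ennreal (exp B) = (\<integral>\<^sup>+u. ennreal (exp B) * indicator {0..1::real} u \<partial>lborel)"
      by (subst nn_integral_cmult) auto
    also have "\<dots> = (\<integral>\<^sup>+\<omega>. ennreal (exp B) * indicator {0..1} (\<omega> x) \<partial>reference {x})"
      by (rule lborel_product.product_nn_integral_singleton[symmetric]) measurable
    also have "\<dots> \<le> Z {x} \<xi>"
      unfolding Z_eq using low by (intro nn_integral_mono) (auto simp: indicator_def)
    finally have den: "exp B \<le> z {x} \<xi>"
      using z_pos[of "{x}" \<xi>] by (simp add: Z_eq_z)
    have "(\<integral>\<^sup>+\<eta>. ennreal (exp (l * \<bar>\<eta> x\<bar> powr p)) \<partial>kernel {x} \<xi>) \<le> ennreal (exp A * K) / ennreal (z {x} \<xi>)"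
      using num by (subst nn_integral_kernel) (auto simp: Z_eq_z[symmetric] intro: divide_right_mono_ennreal)
    also have "\<dots> = ennreal (exp A * K / z {x} \<xi>)"
      using z_pos[of "{x}" \<xi>] K0 by (intro divide_ennreal) auto
    also have "\<dots> \<le> ennreal (exp A * K / exp B)"
      using den K0 z_pos[of "{x}" \<xi>] by (intro ennreal_leI divide_left_mono) auto
    also have "exp A * K / exp B \<le> exp A * exp K / exp B"
    proof -
      \<comment> \<open>Moves the prefactor into the exponent, where all constants add up.\<close>
      have "K \<le> exp K" using exp_ge_add_one_self[of K] by linarith
      then show ?thesis by (intro divide_right_mono mult_left_mono) auto
    qed
    also have "\<dots> = exp (A + K - B)" by (simp add: exp_add exp_diff)
    also have "A + K - B \<le> C * (1 + m) + \<kappa> * (\<Sum>y\<in>nbrs x. \<bar>\<xi> y\<bar> powr p / (deg x * deg y))"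
    proof -
      have m0: "0 \<le> m" unfolding m_def by (rule m_theta_nonneg)
      have "A + K - B = K + c + v + J / 2 + deg x * I + J / 2 * deg x + J / 2 * deg x powr (1 + \<theta>) + J * S"
        unfolding A_def B_def by (simp add: field_simps)
      also have "\<dots> \<le> K + \<bar>c\<bar> + v + J / 2 + m * I + J / 2 * m + J / 2 * m
         + (\<kappa> * (\<Sum>y\<in>nbrs x. \<bar>\<xi> y\<bar> powr p / (deg x * deg y)) + \<kappa> + J * (J / \<kappa>) powr \<theta> * m)"
        unfolding S_def m_def using params
        by (intro add_mono mult_left_mono mult_right_mono deg_le_m_theta deg_powr_le_m_theta
            sum_boundary_term_le assms order_refl) auto
      also have "\<dots> = (K + \<bar>c\<bar> + v + J / 2 + \<kappa>) + (I + J + J * (J / \<kappa>) powr \<theta>) * m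
         + \<kappa> * (\<Sum>y\<in>nbrs x. \<bar>\<xi> y\<bar> powr p / (deg x * deg y))"
        by (simp add: algebra_simps)
      also have "\<dots> \<le> C * 1 + C * m + \<kappa> * (\<Sum>y\<in>nbrs x. \<bar>\<xi> y\<bar> powr p / (deg x * deg y))"
        using m0 K0 v0 params assms \<open>0 \<le> J * (J / \<kappa>) powr \<theta>\<close> unfolding C_def
        by (intro add_mono mult_right_mono order_refl) auto
      finally show ?thesis by (simp add: algebra_simps)
    qed
    finally show ?thesis unfolding m_def by (simp add: ennreal_leI)
  qed
  with C0 show ?thesis by blast
qed

section \<open>From one site to finite volumes\<close>

lemma kernel_moment_finite:
  assumes "finite \<Lambda>" "x \<in> \<Lambda>" "0 \<le> l"
  shows "(\<integral>\<^sup>+\<eta>. ennreal (exp (l * \<bar>\<eta> x\<bar> powr p)) \<partial>kernel \<Lambda> \<xi>) < \<infinity>"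
proof -
  let ?m = "\<lambda>\<omega>. merge_cfg \<Lambda> \<omega> \<xi>"
  have le: "exp (l * \<bar>?m \<omega> x\<bar> powr p) * exp (- energy \<Lambda> (?m \<omega>)) \<le> boundary_factor \<Lambda> \<xi> * dominant \<Lambda> p l \<omega>" for \<omega>
  proof -
    have "\<bar>?m \<omega> x\<bar> powr p \<le> (\<Sum>x\<in>\<Lambda>. \<bar>?m \<omega> x\<bar> powr p)"
      using assms by (intro member_le_sum) auto
    then have "l * \<bar>?m \<omega> x\<bar> powr p - energy \<Lambda> (?m \<omega>) \<le> l * (\<Sum>x\<in>\<Lambda>. \<bar>?m \<omega> x\<bar> powr p) - energy \<Lambda> (?m \<omega>)"
      using assms by (intro diff_right_mono mult_left_mono)
    then have "exp (l * \<bar>?m \<omega> x\<bar> powr p - energy \<Lambda> (?m \<omega>)) \<le> boundary_factor \<Lambda> \<xi> * dominant \<Lambda> p l \<omega>"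
      by (intro order_trans[OF _ exp_energy_le_dominant[OF assms(1)]]) simp
    then show ?thesis by (simp add: exp_add[symmetric])
  qed
  have int: "integrable (reference \<Lambda>) (\<lambda>\<omega>. boundary_factor \<Lambda> \<xi> * dominant \<Lambda> p l \<omega>)"
    using assms p_pos p_less by (intro integrable_mult_right integrable_dominant)
  have dom0: "0 \<le> boundary_factor \<Lambda> \<xi> * dominant \<Lambda> p l \<omega>" for \<omega>
    unfolding dominant_def boundary_factor_def by (intro mult_nonneg_nonneg prod_nonneg) auto
  have "(\<integral>\<^sup>+\<omega>. ennreal (exp (l * \<bar>?m \<omega> x\<bar> powr p)) * ennreal (exp (- energy \<Lambda> (?m \<omega>))) \<partial>reference \<Lambda>)
    \<le> (\<integral>\<^sup>+\<omega>. ennreal (boundary_factor \<Lambda> \<xi> * dominant \<Lambda> p l \<omega>) \<partial>reference \<Lambda>)"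
    using le by (intro nn_integral_mono) (simp add: ennreal_mult[symmetric] ennreal_leI)
  also have "\<dots> = ennreal (\<integral>\<omega>. boundary_factor \<Lambda> \<xi> * dominant \<Lambda> p l \<omega> \<partial>reference \<Lambda>)"
    using dom0 by (intro nn_integral_eq_integral int) auto
  also have "\<dots> < \<infinity>" by simp
  finally show ?thesis
    using z_pos[OF assms(1), of \<xi>]
    by (subst nn_integral_kernel) (auto simp: Z_eq_z[OF assms(1)] divide_ennreal_def inverse_ennreal ennreal_mult_less_top)
qed

text \<open>Interchanging the sums and moving the weight from \<open>x\<close> to \<open>y\<close>
  costs the factor \<open>E\<close>, and column sums are at most 1: the neighbour matrix has norm at
  most \<open>E\<close> on the weighted l1 space.\<close>

lemma weighted_pair_sum_le:
  assumes "finite A" "finite B" "\<And>y. y \<in> B \<Longrightarrow> 0 \<le> g y"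
  shows "(\<Sum>x\<in>A. w x * (\<Sum>y\<in>nbrs x \<inter> B. g y / (deg x * deg y))) \<le> E * (\<Sum>y\<in>B. w y * g y)"
proof -
  have restrict: "(\<Sum>y\<in>nbrs x \<inter> C. h y) = (\<Sum>y\<in>C. if adj x y then h y else 0)"
    if "finite C" for C x and h :: "'v \<Rightarrow> real"
    using sum.inter_restrict[OF that, of h "nbrs x"] by (simp add: Int_commute)
  have "(\<Sum>x\<in>A. w x * (\<Sum>y\<in>nbrs x \<inter> B. g y / (deg x * deg y)))
    = (\<Sum>x\<in>A. \<Sum>y\<in>B. if adj x y then w x * (g y / (deg x * deg y)) else 0)"
    unfolding restrict[OF assms(2)] sum_distrib_left by (intro sum.cong refl) simp
  also have "\<dots> \<le> (\<Sum>x\<in>A. \<Sum>y\<in>B. if adj x y then E * w y * g y * (1 / (deg x * deg y)) else 0)"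
  proof (intro sum_mono)
    fix x y assume "y \<in> B"
    show "(if adj x y then w x * (g y / (deg x * deg y)) else 0)
      \<le> (if adj x y then E * w y * g y * (1 / (deg x * deg y)) else 0)"
      using w_adj[of x y] mult_right_mono[of "w x" "E * w y" "g y / (deg x * deg y)"] assms(3)[OF \<open>y \<in> B\<close>]
      by (auto simp: mult_ac)
  qed
  also have "\<dots> = (\<Sum>y\<in>B. \<Sum>x\<in>A. if adj x y then E * w y * g y * (1 / (deg x * deg y)) else 0)"
    by (rule sum.swap)
  also have "\<dots> = (\<Sum>y\<in>B. E * w y * g y * (\<Sum>x\<in>nbrs y \<inter> A. 1 / (deg y * deg x)))"
    unfolding restrict[OF assms(1)] sum_distrib_left
    by (intro sum.cong refl) (auto simp: mult_ac dest: sym)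
  also have "\<dots> \<le> (\<Sum>y\<in>B. E * w y * g y * 1)"
    using assms(3) E_ge_1 w_pos
    by (intro sum_mono mult_left_mono sum_inverse_deg_le_1 mult_nonneg_nonneg) (auto simp: less_imp_le)
  finally show ?thesis by (simp add: sum_distrib_left mult_ac)
qed

text \<open>The spin at \<open>x\<close> is resampled given the others. Neighbours outside \<Lambda>
  are frozen at \<xi>; those inside enter with Hoelder exponents
  \<open>\<kappa> / (l * deg x * deg y)\<close>, whose sum is at most 1 because
  \<open>\<kappa> \<le> l\<close>.\<close>

lemma kernel_log_moment_recursion:
  assumes "finite \<Lambda>" "0 < l" "0 < \<kappa>" "\<kappa> \<le> l" "x \<in> \<Lambda>"
    and C: "\<And>\<xi>. (\<integral>\<^sup>+\<eta>. ennreal (exp (l * \<bar>\<eta> x\<bar> powr p)) \<partial>kernel {x} \<xi>)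
      \<le> ennreal (exp (C * (1 + m_theta adj \<theta> x) + \<kappa> * (\<Sum>y\<in>nbrs x. \<bar>\<xi> y\<bar> powr p / (deg x * deg y))))"
    and n: "\<And>y. y \<in> \<Lambda> \<Longrightarrow> (\<integral>\<^sup>+\<eta>. ennreal (exp (l * \<bar>\<eta> y\<bar> powr p)) \<partial>kernel \<Lambda> \<xi>) = ennreal (exp (n y))"
  shows "n x \<le> C * (1 + m_theta adj \<theta> x) + \<kappa> / l * (\<Sum>y\<in>nbrs x \<inter> \<Lambda>. n y / (deg x * deg y))
    + \<kappa> * (\<Sum>y\<in>nbrs x \<inter> boundary \<Lambda>. \<bar>\<xi> y\<bar> powr p / (deg x * deg y))"
proof -
  interpret K: prob_space "kernel \<Lambda> \<xi>" using assms(1) by (rule prob_space_kernel)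
  define R where "R = C * (1 + m_theta adj \<theta> x) + \<kappa> * (\<Sum>y\<in>nbrs x \<inter> boundary \<Lambda>. \<bar>\<xi> y\<bar> powr p / (deg x * deg y))"
  define t where "t y = \<kappa> / l * (1 / (deg x * deg y))" for y
  have t0: "0 \<le> t y" for y unfolding t_def using assms by simp
  have t1: "sum t (nbrs x \<inter> \<Lambda>) \<le> 1"
  proof -
    have "sum t (nbrs x \<inter> \<Lambda>) = \<kappa> / l * (\<Sum>y\<in>nbrs x \<inter> \<Lambda>. 1 / (deg x * deg y))"
      unfolding t_def sum_distrib_left ..
    also have "\<dots> \<le> 1 * 1"
      using assms by (intro mult_mono sum_inverse_deg_le_1) (auto intro!: sum_nonneg)
    finally show ?thesis by simp
  qed
  have split: "\<kappa> * (\<Sum>y\<in>nbrs x. \<bar>\<eta> y\<bar> powr p / (deg x * deg y)) =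
      \<kappa> * (\<Sum>y\<in>nbrs x \<inter> boundary \<Lambda>. \<bar>\<xi> y\<bar> powr p / (deg x * deg y)) + (\<Sum>y\<in>nbrs x \<inter> \<Lambda>. t y * (l * \<bar>\<eta> y\<bar> powr p))"
    if "\<forall>y. y \<notin> \<Lambda> \<longrightarrow> \<eta> y = \<xi> y" for \<eta>
  proof -
    have "nbrs x = (nbrs x \<inter> boundary \<Lambda>) \<union> (nbrs x \<inter> \<Lambda>)" "(nbrs x \<inter> boundary \<Lambda>) \<inter> (nbrs x \<inter> \<Lambda>) = {}"
      using assms(5) by (auto simp: boundary_def)
    then have "(\<Sum>y\<in>nbrs x. \<bar>\<eta> y\<bar> powr p / (deg x * deg y)) =
      (\<Sum>y\<in>nbrs x \<inter> boundary \<Lambda>. \<bar>\<eta> y\<bar> powr p / (deg x * deg y)) + (\<Sum>y\<in>nbrs x \<inter> \<Lambda>. \<bar>\<eta> y\<bar> powr p / (deg x * deg y))"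
      using loc_fin[of x] by (metis (no_types, lifting) finite_Un sum.union_disjoint)
    also have "(\<Sum>y\<in>nbrs x \<inter> boundary \<Lambda>. \<bar>\<eta> y\<bar> powr p / (deg x * deg y)) =
      (\<Sum>y\<in>nbrs x \<inter> boundary \<Lambda>. \<bar>\<xi> y\<bar> powr p / (deg x * deg y))"
      using that by (intro sum.cong) (auto simp: boundary_def)
    finally show ?thesis
      using assms(2) by (simp add: t_def algebra_simps sum_distrib_left)
  qed
  have "ennreal (exp (n x)) = (\<integral>\<^sup>+\<eta>. ennreal (exp (l * \<bar>\<eta> x\<bar> powr p)) \<partial>kernel \<Lambda> \<xi>)"
    by (rule n[OF assms(5), symmetric])
  also have "\<dots> = (\<integral>\<^sup>+\<eta>. (\<integral>\<^sup>+\<zeta>. ennreal (exp (l * \<bar>\<zeta> x\<bar> powr p)) \<partial>kernel {x} \<eta>) \<partial>kernel \<Lambda> \<xi>)"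
    using assms by (intro kernel_consistent[symmetric]) auto
  also have "\<dots> \<le> (\<integral>\<^sup>+\<eta>. ennreal (exp R) * ennreal (exp (\<Sum>y\<in>nbrs x \<inter> \<Lambda>. t y * (l * \<bar>\<eta> y\<bar> powr p))) \<partial>kernel \<Lambda> \<xi>)"
  proof (rule nn_integral_mono_AE, rule AE_mp[OF AE_kernel_outside], rule AE_I2, rule impI)
    fix \<eta> assume \<eta>: "\<forall>y. y \<notin> \<Lambda> \<longrightarrow> \<eta> y = \<xi> y"
    show "(\<integral>\<^sup>+\<zeta>. ennreal (exp (l * \<bar>\<zeta> x\<bar> powr p)) \<partial>kernel {x} \<eta>)
      \<le> ennreal (exp R) * ennreal (exp (\<Sum>y\<in>nbrs x \<inter> \<Lambda>. t y * (l * \<bar>\<eta> y\<bar> powr p)))"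
      by (rule order_trans[OF C]) (simp add: R_def split[OF \<eta>] exp_add[symmetric] ennreal_mult[symmetric] add.assoc)
  qed
  also have "\<dots> = ennreal (exp R) * (\<integral>\<^sup>+\<eta>. ennreal (exp (\<Sum>y\<in>nbrs x \<inter> \<Lambda>. t y * (l * \<bar>\<eta> y\<bar> powr p))) \<partial>kernel \<Lambda> \<xi>)"
    by (rule nn_integral_cmult) measurable
  also have "\<dots> \<le> ennreal (exp R) * ennreal (exp (\<Sum>y\<in>nbrs x \<inter> \<Lambda>. t y * n y))"
    using assms(1) t0 t1 n by (intro mult_left_mono K.nn_integral_exp_weighted_sum_le) auto
  also have "\<dots> = ennreal (exp (R + (\<Sum>y\<in>nbrs x \<inter> \<Lambda>. t y * n y)))"
    by (simp add: exp_add ennreal_mult)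
  finally have "n x \<le> R + (\<Sum>y\<in>nbrs x \<inter> \<Lambda>. t y * n y)" by simp
  then show ?thesis unfolding R_def t_def by (simp add: sum_distrib_left algebra_simps)
qed

text \<open>The logarithmic moments \<open>n x\<close> of the finite-volume measure satisfy a linear system whose matrix
  has norm at most 1/2 in the weighted \<open>\<ell>\<^sup>1\<close> space once \<open>\<kappa> = l / (2 E)\<close>, so it can be absorbed.\<close>

lemma kernel_log_moments:
  assumes "0 < l"
  shows "\<exists>C>0. \<forall>\<Lambda> \<xi>. finite \<Lambda> \<longrightarrow> (\<exists>n. (\<forall>y\<in>\<Lambda>. 0 \<le> n y \<and>
      (\<integral>\<^sup>+\<eta>. ennreal (exp (l * \<bar>\<eta> y\<bar> powr p)) \<partial>kernel \<Lambda> \<xi>) = ennreal (exp (n y))) \<and>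
      (\<Sum>x\<in>\<Lambda>. w x * n x) \<le> C + l * (\<Sum>y\<in>boundary \<Lambda>. w y * \<bar>\<xi> y\<bar> powr p))"
proof -
  define \<kappa> where "\<kappa> = l / (2 * E)"
  have \<kappa>: "0 < \<kappa>" "\<kappa> \<le> l" "\<kappa> * E = l / 2"
    unfolding \<kappa>_def using assms E_ge_1 by (auto simp: field_simps)
  obtain C where C0: "C > 0" and C: "\<And>x \<xi>. (\<integral>\<^sup>+\<eta>. ennreal (exp (l * \<bar>\<eta> x\<bar> powr p)) \<partial>kernel {x} \<xi>)
    \<le> ennreal (exp (C * (1 + m_theta adj \<theta> x) + \<kappa> * (\<Sum>y\<in>nbrs x. \<bar>\<xi> y\<bar> powr p / (deg x * deg y))))"
    using kernel_singleton_moment[OF assms \<kappa>(1)] by auto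
  have "\<exists>n. (\<forall>y\<in>\<Lambda>. 0 \<le> n y \<and>
      (\<integral>\<^sup>+\<eta>. ennreal (exp (l * \<bar>\<eta> y\<bar> powr p)) \<partial>kernel \<Lambda> \<xi>) = ennreal (exp (n y))) \<and>
      (\<Sum>x\<in>\<Lambda>. w x * n x) \<le> 2 * C * M + l * (\<Sum>y\<in>boundary \<Lambda>. w y * \<bar>\<xi> y\<bar> powr p)"
    if fin: "finite \<Lambda>" for \<Lambda> \<xi>
  proof -
    interpret K: prob_space "kernel \<Lambda> \<xi>" using fin by (rule prob_space_kernel)
    define e where "e y = (\<integral>\<^sup>+\<eta>. ennreal (exp (l * \<bar>\<eta> y\<bar> powr p)) \<partial>kernel \<Lambda> \<xi>)" for y
    define n where "n y = ln (enn2real (e y))" for y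
    have e1: "1 \<le> e y" for y
    proof -
      have "(\<integral>\<^sup>+\<eta>. 1 \<partial>kernel \<Lambda> \<xi>) \<le> e y"
        unfolding e_def using assms by (intro nn_integral_mono) (simp add: ennreal_1[symmetric] del: ennreal_1)
      then show ?thesis using K.emeasure_space_1 by simp
    qed
    have n: "0 \<le> n y" "e y = ennreal (exp (n y))" if "y \<in> \<Lambda>" for y
    proof -
      \<comment> \<open>Finiteness is essential: it makes the logarithms genuine real numbers, so
        that half of their weighted sum can be subtracted from both sides below.\<close>
      have "e y < \<infinity>" unfolding e_def using fin that assms by (intro kernel_moment_finite) auto
      then obtain v where v: "e y = ennreal v" "0 \<le> v" by (cases "e y") auto
      then have "1 \<le> v" using e1[of y] by (simp add: ennreal_1[symmetric] del: ennreal_1)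
      then show "0 \<le> n y" "e y = ennreal (exp (n y))" unfolding n_def using v by auto
    qed
    have "(\<Sum>x\<in>\<Lambda>. w x * n x) \<le> (\<Sum>x\<in>\<Lambda>. w x * (C * (1 + m_theta adj \<theta> x)
        + \<kappa> / l * (\<Sum>y\<in>nbrs x \<inter> \<Lambda>. n y / (deg x * deg y))
        + \<kappa> * (\<Sum>y\<in>nbrs x \<inter> boundary \<Lambda>. \<bar>\<xi> y\<bar> powr p / (deg x * deg y))))"
      using n C unfolding e_def
      by (intro sum_mono mult_left_mono kernel_log_moment_recursion[OF fin assms \<kappa>(1,2)] less_imp_le[OF w_pos]) auto
    also have "\<dots> = C * (\<Sum>x\<in>\<Lambda>. (1 + m_theta adj \<theta> x) * w x)
        + \<kappa> / l * (\<Sum>x\<in>\<Lambda>. w x * (\<Sum>y\<in>nbrs x \<inter> \<Lambda>. n y / (deg x * deg y)))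
        + \<kappa> * (\<Sum>x\<in>\<Lambda>. w x * (\<Sum>y\<in>nbrs x \<inter> boundary \<Lambda>. \<bar>\<xi> y\<bar> powr p / (deg x * deg y)))"
    proof -
      have "u * (C * v + k * A + h * B) = C * (v * u) + k * (u * A) + h * (u * B)" for u v k h A B :: real
        by (simp add: algebra_simps)
      then show ?thesis
        unfolding sum_distrib_left[where r = C and A = \<Lambda>] sum_distrib_left[where r = "\<kappa> / l" and A = \<Lambda>]
          sum_distrib_left[where r = \<kappa> and A = \<Lambda>] sum.distrib[symmetric]
        by (intro sum.cong refl)
    qed
    also have "\<dots> \<le> C * M + \<kappa> / l * (E * (\<Sum>y\<in>\<Lambda>. w y * n y))
        + \<kappa> * (E * (\<Sum>y\<in>boundary \<Lambda>. w y * \<bar>\<xi> y\<bar> powr p))"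
      using C0 \<kappa> assms n fin finite_boundary[OF fin]
      by (intro add_mono mult_left_mono mass weighted_pair_sum_le) auto
    also have "\<dots> = C * M + (\<Sum>y\<in>\<Lambda>. w y * n y) / 2 + l * (\<Sum>y\<in>boundary \<Lambda>. w y * \<bar>\<xi> y\<bar> powr p) / 2"
    proof -
      have "\<kappa> / l * (E * X) = X / 2" "\<kappa> * (E * X) = l * X / 2" for X
        using assms E_ge_1 unfolding \<kappa>_def by (auto simp: field_simps)
      then show ?thesis by (simp only:)
    qed
    finally have "(\<Sum>x\<in>\<Lambda>. w x * n x) \<le> 2 * C * M + l * (\<Sum>y\<in>boundary \<Lambda>. w y * \<bar>\<xi> y\<bar> powr p)"
      by (simp add: field_simps)
    then show ?thesis using n unfolding e_def by blast
  qed
  then show ?thesis using C0 M_pos by (intro exI[of _ "2 * C * M"]) auto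
qed

text \<open>Hoelder's inequality with exponents \<open>w x / M\<close>, which sum to at most 1. To
  compensate, the site moments are taken with parameter \<open>l * M\<close> and the bound is
  divided by \<open>M\<close>.\<close>

lemma kernel_exp_bound:
  assumes "0 < l"
  shows "\<exists>C>0. \<forall>\<Lambda> \<xi>. finite \<Lambda> \<longrightarrow> (\<integral>\<^sup>+\<eta>. ennreal (exp (l * (\<Sum>x\<in>\<Lambda>. \<bar>\<eta> x\<bar> powr p * w x))) \<partial>kernel \<Lambda> \<xi>)
      \<le> ennreal (exp (C + l * (\<Sum>y\<in>boundary \<Lambda>. \<bar>\<xi> y\<bar> powr p * w y)))"
proof -
  have lM: "0 < l * M" using assms M_pos by simp
  obtain C where C0: "C > 0" and C: "\<And>\<Lambda> \<xi>. finite \<Lambda> \<Longrightarrow> (\<exists>n. (\<forall>y\<in>\<Lambda>. 0 \<le> n y \<and>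
      (\<integral>\<^sup>+\<eta>. ennreal (exp (l * M * \<bar>\<eta> y\<bar> powr p)) \<partial>kernel \<Lambda> \<xi>) = ennreal (exp (n y))) \<and>
      (\<Sum>x\<in>\<Lambda>. w x * n x) \<le> C + l * M * (\<Sum>y\<in>boundary \<Lambda>. w y * \<bar>\<xi> y\<bar> powr p))"
    using kernel_log_moments[OF lM] by blast
  have "(\<integral>\<^sup>+\<eta>. ennreal (exp (l * (\<Sum>x\<in>\<Lambda>. \<bar>\<eta> x\<bar> powr p * w x))) \<partial>kernel \<Lambda> \<xi>)
      \<le> ennreal (exp (C / M + l * (\<Sum>y\<in>boundary \<Lambda>. \<bar>\<xi> y\<bar> powr p * w y)))" if fin: "finite \<Lambda>" for \<Lambda> \<xi>
  proof -
    interpret K: prob_space "kernel \<Lambda> \<xi>" using fin by (rule prob_space_kernel)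
    obtain n where n: "\<And>y. y \<in> \<Lambda> \<Longrightarrow> (\<integral>\<^sup>+\<eta>. ennreal (exp (l * M * \<bar>\<eta> y\<bar> powr p)) \<partial>kernel \<Lambda> \<xi>) = ennreal (exp (n y))"
      and sum_n: "(\<Sum>x\<in>\<Lambda>. w x * n x) \<le> C + l * M * (\<Sum>y\<in>boundary \<Lambda>. w y * \<bar>\<xi> y\<bar> powr p)"
      using C[OF fin, of \<xi>] by blast
    have "l * (\<Sum>x\<in>\<Lambda>. \<bar>\<eta> x\<bar> powr p * w x) = (\<Sum>x\<in>\<Lambda>. w x / M * (l * M * \<bar>\<eta> x\<bar> powr p))" for \<eta>
      using M_pos by (simp add: sum_distrib_left mult_ac)
    then have "(\<integral>\<^sup>+\<eta>. ennreal (exp (l * (\<Sum>x\<in>\<Lambda>. \<bar>\<eta> x\<bar> powr p * w x))) \<partial>kernel \<Lambda> \<xi>) =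
      (\<integral>\<^sup>+\<eta>. ennreal (exp (\<Sum>x\<in>\<Lambda>. w x / M * (l * M * \<bar>\<eta> x\<bar> powr p))) \<partial>kernel \<Lambda> \<xi>)" by simp
    also have "\<dots> \<le> ennreal (exp (\<Sum>x\<in>\<Lambda>. w x / M * n x))"
    proof (rule K.nn_integral_exp_weighted_sum_le[OF fin])
      show "(\<Sum>x\<in>\<Lambda>. w x / M) \<le> 1"
        using sum_w_le[OF fin] M_pos by (simp add: sum_divide_distrib[symmetric])
    qed (use n w_pos M_pos in \<open>auto simp: less_imp_le\<close>)
    also have "(\<Sum>x\<in>\<Lambda>. w x / M * n x) = (\<Sum>x\<in>\<Lambda>. w x * n x) / M"
      by (simp add: sum_divide_distrib)
    also have "ennreal (exp \<dots>) \<le> ennreal (exp ((C + l * M * (\<Sum>y\<in>boundary \<Lambda>. w y * \<bar>\<xi> y\<bar> powr p)) / M))"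
      using sum_n M_pos by (simp add: divide_right_mono)
    also have "(C + l * M * (\<Sum>y\<in>boundary \<Lambda>. w y * \<bar>\<xi> y\<bar> powr p)) / M = C / M + l * (\<Sum>y\<in>boundary \<Lambda>. \<bar>\<xi> y\<bar> powr p * w y)"
      using M_pos by (simp add: add_divide_distrib mult_ac)
    finally show ?thesis .
  qed
  then show ?thesis using C0 M_pos by (intro exI[of _ "C / M"]) auto
qed

end

section \<open>Tempered Gibbs measures\<close>

lemma nn_integral_le_of_truncations:
  fixes f :: "'a \<Rightarrow> real"
  assumes [measurable]: "f \<in> borel_measurable M"
    and le: "\<And>k::nat. (\<integral>\<^sup>+x. ennreal (min (real k) (f x)) \<partial>M) \<le> c"
  shows "(\<integral>\<^sup>+x. ennreal (f x) \<partial>M) \<le> c"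
proof -
  have sup: "ennreal (f x) = (SUP k. ennreal (min (real k) (f x)))" for x
  proof (rule antisym)
    obtain k :: nat where "f x \<le> real k" using real_arch_simple by blast
    then have "ennreal (f x) = ennreal (min (real k) (f x))" by simp
    then show "ennreal (f x) \<le> (SUP k. ennreal (min (real k) (f x)))"
      by (metis SUP_upper UNIV_I)
    show "(SUP k. ennreal (min (real k) (f x))) \<le> ennreal (f x)"
      by (intro SUP_least ennreal_leI) simp
  qed
  have "(\<integral>\<^sup>+x. ennreal (f x) \<partial>M) = (SUP k. \<integral>\<^sup>+x. ennreal (min (real k) (f x)) \<partial>M)"
    unfolding sup
    by (rule nn_integral_monotone_convergence_SUP) (auto intro!: incseq_SucI le_funI ennreal_leI)
  also have "\<dots> \<le> c" by (intro SUP_least le)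
  finally show ?thesis .
qed

text \<open>The element \<open>undefined\<close> only makes \<open>volume 0\<close> nonempty, as the Gibbs condition demands.\<close>

definition volume :: "nat \<Rightarrow> 'v::countable set" where
  "volume n = insert undefined {x. to_nat x < n}"

lemma finite_volume: "finite (volume n)"
proof -
  have "{x :: 'a. to_nat x < n} = to_nat -` {..<n}" by auto
  then show ?thesis unfolding volume_def by (simp add: finite_vimageI)
qed

lemma volume_nonempty: "volume n \<noteq> {}"
  by (simp add: volume_def)

lemma volume_mono: "m \<le> n \<Longrightarrow> volume m \<subseteq> volume n"
  by (auto simp: volume_def)

lemma eventually_subset_volume:
  assumes "finite F"
  shows "\<forall>\<^sub>F n in sequentially. F \<subseteq> volume n"
proof -
  have "F \<subseteq> volume n" if "n \<ge> Suc (Max (to_nat ` F))" for n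
  proof
    fix x assume "x \<in> F"
    then have "to_nat x \<le> Max (to_nat ` F)" using assms by (intro Max_ge) auto
    then show "x \<in> volume n" using that by (simp add: volume_def)
  qed
  then show ?thesis by (rule eventually_sequentiallyI)
qed

lemma filterlim_volume: "filterlim volume (finite_subsets_at_top UNIV) sequentially"
  unfolding filterlim_iff eventually_finite_subsets_at_top
proof (intro allI impI, elim exE conjE)
  fix P and X :: "'a set"
  assume X: "finite X" "\<forall>Y. finite Y \<and> X \<subseteq> Y \<and> Y \<subseteq> UNIV \<longrightarrow> P Y"
  show "\<forall>\<^sub>F n in sequentially. P (volume n)"
    using eventually_subset_volume[OF X(1)] X(2) by (auto elim!: eventually_mono simp: finite_volume)
qed

lemma summable_on_small_outside:
  fixes f :: "'a \<Rightarrow> real"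
  assumes "f summable_on UNIV" "\<And>x. 0 \<le> f x" "0 < e"
  obtains F where "finite F" "\<And>G. finite G \<Longrightarrow> G \<inter> F = {} \<Longrightarrow> sum f G < e"
proof -
  have "(sum f \<longlongrightarrow> infsum f UNIV) (finite_subsets_at_top UNIV)"
    using has_sum_infsum[OF assms(1)] by (simp add: has_sum_def)
  then have "\<forall>\<^sub>F F in finite_subsets_at_top UNIV. infsum f UNIV - e < sum f F"
    using assms(3) by (intro order_tendstoD) auto
  then obtain F where F: "finite F" "infsum f UNIV - e < sum f F"
    unfolding eventually_finite_subsets_at_top by auto
  have "sum f G < e" if "finite G" "G \<inter> F = {}" for G
  proof -
    have "sum f F + sum f G = sum f (F \<union> G)" using that F by (subst sum.union_disjoint) auto
    also have "\<dots> \<le> infsum f UNIV" using that F assms by (intro finite_sum_le_infsum) auto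
    finally show ?thesis using F(2) by linarith
  qed
  then show thesis using that F(1) by blast
qed

context tempered_spin_system begin

section \<open>Tempered configurations and uniform moment bounds\<close>

definition wsum :: "'v set \<Rightarrow> ('v \<Rightarrow> real) \<Rightarrow> real" where
  "wsum F \<eta> = (\<Sum>x\<in>F. \<bar>\<eta> x\<bar> powr p * w x)"

definition tempered :: "('v \<Rightarrow> real) set" where
  "tempered = {\<eta>. (\<lambda>x. \<bar>\<eta> x\<bar> powr p * w x) summable_on UNIV}"

lemma term_nonneg: "0 \<le> \<bar>\<eta> x\<bar> powr p * w x"
  using w_pos[of x] by simp

lemma wsum_nonneg: "0 \<le> wsum F \<eta>"
  unfolding wsum_def by (intro sum_nonneg term_nonneg)

lemma wsum_mono: "finite G \<Longrightarrow> F \<subseteq> G \<Longrightarrow> wsum F \<eta> \<le> wsum G \<eta>"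
  unfolding wsum_def by (intro sum_mono2 term_nonneg)

lemma continuous_on_wsum: "continuous_on UNIV (wsum F)"
  unfolding wsum_def[abs_def]
  by (intro continuous_on_sum continuous_on_mult continuous_on_const continuous_on_abs_powr p_pos
      continuous_on_product_coordinates)

lemma wsum_measurable[measurable]: "wsum F \<in> borel_measurable borel"
  by (intro borel_measurable_continuous_onI continuous_on_wsum)

text \<open>Chosen once per \<open>l\<close>, so that all volumes, boundary conditions, tempered
  Gibbs measures and weak limits share the same constant.\<close>

definition log_bound :: "real \<Rightarrow> real" where
  "log_bound l = (SOME C. \<forall>\<Lambda> \<xi>. finite \<Lambda> \<longrightarrow>
     (\<integral>\<^sup>+\<eta>. ennreal (exp (l * wsum \<Lambda> \<eta>)) \<partial>kernel \<Lambda> \<xi>) \<le> ennreal (exp (C + l * wsum (boundary \<Lambda>) \<xi>)))"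

lemma kernel_wsum_bound:
  assumes "0 < l" "finite \<Lambda>"
  shows "(\<integral>\<^sup>+\<eta>. ennreal (exp (l * wsum \<Lambda> \<eta>)) \<partial>kernel \<Lambda> \<xi>)
    \<le> ennreal (exp (log_bound l + l * wsum (boundary \<Lambda>) \<xi>))"
proof -
  have "\<exists>C. \<forall>\<Lambda> \<xi>. finite \<Lambda> \<longrightarrow>
     (\<integral>\<^sup>+\<eta>. ennreal (exp (l * wsum \<Lambda> \<eta>)) \<partial>kernel \<Lambda> \<xi>) \<le> ennreal (exp (C + l * wsum (boundary \<Lambda>) \<xi>))"
    using kernel_exp_bound[OF assms(1)] unfolding wsum_def by blast
  from someI_ex[OF this] show ?thesis using assms(2) unfolding log_bound_def by blast
qed

text \<open>Only finitely many spins occur in each bound, so the bounds survive weak limits; their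
  uniformity in \<open>F\<close> recovers the full norm.\<close>

definition moment_bounded :: "('v \<Rightarrow> real) measure \<Rightarrow> bool" where
  "moment_bounded \<mu> \<longleftrightarrow> (\<forall>l>0. \<forall>F. finite F \<longrightarrow>
     (\<integral>\<^sup>+\<eta>. ennreal (exp (l * wsum F \<eta>)) \<partial>\<mu>) \<le> ennreal (exp (log_bound l)))"

text \<open>The volumes exhaust the vertices, so they control all finite partial sums. Countable
  quantifiers, including a natural bound, make Borel measurability immediate.\<close>

lemma tempered_iff: "\<eta> \<in> tempered \<longleftrightarrow> (\<exists>B::nat. \<forall>n. wsum (volume n) \<eta> \<le> real B)"
proof
  assume "\<eta> \<in> tempered"
  then have s: "(\<lambda>x. \<bar>\<eta> x\<bar> powr p * w x) summable_on UNIV" by (simp add: tempered_def)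
  obtain B :: nat where B: "infsum (\<lambda>x. \<bar>\<eta> x\<bar> powr p * w x) UNIV \<le> real B" using real_arch_simple by blast
  have "wsum (volume n) \<eta> \<le> real B" for n
    unfolding wsum_def using s by (intro order_trans[OF finite_sum_le_infsum B] finite_volume term_nonneg) auto
  then show "\<exists>B::nat. \<forall>n. wsum (volume n) \<eta> \<le> real B" by blast
next
  assume "\<exists>B::nat. \<forall>n. wsum (volume n) \<eta> \<le> real B"
  then obtain B :: nat where B: "\<And>n. wsum (volume n) \<eta> \<le> real B" by blast
  have "sum (\<lambda>x. \<bar>\<eta> x\<bar> powr p * w x) X \<le> real B" if X: "finite X" for X
  proof -
    obtain n where "X \<subseteq> volume n"
      using eventually_subset_volume[OF X] by (auto simp: eventually_sequentially)
    then show ?thesis using wsum_mono[OF finite_volume, of X n \<eta>] B[of n] unfolding wsum_def by linarith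
  qed
  then have "(\<lambda>x. \<bar>\<eta> x\<bar> powr p * w x) summable_on UNIV"
    by (intro nonneg_bounded_partial_sums_imp_summable_on[where C = "real B"] term_nonneg)
       (auto simp: eventually_finite_subsets_at_top)
  then show "\<eta> \<in> tempered" by (simp add: tempered_def)
qed

lemma tempered_measurable[measurable]: "tempered \<in> sets borel"
proof -
  have "Measurable.pred borel (\<lambda>\<eta> :: 'v \<Rightarrow> real. \<exists>B::nat. \<forall>n. wsum (volume n) \<eta> \<le> real B)" by measurable
  then show ?thesis unfolding pred_def tempered_iff[symmetric] by simp
qed

text \<open>The boundary of a volume lies in its complement and thus sees only a tail of the
  convergent sum.\<close>

lemma wsum_boundary_tendsto:
  assumes "\<xi> \<in> tempered"
  shows "(\<lambda>n. wsum (boundary (volume n)) \<xi>) \<longlonglongrightarrow> 0"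
proof (rule LIMSEQ_I)
  fix e :: real assume "0 < e"
  obtain F where F: "finite F" "\<And>G. finite G \<Longrightarrow> G \<inter> F = {} \<Longrightarrow> (\<Sum>x\<in>G. \<bar>\<xi> x\<bar> powr p * w x) < e"
    using summable_on_small_outside[of "\<lambda>x. \<bar>\<xi> x\<bar> powr p * w x" e] assms term_nonneg \<open>0 < e\<close>
    by (auto simp: tempered_def)
  obtain N where N: "\<And>n. n \<ge> N \<Longrightarrow> F \<subseteq> volume n"
    using eventually_subset_volume[OF F(1)] by (auto simp: eventually_sequentially)
  have "norm (wsum (boundary (volume n)) \<xi> - 0) < e" if "n \<ge> N" for n
  proof -
    have "boundary (volume n) \<inter> F = {}" using N[OF that] by (auto simp: boundary_def)
    then have "wsum (boundary (volume n)) \<xi> < e"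
      unfolding wsum_def by (intro F(2) finite_boundary finite_volume)
    then show ?thesis using wsum_nonneg[of "boundary (volume n)" \<xi>] by simp
  qed
  then show "\<exists>N. \<forall>n\<ge>N. norm (wsum (boundary (volume n)) \<xi> - 0) < e" by blast
qed

text \<open>The a priori integrability of the moments is unknown, so the moments are truncated at \<open>k\<close> before
  the finite-volume bound is averaged over the boundary condition.\<close>

lemma gibbs_moment_bounded:
  assumes \<mu>: "\<mu> \<in> gibbs_measures adj W V" and "measure \<mu> tempered = 1"
  shows "moment_bounded \<mu>"
  unfolding moment_bounded_def
proof (intro allI impI)
  fix l :: real and F :: "'v set" assume l: "0 < l" and F: "finite F"
  have "prob_space \<mu>" and s[measurable_cong]: "sets \<mu> = sets borel" using \<mu> gibbs_iff by auto
  interpret prob_space \<mu> by fact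
  have AE_t: "AE \<xi> in \<mu>. \<xi> \<in> tempered" using assms(2) by (rule AE_prob_1)
  show "(\<integral>\<^sup>+\<eta>. ennreal (exp (l * wsum F \<eta>)) \<partial>\<mu>) \<le> ennreal (exp (log_bound l))"
  proof (rule nn_integral_le_of_truncations)
    show "(\<lambda>\<eta>. exp (l * wsum F \<eta>)) \<in> borel_measurable \<mu>" by measurable
    fix k :: nat
    \<comment> \<open>Combines two bounds on the truncated moment under the kernel: the level
      \<open>k\<close> provides domination, and the finite-volume bound converges for tempered
      \<xi>.\<close>
    define h where "h n \<xi> = ennreal (min (real k) (exp (log_bound l + l * wsum (boundary (volume n)) \<xi>)))" for n \<xi>
    have "(\<lambda>n. \<integral>\<^sup>+\<xi>. h n \<xi> \<partial>\<mu>) \<longlonglongrightarrow> (\<integral>\<^sup>+\<xi>. ennreal (min (real k) (exp (log_bound l + l * 0))) \<partial>\<mu>)"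
    proof (rule nn_integral_dominated_convergence[where w = "\<lambda>_. ennreal (real k)"])
      show "AE \<xi> in \<mu>. (\<lambda>n. h n \<xi>) \<longlonglongrightarrow> ennreal (min (real k) (exp (log_bound l + l * 0)))"
        using AE_t
      proof (rule AE_mp, intro AE_I2 impI)
        fix \<xi> assume "\<xi> \<in> tempered"
        then show "(\<lambda>n. h n \<xi>) \<longlonglongrightarrow> ennreal (min (real k) (exp (log_bound l + l * 0)))"
          unfolding h_def by (intro tendsto_ennrealI tendsto_intros wsum_boundary_tendsto)
      qed
    qed (auto simp: h_def emeasure_space_1 intro!: ennreal_leI)
    moreover have "\<forall>\<^sub>F n in sequentially. (\<integral>\<^sup>+\<eta>. ennreal (min (real k) (exp (l * wsum F \<eta>))) \<partial>\<mu>) \<le> (\<integral>\<^sup>+\<xi>. h n \<xi> \<partial>\<mu>)"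
      using eventually_subset_volume[OF F]
    proof (rule eventually_mono)
      fix n :: nat assume Fn: "F \<subseteq> volume n"
      have "(\<integral>\<^sup>+\<eta>. ennreal (min (real k) (exp (l * wsum F \<eta>))) \<partial>kernel (volume n) \<xi>) \<le> h n \<xi>" for \<xi>
      proof -
        interpret K: prob_space "kernel (volume n) \<xi>" by (rule prob_space_kernel[OF finite_volume])
        have "(\<integral>\<^sup>+\<eta>. ennreal (min (real k) (exp (l * wsum F \<eta>))) \<partial>kernel (volume n) \<xi>)
          \<le> (\<integral>\<^sup>+\<eta>. ennreal (real k) \<partial>kernel (volume n) \<xi>)"
          by (intro nn_integral_mono ennreal_leI) simp
        also have "\<dots> = ennreal (real k)" using K.emeasure_space_1 by simp
        finally have 1: "(\<integral>\<^sup>+\<eta>. ennreal (min (real k) (exp (l * wsum F \<eta>))) \<partial>kernel (volume n) \<xi>) \<le> ennreal (real k)" .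
        have "(\<integral>\<^sup>+\<eta>. ennreal (min (real k) (exp (l * wsum F \<eta>))) \<partial>kernel (volume n) \<xi>)
          \<le> (\<integral>\<^sup>+\<eta>. ennreal (exp (l * wsum (volume n) \<eta>)) \<partial>kernel (volume n) \<xi>)"
          using wsum_mono[OF finite_volume Fn] l
          by (intro nn_integral_mono ennreal_leI min.coboundedI2) simp
        also have "\<dots> \<le> ennreal (exp (log_bound l + l * wsum (boundary (volume n)) \<xi>))"
          by (rule kernel_wsum_bound[OF l finite_volume])
        finally show ?thesis using 1 unfolding h_def by (simp add: min_def)
      qed
      then have "(\<integral>\<^sup>+\<xi>. (\<integral>\<^sup>+\<eta>. ennreal (min (real k) (exp (l * wsum F \<eta>))) \<partial>kernel (volume n) \<xi>) \<partial>\<mu>) \<le> (\<integral>\<^sup>+\<xi>. h n \<xi> \<partial>\<mu>)"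
        by (intro nn_integral_mono)
      then show "(\<integral>\<^sup>+\<eta>. ennreal (min (real k) (exp (l * wsum F \<eta>))) \<partial>\<mu>) \<le> (\<integral>\<^sup>+\<xi>. h n \<xi> \<partial>\<mu>)"
        by (subst (asm) nn_integral_gibbs[OF \<mu> finite_volume volume_nonempty]) simp_all
    qed
    ultimately have "(\<integral>\<^sup>+\<eta>. ennreal (min (real k) (exp (l * wsum F \<eta>))) \<partial>\<mu>)
      \<le> (\<integral>\<^sup>+\<xi>. ennreal (min (real k) (exp (log_bound l + l * 0))) \<partial>\<mu>)"
      by (rule tendsto_lowerbound) simp
    also have "\<dots> \<le> ennreal (exp (log_bound l))"
      using emeasure_space_1 by (simp add: ennreal_leI)
    finally show "(\<integral>\<^sup>+\<eta>. ennreal (min (real k) (exp (l * wsum F \<eta>))) \<partial>\<mu>) \<le> ennreal (exp (log_bound l))" .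
  qed
qed

text \<open>The supremum is meaningful everywhere, being infinite off \<open>tempered\<close>, where
  the infinite sum takes the default value 0.\<close>

lemma exp_infsum_eq_SUP:
  assumes "\<eta> \<in> tempered" "0 < l"
  shows "ennreal (exp (l * (\<Sum>\<^sub>\<infinity>x. \<bar>\<eta> x\<bar> powr p * w x))) = (SUP n. ennreal (exp (l * wsum (volume n) \<eta>)))"
proof (rule LIMSEQ_unique)
  have "(sum (\<lambda>x. \<bar>\<eta> x\<bar> powr p * w x) \<longlongrightarrow> (\<Sum>\<^sub>\<infinity>x. \<bar>\<eta> x\<bar> powr p * w x)) (finite_subsets_at_top UNIV)"
    using has_sum_infsum[of "\<lambda>x. \<bar>\<eta> x\<bar> powr p * w x" UNIV] assms(1) by (simp add: has_sum_def tempered_def)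
  then have "(\<lambda>n. wsum (volume n) \<eta>) \<longlonglongrightarrow> (\<Sum>\<^sub>\<infinity>x. \<bar>\<eta> x\<bar> powr p * w x)"
    unfolding wsum_def by (rule filterlim_compose[OF _ filterlim_volume])
  then show "(\<lambda>n. ennreal (exp (l * wsum (volume n) \<eta>))) \<longlonglongrightarrow> ennreal (exp (l * (\<Sum>\<^sub>\<infinity>x. \<bar>\<eta> x\<bar> powr p * w x)))"
    by (intro tendsto_ennrealI tendsto_intros)
  show "(\<lambda>n. ennreal (exp (l * wsum (volume n) \<eta>))) \<longlonglongrightarrow> (SUP n. ennreal (exp (l * wsum (volume n) \<eta>)))"
    using assms(2)
    by (intro LIMSEQ_SUP incseq_SucI ennreal_leI) (simp add: wsum_mono finite_volume volume_mono)
qed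

lemma moment_bounded_SUP:
  assumes "moment_bounded \<mu>" and [measurable_cong]: "sets \<mu> = sets borel" and "0 < l"
  shows "(\<integral>\<^sup>+\<eta>. (SUP n. ennreal (exp (l * wsum (volume n) \<eta>))) \<partial>\<mu>) \<le> ennreal (exp (log_bound l))"
proof -
  have "(\<integral>\<^sup>+\<eta>. (SUP n. ennreal (exp (l * wsum (volume n) \<eta>))) \<partial>\<mu>) = (SUP n. \<integral>\<^sup>+\<eta>. ennreal (exp (l * wsum (volume n) \<eta>)) \<partial>\<mu>)"
    using assms(3)
    by (intro nn_integral_monotone_convergence_SUP incseq_SucI le_funI ennreal_leI)
       (simp_all add: wsum_mono finite_volume volume_mono)
  also have "\<dots> \<le> ennreal (exp (log_bound l))"
    using assms(1,3) unfolding moment_bounded_def by (intro SUP_least) (simp add: finite_volume)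
  finally show ?thesis .
qed

text \<open>A finite integral makes the supremum finite almost everywhere, and the exponential
  bounds \<open>wsum\<close> itself.\<close>

lemma moment_bounded_AE_tempered:
  assumes "moment_bounded \<mu>" and s[measurable_cong]: "sets \<mu> = sets borel"
  shows "AE \<eta> in \<mu>. \<eta> \<in> tempered"
proof -
  have "(\<integral>\<^sup>+\<eta>. (SUP n. ennreal (exp (1 * wsum (volume n) \<eta>))) \<partial>\<mu>) < \<infinity>"
    using moment_bounded_SUP[OF assms, of 1] by (auto intro: le_less_trans)
  then have "AE \<eta> in \<mu>. (SUP n. ennreal (exp (1 * wsum (volume n) \<eta>))) \<noteq> \<infinity>"
    by (intro nn_integral_noteq_infinite) auto
  then show ?thesis
  proof (rule AE_mp, intro AE_I2 impI)
    fix \<eta> assume fin: "(SUP n. ennreal (exp (1 * wsum (volume n) \<eta>))) \<noteq> \<infinity>"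
    then obtain v where v: "(SUP n. ennreal (exp (1 * wsum (volume n) \<eta>))) = ennreal v" "0 \<le> v"
      by (cases "SUP n. ennreal (exp (1 * wsum (volume n) \<eta>))") auto
    obtain B :: nat where B: "v \<le> real B" using real_arch_simple by blast
    have "wsum (volume n) \<eta> \<le> real B" for n
    proof -
      have "ennreal (exp (1 * wsum (volume n) \<eta>)) \<le> ennreal v" unfolding v(1)[symmetric] by (rule SUP_upper) simp
      then have "exp (wsum (volume n) \<eta>) \<le> v" using v(2) by simp
      then show ?thesis using B exp_ge_add_one_self[of "wsum (volume n) \<eta>"] by linarith
    qed
    then show "\<eta> \<in> tempered" unfolding tempered_iff by blast
  qed
qed

lemma moment_bounded_norm:
  assumes "moment_bounded \<mu>" "sets \<mu> = sets borel" "0 < l"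
  shows "(\<integral>\<^sup>+\<eta>. ennreal (exp (l * (\<Sum>\<^sub>\<infinity>x. \<bar>\<eta> x\<bar> powr p * w x))) \<partial>\<mu>) \<le> ennreal (exp (log_bound l))"
proof -
  have "(\<integral>\<^sup>+\<eta>. ennreal (exp (l * (\<Sum>\<^sub>\<infinity>x. \<bar>\<eta> x\<bar> powr p * w x))) \<partial>\<mu>) =
    (\<integral>\<^sup>+\<eta>. (SUP n. ennreal (exp (l * wsum (volume n) \<eta>))) \<partial>\<mu>)"
  \<comment> \<open>The set on which the infinite sum has its default value is null here.\<close>
  proof (rule nn_integral_cong_AE)
    show "AE \<eta> in \<mu>. ennreal (exp (l * (\<Sum>\<^sub>\<infinity>x. \<bar>\<eta> x\<bar> powr p * w x))) = (SUP n. ennreal (exp (l * wsum (volume n) \<eta>)))"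
      using moment_bounded_AE_tempered[OF assms(1,2)] exp_infsum_eq_SUP[OF _ assms(3)] by (auto elim!: AE_mp)
  qed
  then show ?thesis using moment_bounded_SUP[OF assms] by simp
qed

lemma moment_bounded_site:
  assumes "moment_bounded \<mu>" "0 < l"
  shows "(\<integral>\<^sup>+\<eta>. ennreal (exp (l * \<bar>\<eta> x\<bar> powr p)) \<partial>\<mu>) \<le> ennreal (exp (log_bound (l / w x)))"
proof -
  have "l / w x * wsum {x} \<eta> = l * \<bar>\<eta> x\<bar> powr p" for \<eta>
    using w_pos[of x] by (simp add: wsum_def)
  then show ?thesis
    using assms(1)[unfolded moment_bounded_def, rule_format, of "l / w x" "{x}"] assms(2) w_pos[of x] by simp
qed

definition tempered_gibbs :: "('v \<Rightarrow> real) measure set" where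
  "tempered_gibbs = {\<mu> \<in> gibbs_measures adj W V. measure \<mu> tempered = 1}"

text \<open>Replaces the support condition by one that is closed under weak limits; this is how
  limits are recognised as tempered.\<close>

lemma tempered_gibbs_iff:
  "\<mu> \<in> tempered_gibbs \<longleftrightarrow> \<mu> \<in> gibbs_measures adj W V \<and> moment_bounded \<mu>"
proof
  assume "\<mu> \<in> tempered_gibbs"
  then show "\<mu> \<in> gibbs_measures adj W V \<and> moment_bounded \<mu>"
    using gibbs_moment_bounded by (auto simp: tempered_gibbs_def)
next
  assume *: "\<mu> \<in> gibbs_measures adj W V \<and> moment_bounded \<mu>"
  then have "prob_space \<mu>" and s[measurable_cong]: "sets \<mu> = sets borel" using gibbs_iff by auto
  then interpret prob_space \<mu> by simp
  have "measure \<mu> tempered = 1"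
    using moment_bounded_AE_tempered[OF _ s] * by (subst prob_eq_1) auto
  then show "\<mu> \<in> tempered_gibbs" using * by (simp add: tempered_gibbs_def)
qed

section \<open>Tightness, weak limits and compactness\<close>

lemma moment_bounded_tight:
  assumes "0 < e"
  shows "\<exists>R. \<forall>\<mu>. prob_space \<mu> \<longrightarrow> sets \<mu> = sets borel \<longrightarrow> moment_bounded \<mu> \<longrightarrow> measure \<mu> {\<omega>. \<bar>\<omega> x\<bar> > R} \<le> e"
proof -
  \<comment> \<open>Chebyshev's inequality gives the tail bound
    \<open>exp (log_bound 1 - T * w x)\<close>, which this \<open>T\<close> makes at most
    \<open>e\<close>; the maximum with 0 ensures that \<open>R\<close> has p-th power
    \<open>T\<close>.\<close>
  define T where "T = max 0 ((log_bound 1 - ln e) / w x)"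
  define R where "R = T powr (1 / p)"
  have RT: "R powr p = T" unfolding R_def T_def using p_pos by (simp add: powr_powr)
  have "measure \<mu> {\<omega>. \<bar>\<omega> x\<bar> > R} \<le> e"
    if \<mu>: "prob_space \<mu>" and s[measurable_cong]: "sets \<mu> = sets borel" and mb: "moment_bounded \<mu>" for \<mu>
  proof -
    interpret prob_space \<mu> by fact
    have [simp]: "space \<mu> = UNIV" using sets_eq_imp_space_eq[OF s] by simp
    define A where "A = {\<omega> :: 'v \<Rightarrow> real. \<bar>\<omega> x\<bar> > R}"
    have [measurable]: "A \<in> sets borel" unfolding A_def by measurable
    have "ennreal (exp (T * w x)) * emeasure \<mu> A = (\<integral>\<^sup>+\<omega>. ennreal (exp (T * w x)) * indicator A \<omega> \<partial>\<mu>)"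
      by (simp add: nn_integral_cmult_indicator)
    also have "\<dots> \<le> (\<integral>\<^sup>+\<omega>. ennreal (exp (1 * wsum {x} \<omega>)) \<partial>\<mu>)"
    proof (rule nn_integral_mono)
      fix \<omega>
      show "ennreal (exp (T * w x)) * indicator A \<omega> \<le> ennreal (exp (1 * wsum {x} \<omega>))"
      proof (cases "\<omega> \<in> A")
        case True
        then have "R powr p \<le> \<bar>\<omega> x\<bar> powr p"
          unfolding A_def R_def using p_pos by (intro powr_mono2) auto
        then have "T * w x \<le> wsum {x} \<omega>"
          unfolding RT wsum_def using w_pos[of x] by (simp add: mult_right_mono)
        then show ?thesis using True by simp
      qed simp
    qed
    also have "\<dots> \<le> ennreal (exp (log_bound 1))"
      using mb[unfolded moment_bounded_def, rule_format, of 1 "{x}"] by simp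
    finally have "exp (T * w x) * measure \<mu> A \<le> exp (log_bound 1)"
      by (simp add: emeasure_eq_measure ennreal_mult[symmetric])
    moreover have "exp (log_bound 1) \<le> exp (T * w x) * e"
    proof -
      have "(log_bound 1 - ln e) / w x * w x \<le> T * w x"
        unfolding T_def using w_pos[of x] by (intro mult_right_mono) auto
      then have "log_bound 1 \<le> T * w x + ln e" using w_pos[of x] by simp
      then have "exp (log_bound 1) \<le> exp (T * w x + ln e)" by simp
      then show ?thesis using assms by (simp add: exp_add)
    qed
    ultimately have "exp (T * w x) * measure \<mu> A \<le> exp (T * w x) * e" by linarith
    then show ?thesis unfolding A_def by simp
  qed
  then show ?thesis by blast
qed

text \<open>Truncated exponentials of \<open>wsum F\<close> are bounded and continuous, so the bound
  passes to the limit at each level; then the level is removed.\<close>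

lemma moment_bounded_limit:
  assumes lim: "converges_weakly \<mu>s \<mu>" and \<mu>: "prob_space \<mu>" "sets \<mu> = sets borel"
    and \<mu>s: "\<And>n. prob_space (\<mu>s n)" "\<And>n. sets (\<mu>s n) = sets borel" "\<And>n. moment_bounded (\<mu>s n)"
  shows "moment_bounded \<mu>"
  unfolding moment_bounded_def
proof (intro allI impI)
  fix l :: real and F :: "'v set" assume l: "0 < l" and F: "finite F"
  note [measurable_cong] = \<mu>(2) \<mu>s(2)
  show "(\<integral>\<^sup>+\<eta>. ennreal (exp (l * wsum F \<eta>)) \<partial>\<mu>) \<le> ennreal (exp (log_bound l))"
  proof (rule nn_integral_le_of_truncations)
    show "(\<lambda>\<eta>. exp (l * wsum F \<eta>)) \<in> borel_measurable \<mu>" by measurable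
    fix k :: nat
    let ?g = "\<lambda>\<eta>. min (real k) (exp (l * wsum F \<eta>))"
    have g: "\<bar>?g \<eta>\<bar> \<le> real k" "0 \<le> ?g \<eta>" for \<eta> by auto
    have int: "integrable M ?g" and nn: "(\<integral>\<^sup>+\<eta>. ennreal (?g \<eta>) \<partial>M) = ennreal (\<integral>\<eta>. ?g \<eta> \<partial>M)"
      if "prob_space M" and s[measurable_cong]: "sets M = sets borel" for M
    proof -
      interpret M: prob_space M by fact
      show int: "integrable M ?g"
        by (rule M.integrable_const_bound[of _ "real k"]) (auto simp: g)
      show "(\<integral>\<^sup>+\<eta>. ennreal (?g \<eta>) \<partial>M) = ennreal (\<integral>\<eta>. ?g \<eta> \<partial>M)"
        by (rule nn_integral_eq_integral[OF int]) (simp add: g)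
    qed
    have "(\<integral>\<eta>. ?g \<eta> \<partial>\<mu>s n) \<le> exp (log_bound l)" for n
    proof -
      have "ennreal (\<integral>\<eta>. ?g \<eta> \<partial>\<mu>s n) \<le> (\<integral>\<^sup>+\<eta>. ennreal (exp (l * wsum F \<eta>)) \<partial>\<mu>s n)"
        unfolding nn[OF \<mu>s(1,2), symmetric] by (intro nn_integral_mono ennreal_leI) simp
      also have "\<dots> \<le> ennreal (exp (log_bound l))"
        using \<mu>s(3)[of n] l F unfolding moment_bounded_def by blast
      finally show ?thesis by simp
    qed
    moreover have "(\<lambda>n. \<integral>\<eta>. ?g \<eta> \<partial>\<mu>s n) \<longlonglongrightarrow> (\<integral>\<eta>. ?g \<eta> \<partial>\<mu>)"
      by (rule converges_weaklyD[OF lim _ g(1)])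
         (intro continuous_on_min continuous_on_const continuous_on_exp continuous_on_mult continuous_on_wsum)
    ultimately have "(\<integral>\<eta>. ?g \<eta> \<partial>\<mu>) \<le> exp (log_bound l)"
      by (intro LIMSEQ_le_const2) auto
    then show "(\<integral>\<^sup>+\<eta>. ennreal (?g \<eta>) \<partial>\<mu>) \<le> ennreal (exp (log_bound l))"
      unfolding nn[OF \<mu>] by (rule ennreal_leI)
  qed
qed

lemma kernel_bind_kernel:
  assumes "finite \<Lambda>" "\<Delta> \<subseteq> \<Lambda>"
  shows "kernel \<Lambda> \<xi> \<bind> kernel \<Delta> = kernel \<Lambda> \<xi>"
proof (rule measure_eqI)
  have fin: "finite \<Delta>" using assms finite_subset by blast
  show sets: "sets (kernel \<Lambda> \<xi> \<bind> kernel \<Delta>) = sets (kernel \<Lambda> \<xi>)"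
    by (subst sets_bind[where N = borel]) auto
  have k: "kernel \<Delta> \<in> kernel \<Lambda> \<xi> \<rightarrow>\<^sub>M subprob_algebra borel"
    using kernel_measurable_subprob[OF fin] by (simp cong: measurable_cong_sets)
  fix A assume "A \<in> sets (kernel \<Lambda> \<xi> \<bind> kernel \<Delta>)"
  then have A[measurable]: "A \<in> sets borel" using sets by simp
  have "emeasure (kernel \<Lambda> \<xi> \<bind> kernel \<Delta>) A = (\<integral>\<^sup>+\<eta>. (\<integral>\<^sup>+\<zeta>. indicator A \<zeta> \<partial>kernel \<Delta> \<eta>) \<partial>kernel \<Lambda> \<xi>)"
    using A by (subst emeasure_bind[OF _ k]) auto
  also have "\<dots> = emeasure (kernel \<Lambda> \<xi>) A"
    using assms A by (subst kernel_consistent) auto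
  finally show "emeasure (kernel \<Lambda> \<xi> \<bind> kernel \<Delta>) A = emeasure (kernel \<Lambda> \<xi>) A" .
qed

text \<open>By the Feller property the kernel average of a test function is again a test function,
  so both sides of the invariance pass to the limit. Invariance is asked only eventually, as
  finite-volume measures are known to satisfy it once the volume contains \<Lambda>.\<close>

lemma bind_kernel_limit:
  assumes lim: "converges_weakly \<mu>s \<mu>" and \<mu>: "prob_space \<mu>" "sets \<mu> = sets borel"
    and \<mu>s: "\<And>n. prob_space (\<mu>s n)" "\<And>n. sets (\<mu>s n) = sets borel"
    and fin: "finite \<Lambda>" and ev: "\<forall>\<^sub>F n in sequentially. \<mu>s n \<bind> kernel \<Lambda> = \<mu>s n"
  shows "\<mu> \<bind> kernel \<Lambda> = \<mu>"
proof -
  obtain d :: "nat list \<times> nat \<Rightarrow> ('v \<Rightarrow> real) \<Rightarrow> real" where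
    D: "(\<forall>i. continuous_on UNIV (d i)) \<and> (\<forall>i z. \<bar>d i z\<bar> \<le> 1) \<and>
    (\<forall>\<mu> \<nu>. prob_space \<mu> \<longrightarrow> prob_space \<nu> \<longrightarrow> sets \<mu> = sets borel \<longrightarrow> sets \<nu> = sets borel \<longrightarrow>
       (\<forall>i. (\<integral>z. d i z \<partial>\<mu>) = (\<integral>z. d i z \<partial>\<nu>)) \<longrightarrow> \<mu> = \<nu>)"
    using countable_determining_family ..
  note d = D[THEN conjunct1, rule_format] D[THEN conjunct2, THEN conjunct1, rule_format]
    and det = D[THEN conjunct2, THEN conjunct2, rule_format]
  have in_alg: "M \<in> space (prob_algebra borel)" if "prob_space M" "sets M = sets borel" for M :: "('v \<Rightarrow> real) measure"
    using that by (simp add: space_prob_algebra)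
  have int_bind: "(\<integral>z. d i z \<partial>(M \<bind> kernel \<Lambda>)) = (\<integral>\<xi>. (\<integral>z. d i z \<partial>kernel \<Lambda> \<xi>) \<partial>M)"
    if M: "prob_space M" "sets M = sets borel" for i M
  proof -
    interpret prob_space M by fact
    have [measurable]: "d i \<in> borel_measurable borel" using d(1) by (rule borel_measurable_continuous_onI)
    show ?thesis
    proof (rule integral_bind)
      show "kernel \<Lambda> \<in> M \<rightarrow>\<^sub>M subprob_algebra borel"
        using kernel_measurable_subprob[OF fin] M(2) by (simp cong: measurable_cong_sets)
      show "AE x in M. emeasure (kernel \<Lambda> x) (space (kernel \<Lambda> x)) \<le> ennreal 1"
        using prob_space.emeasure_space_1[OF prob_space_kernel[OF fin]] by (intro AE_I2) simp
      show "\<bar>d i x\<bar> \<le> 1" for x using d(2) .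
    qed (auto intro: finite_measure_axioms)
  qed
  show ?thesis
  proof (rule det)
    show "prob_space (\<mu> \<bind> kernel \<Lambda>)"
      using prob_space_bind'[OF in_alg[OF \<mu>] kernel_measurable[OF fin]] .
    show "sets (\<mu> \<bind> kernel \<Lambda>) = sets borel"
      using sets_bind'[OF in_alg[OF \<mu>] kernel_measurable[OF fin]] .
    fix i
    have kB: "\<bar>\<integral>z. d i z \<partial>kernel \<Lambda> \<xi>\<bar> \<le> 1" for \<xi>
    proof -
      interpret K: prob_space "kernel \<Lambda> \<xi>" by (rule prob_space_kernel[OF fin])
      have [measurable]: "d i \<in> borel_measurable borel" using d(1) by (rule borel_measurable_continuous_onI)
      have int: "integrable (kernel \<Lambda> \<xi>) (d i)"
        by (rule K.integrable_const_bound[of _ 1]) (auto simp: d)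
      have "\<bar>\<integral>z. d i z \<partial>kernel \<Lambda> \<xi>\<bar> \<le> (\<integral>z. \<bar>d i z\<bar> \<partial>kernel \<Lambda> \<xi>)" by (rule integral_abs_bound)
      also have "\<dots> \<le> (\<integral>z. 1 \<partial>kernel \<Lambda> \<xi>)" using int d(2) by (intro integral_mono) auto
      also have "\<dots> = 1" using K.prob_space by simp
      finally show ?thesis .
    qed
    have "(\<lambda>n. \<integral>\<xi>. (\<integral>z. d i z \<partial>kernel \<Lambda> \<xi>) \<partial>\<mu>s n) \<longlonglongrightarrow> (\<integral>\<xi>. (\<integral>z. d i z \<partial>kernel \<Lambda> \<xi>) \<partial>\<mu>)"
      by (rule converges_weaklyD[OF lim kernel_feller[OF fin d] kB])
    moreover have "\<forall>\<^sub>F n in sequentially. (\<integral>\<xi>. (\<integral>z. d i z \<partial>kernel \<Lambda> \<xi>) \<partial>\<mu>s n) = (\<integral>z. d i z \<partial>\<mu>s n)"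
      using ev by (rule eventually_mono) (simp add: int_bind[OF \<mu>s, symmetric])
    ultimately have "(\<lambda>n. \<integral>z. d i z \<partial>\<mu>s n) \<longlonglongrightarrow> (\<integral>\<xi>. (\<integral>z. d i z \<partial>kernel \<Lambda> \<xi>) \<partial>\<mu>)"
      by (simp only: tendsto_cong)
    then show "(\<integral>z. d i z \<partial>(\<mu> \<bind> kernel \<Lambda>)) = (\<integral>z. d i z \<partial>\<mu>)"
      unfolding int_bind[OF \<mu>] using converges_weaklyD[OF lim d] by (rule LIMSEQ_unique)
  qed (use \<mu> in auto)
qed

text \<open>Common source of existence, applied to finite-volume measures, and of compactness,
  applied to tempered Gibbs measures.\<close>

lemma tempered_gibbs_limit:
  assumes \<mu>s: "\<And>n. prob_space (\<mu>s n)" "\<And>n. sets (\<mu>s n) = sets borel" "\<And>n. moment_bounded (\<mu>s n)"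
    and ev: "\<And>\<Lambda>. finite \<Lambda> \<Longrightarrow> \<Lambda> \<noteq> {} \<Longrightarrow> \<forall>\<^sub>F n in sequentially. \<mu>s n \<bind> kernel \<Lambda> = \<mu>s n"
  shows "\<exists>r \<mu>. strict_mono (r :: nat \<Rightarrow> nat) \<and> \<mu> \<in> tempered_gibbs \<and> converges_weakly (\<mu>s \<circ> r) \<mu>"
proof -
  have "\<exists>R. \<forall>n. measure (\<mu>s n) {\<omega>. \<bar>\<omega> x\<bar> > R} \<le> e" if "0 < e" for x e
    using moment_bounded_tight[OF that, of x] \<mu>s by metis
  then obtain r \<mu> where r: "strict_mono (r :: nat \<Rightarrow> nat)" and \<mu>: "prob_space \<mu>" "sets \<mu> = sets borel"
    and lim: "converges_weakly (\<mu>s \<circ> r) \<mu>"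
    using prokhorov_fun[of \<mu>s, OF \<mu>s(1,2)] by blast
  have "moment_bounded \<mu>"
    using moment_bounded_limit[OF lim \<mu>] \<mu>s by simp
  moreover have "\<mu> \<bind> kernel \<Lambda> = \<mu>" if "finite \<Lambda>" "\<Lambda> \<noteq> {}" for \<Lambda>
  proof (rule bind_kernel_limit[OF lim \<mu> _ _ that(1)])
    show "\<forall>\<^sub>F n in sequentially. (\<mu>s \<circ> r) n \<bind> kernel \<Lambda> = (\<mu>s \<circ> r) n"
      using eventually_subseq[OF r ev[OF that]] by simp
  qed (use \<mu>s in auto)
  ultimately have "\<mu> \<in> tempered_gibbs"
    using \<mu> by (auto simp: tempered_gibbs_iff gibbs_iff)
  then show ?thesis using r lim by blast
qed

lemma tempered_gibbs_nonempty: "tempered_gibbs \<noteq> {}"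
proof -
  define \<mu>s where "\<mu>s n = kernel (volume n) (\<lambda>_. 0)" for n
  have "moment_bounded (\<mu>s n)" for n
    unfolding moment_bounded_def
  proof (intro allI impI)
    fix l :: real and F :: "'v set" assume l: "0 < l" and F: "finite F"
    have "(\<integral>\<^sup>+\<eta>. ennreal (exp (l * wsum F \<eta>)) \<partial>\<mu>s n) \<le> (\<integral>\<^sup>+\<eta>. ennreal (exp (l * wsum (volume n) \<eta>)) \<partial>\<mu>s n)"
      unfolding \<mu>s_def
    proof (rule nn_integral_mono_AE, rule AE_mp[OF AE_kernel_outside], intro AE_I2 impI)
      \<comment> \<open>With zero boundary condition the spins outside the volume vanish almost
        surely, so an arbitrary \<open>F\<close> reduces to its part inside.\<close>
      fix \<eta> :: "'v \<Rightarrow> real" assume \<eta>: "\<forall>y. y \<notin> volume n \<longrightarrow> \<eta> y = 0"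
      have "wsum F \<eta> = wsum (F \<inter> volume n) \<eta>"
        unfolding wsum_def using F \<eta> by (intro sum.mono_neutral_right) auto
      also have "\<dots> \<le> wsum (volume n) \<eta>" by (intro wsum_mono finite_volume) auto
      finally show "ennreal (exp (l * wsum F \<eta>)) \<le> ennreal (exp (l * wsum (volume n) \<eta>))"
        using l by (simp add: ennreal_leI)
    qed
    also have "\<dots> \<le> ennreal (exp (log_bound l + l * wsum (boundary (volume n)) (\<lambda>_. 0)))"
      unfolding \<mu>s_def by (rule kernel_wsum_bound[OF l finite_volume])
    also have "\<dots> = ennreal (exp (log_bound l))" by (simp add: wsum_def)
    finally show "(\<integral>\<^sup>+\<eta>. ennreal (exp (l * wsum F \<eta>)) \<partial>\<mu>s n) \<le> ennreal (exp (log_bound l))" .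
  qed
  moreover have "\<forall>\<^sub>F n in sequentially. \<mu>s n \<bind> kernel \<Lambda> = \<mu>s n" if "finite \<Lambda>" for \<Lambda>
    using eventually_subset_volume[OF that]
    unfolding \<mu>s_def by (rule eventually_mono) (rule kernel_bind_kernel[OF finite_volume])
  ultimately show ?thesis
    using tempered_gibbs_limit[of \<mu>s] prob_space_kernel[OF finite_volume] by (auto simp: \<mu>s_def)
qed

lemma tempered_gibbs_compact: "compactin weak_topology tempered_gibbs"
proof (rule compactin_weak_topologyI)
  show "tempered_gibbs \<subseteq> prob_measures"
    by (auto simp: tempered_gibbs_def gibbs_measures_def)
  fix \<mu>s :: "nat \<Rightarrow> ('v \<Rightarrow> real) measure" assume \<mu>s: "\<And>n. \<mu>s n \<in> tempered_gibbs"
  then have g: "\<mu>s n \<in> gibbs_measures adj W V" "moment_bounded (\<mu>s n)" for n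
    by (auto simp: tempered_gibbs_iff)
  show "\<exists>r \<mu>. strict_mono (r :: nat \<Rightarrow> nat) \<and> \<mu> \<in> tempered_gibbs \<and> converges_weakly (\<mu>s \<circ> r) \<mu>"
    using g by (intro tempered_gibbs_limit) (auto simp: gibbs_iff)
qed

end

section \<open>The weights of a connected graph\<close>

lemma graph_dist_adj_le:
  assumes sym: "\<And>x y. adj x y \<Longrightarrow> adj y x" and connected: "\<And>x y. adj\<^sup>*\<^sup>* x y" and "adj x y"
  shows "\<bar>real (graph_dist adj o' x) - real (graph_dist adj o' y)\<bar> \<le> 1"
proof -
  have le: "graph_dist adj o' y \<le> Suc (graph_dist adj o' x)" if "adj x y" for x y
  proof -
    obtain n where "(adj ^^ n) o' x" using connected[of o' x] by (auto dest: rtranclp_imp_relpowp)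
    then have "(adj ^^ graph_dist adj o' x) o' x" unfolding graph_dist_def by (rule LeastI)
    then have "(adj ^^ Suc (graph_dist adj o' x)) o' y" using that by (rule relpowp_Suc_I)
    then show ?thesis unfolding graph_dist_def by (rule Least_le)
  qed
  from le[OF assms(3)] le[OF sym[OF assms(3)]] show ?thesis by linarith
qed

text \<open>Distances to the root differ by at most 1 across an edge. The absolute value covers
  negative \<alpha>, which are admissible for instance on a finite graph.\<close>

lemma weight_adj_le:
  assumes "\<And>x y. adj x y \<Longrightarrow> adj y x" "\<And>x y. adj\<^sup>*\<^sup>* x y" "adj x y"
  shows "weight adj o' \<alpha> x \<le> exp \<bar>\<alpha>\<bar> * weight adj o' \<alpha> y"
proof -
  have "\<alpha> * (real (graph_dist adj o' y) - real (graph_dist adj o' x)) \<le>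
    \<bar>\<alpha>\<bar> * \<bar>real (graph_dist adj o' y) - real (graph_dist adj o' x)\<bar>"
    by (metis abs_ge_self abs_mult)
  also have "\<dots> \<le> \<bar>\<alpha>\<bar> * 1"
    using graph_dist_adj_le[OF assms, of o'] by (intro mult_left_mono) auto
  finally show ?thesis
    unfolding weight_def exp_add[symmetric] by (simp add: algebra_simps)
qed

text \<open>\<open>Theta\<close> controls only \<open>m_theta\<close>. Without isolated vertices
  \<open>m_theta\<close> is at least 1 and pays for the additional 1; a connected graph with an
  isolated vertex consists of that vertex alone.\<close>

lemma sum_m_theta_weight_bounded:
  assumes sym: "\<And>x y. adj x y \<Longrightarrow> adj y x" and loc_fin: "\<And>x. finite {y. adj x y}"
    and connected: "\<And>x y. adj\<^sup>*\<^sup>* x y" and "0 < \<theta>"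
    and fin: "Theta adj o' \<alpha> \<theta> < \<infinity>"
  shows "\<exists>M. \<forall>F. finite F \<longrightarrow> (\<Sum>x\<in>F. (1 + m_theta adj \<theta> x) * weight adj o' \<alpha> x) \<le> M"
proof -
  have m0: "0 \<le> m_theta adj \<theta> x" for x unfolding m_theta_def by (intro sum_nonneg) auto
  have w0: "0 < weight adj o' \<alpha> x" for x by (simp add: weight_def)
  obtain T where T: "Theta adj o' \<alpha> \<theta> = ennreal T" "0 \<le> T"
    using fin by (cases "Theta adj o' \<alpha> \<theta>") auto
  have sum_le: "(\<Sum>x\<in>F. m_theta adj \<theta> x * weight adj o' \<alpha> x) \<le> T" if "finite F" for F
  proof -
    have "ennreal (\<Sum>x\<in>F. m_theta adj \<theta> x * weight adj o' \<alpha> x) = (\<Sum>x\<in>F. ennreal (m_theta adj \<theta> x * weight adj o' \<alpha> x))"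
      using m0 w0 by (intro sum_ennreal[symmetric]) (auto simp: less_imp_le)
    also have "\<dots> \<le> Theta adj o' \<alpha> \<theta>"
      unfolding Theta_def nonneg_infsum_complete[OF zero_le] using that by (intro SUP_upper) auto
    finally show ?thesis using T by simp
  qed
  show ?thesis
  proof (cases "\<exists>x. {y. adj x y} = {}")
    case True
    then obtain x where x: "{y. adj x y} = {}" by blast
    have "y = x" for y using connected[of x y] x by (auto elim: converse_rtranclpE)
    then have "F \<subseteq> {x}" for F by auto
    then have "(\<Sum>y\<in>F. (1 + m_theta adj \<theta> y) * weight adj o' \<alpha> y) \<le> (\<Sum>y\<in>{x}. (1 + m_theta adj \<theta> y) * weight adj o' \<alpha> y)" for F
      using m0 w0 by (intro sum_mono2) (auto intro!: mult_nonneg_nonneg add_nonneg_nonneg simp: less_imp_le)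
    then show ?thesis by blast
  next
    case False
    have m1: "1 \<le> m_theta adj \<theta> x" for x
    proof -
      have d: "1 \<le> real (degree adj z)" for z
        using False loc_fin[of z] by (auto simp: degree_def card_gt_0_iff Suc_le_eq)
      obtain y where y: "adj x y" using False by auto
      have "1 * 1 \<le> real (degree adj x) * real (degree adj y)" using d by (intro mult_mono) auto
      then have "1 \<le> (real (degree adj x) * real (degree adj y)) powr \<theta>"
        using \<open>0 < \<theta>\<close> by (intro ge_one_powr_ge_zero) auto
      also have "\<dots> \<le> m_theta adj \<theta> x"
        unfolding m_theta_def using loc_fin y
        by (intro member_le_sum[where f = "\<lambda>y. (real (degree adj x) * real (degree adj y)) powr \<theta>"]) auto
      finally show ?thesis .
    qed
    have "(\<Sum>x\<in>F. (1 + m_theta adj \<theta> x) * weight adj o' \<alpha> x) \<le> 2 * T" if "finite F" for F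
    proof -
      have "(\<Sum>x\<in>F. (1 + m_theta adj \<theta> x) * weight adj o' \<alpha> x) \<le> (\<Sum>x\<in>F. 2 * (m_theta adj \<theta> x * weight adj o' \<alpha> x))"
      proof (rule sum_mono)
        fix x
        have "(1 + m_theta adj \<theta> x) * weight adj o' \<alpha> x \<le> (2 * m_theta adj \<theta> x) * weight adj o' \<alpha> x"
          using m1[of x] w0[of x] by (intro mult_right_mono) auto
        then show "(1 + m_theta adj \<theta> x) * weight adj o' \<alpha> x \<le> 2 * (m_theta adj \<theta> x * weight adj o' \<alpha> x)" by simp
      qed
      also have "\<dots> \<le> 2 * T" using sum_le[OF that] by (simp add: sum_distrib_left[symmetric])
      finally show ?thesis .
    qed
    then show ?thesis by blast
  qed
qed

theorem theorem3p1:
  fixes adj :: "'v::countable \<Rightarrow> 'v \<Rightarrow> bool" and o' :: 'v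
    and \<theta> I\<^sub>W J\<^sub>W r a\<^sub>V c\<^sub>V q :: real
    and W :: "real \<Rightarrow> real \<Rightarrow> real" and V :: "real \<Rightarrow> real"
    and \<alpha>_lo :: ereal and \<alpha>_hi \<alpha> p :: real
  assumes sym: "\<And>x y. adj x y \<Longrightarrow> adj y x"
    and irrefl: "\<And>x. \<not> adj x x"
    and loc_fin: "\<And>x. finite {y. adj x y}"
    and connected: "\<And>x y. adj\<^sup>*\<^sup>* x y"
    and theta_pos: "\<theta> > 0"
    and Theta_fin: "\<exists>\<alpha>>0. Theta adj o' \<alpha> \<theta> < \<infinity>"
    and W_cont: "continuous_on UNIV (\<lambda>(u,v). W u v)"
    and W_sym: "\<And>u v. W u v = W v u"
    and W_params: "I\<^sub>W > 0" "J\<^sub>W > 0" "r > 0"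
    and W_bound: "\<And>u v. \<bar>W u v\<bar> \<le> (I\<^sub>W + J\<^sub>W * (\<bar>u\<bar> powr r + \<bar>v\<bar> powr r)) / 2"
    and V_cont: "continuous_on UNIV V"
    and V_params: "a\<^sub>V > 0" "c\<^sub>V > 0"
    and V_bound: "\<And>u. V u \<ge> a\<^sub>V * \<bar>u\<bar> powr q - c\<^sub>V"
    and q_gt: "q > r + r / \<theta>"
    and alpha_lo_def: "\<alpha>_lo = Inf {ereal \<beta> | \<beta>. Theta adj o' \<beta> \<theta> < \<infinity>}"
    and alpha_hi_gt: "ereal \<alpha>_hi > \<alpha>_lo"
    and alpha_hi_fin: "\<And>\<beta>. ereal \<beta> > \<alpha>_lo \<Longrightarrow> \<beta> \<le> \<alpha>_hi \<Longrightarrow> Theta adj o' \<beta> \<theta> < \<infinity>"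
    and alpha_range: "ereal \<alpha> > \<alpha>_lo" "\<alpha> \<le> \<alpha>_hi"
    and p_range: "r + r / \<theta> \<le> p" "p < q"
  shows "gibbs_Lp adj W V o' p \<alpha> \<noteq> {}
    \<and> compactin weak_topology (gibbs_Lp adj W V o' p \<alpha>)
    \<and> (\<forall>lam>0. \<forall>x. \<exists>C>0. \<forall>\<mu>\<in>gibbs_Lp adj W V o' p \<alpha>.
          (\<integral>\<^sup>+ \<omega>. ennreal (exp (lam * \<bar>\<omega> x\<bar> powr p)) \<partial>\<mu>) \<le> ennreal C)
    \<and> (\<forall>lam>0. \<exists>C>0. \<forall>\<mu>\<in>gibbs_Lp adj W V o' p \<alpha>.
          (\<integral>\<^sup>+ \<omega>. ennreal (exp (lam * norm_pow adj o' p \<alpha> \<omega>)) \<partial>\<mu>) \<le> ennreal C)"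
proof -
  \<comment> \<open>The range hypotheses on \<alpha> are consumed here, to make \<open>Theta\<close>
    finite at \<alpha> itself.\<close>
  have Theta: "Theta adj o' \<alpha> \<theta> < \<infinity>"
    using alpha_hi_fin alpha_range by blast
  obtain M where M: "\<And>F. finite F \<Longrightarrow> (\<Sum>x\<in>F. (1 + m_theta adj \<theta> x) * weight adj o' \<alpha> x) \<le> M"
    using sum_m_theta_weight_bounded[OF sym loc_fin connected theta_pos Theta] by blast
  have r_q: "r < q"
  proof -
    have "0 < r / \<theta>" using W_params theta_pos by simp
    then show ?thesis using q_gt by linarith
  qed
  interpret tempered_spin_system adj W V I\<^sub>W J\<^sub>W r a\<^sub>V c\<^sub>V q "weight adj o' \<alpha>" \<theta> p "exp \<bar>\<alpha>\<bar>" M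
  proof
    show "0 < weight adj o' \<alpha> x" for x by (simp add: weight_def)
    show "weight adj o' \<alpha> x \<le> exp \<bar>\<alpha>\<bar> * weight adj o' \<alpha> y" if "adj x y" for x y
      using sym connected that by (rule weight_adj_le)
  qed (fact sym loc_fin W_cont W_sym W_params W_bound V_params(1) V_cont V_bound r_q irrefl theta_pos
      p_range M | simp)+
  have G: "gibbs_Lp adj W V o' p \<alpha> = tempered_gibbs"
    by (simp add: gibbs_Lp_def tempered_gibbs_def Lp_set_def tempered_def)
  have mb: "moment_bounded \<mu>" "sets \<mu> = sets borel" if "\<mu> \<in> tempered_gibbs" for \<mu>
    using that by (auto simp: tempered_gibbs_iff gibbs_iff)
  show ?thesis
    unfolding G norm_pow_def
  proof (intro conjI allI impI)
    show "tempered_gibbs \<noteq> {}" by (rule tempered_gibbs_nonempty)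
    show "compactin weak_topology tempered_gibbs" by (rule tempered_gibbs_compact)
    show "\<exists>C>0. \<forall>\<mu>\<in>tempered_gibbs. (\<integral>\<^sup>+ \<omega>. ennreal (exp (lam * \<bar>\<omega> x\<bar> powr p)) \<partial>\<mu>) \<le> ennreal C"
      if "0 < lam" for lam x
      using moment_bounded_site[OF mb(1) that]
      by (intro exI[of _ "exp (log_bound (lam / weight adj o' \<alpha> x))"]) auto
    show "\<exists>C>0. \<forall>\<mu>\<in>tempered_gibbs.
        (\<integral>\<^sup>+ \<omega>. ennreal (exp (lam * (\<Sum>\<^sub>\<infinity>x. \<bar>\<omega> x\<bar> powr p * weight adj o' \<alpha> x))) \<partial>\<mu>) \<le> ennreal C"
      if "0 < lam" for lam
      using moment_bounded_norm[OF mb that] by (intro exI[of _ "exp (log_bound lam)"]) auto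
  qed
qed

end
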